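(* Let $\mathbb{F}$ be an algebraically closed field with $\mathrm{Char}(\mathbb{F}) \neq 2$. Let $A,A^*$ denote a Leonard pair over $\mathbb{F}$ with diameter $d \geq 3$. Then $A,A^*$ is near-bipartite if and only if at least one of the following (i)--(iii) holds: (i) $A,A^*$ is essentially bipartite; (ii) $A,A^*$ has reinforced dual $q$-Krawtchouk type; (iii) $A,A^*$ has Krawtchouk type.
   Context: A tridiagonal matrix is irreducible if all its subdiagonal and superdiagonal entries are nonzero. Let $V$ be a vector space over $\mathbb{F}$ of dimension $d+1$. A Leonard pair on $V$ (with diameter $d$, over $\mathbb{F}$) is an ordered pair $A,A^*$ in $\mathrm{End}(V)$ such that (a) some basis of $V$ makes the matrix of $A$ irreducible tridiagonal and that of $A^*$ diagonal; (b) some basis of $V$ makes the matrix of $A^*$ irreducible tridiagonal and that of $A$ diagonal. ($A^*$ is just a name, not an adjoint.) Each of $A,A^*$ then has $d+1$ distinct eigenvalues. Flat part: let $E^*_0,\dots,E^*_d$ be the primitive idempotents of $A^*$ (projections onto its eigenspaces along the sum of the other eigenspaces). The flat part of $A$ is $F=\sum_{i=0}^d E^*_i A E^*_i$. The Leonard pair $A,A^*$ is essentially bipartite if $F$ is a scalar multiple of the identity, and near-bipartite if $A-F,A^*$ is a Leonard pair on $V$. Parameter array: an ordering $\{\theta_i\}_{i=0}^d$ of the eigenvalues of $A$ is standard if in some basis $A$ is $\mathrm{diag}(\theta_0,\dots,\theta_d)$ and $A^*$ is irreducible tridiagonal; a standard ordering $\{\theta^*_i\}_{i=0}^d$ of the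 eigenvalues of $A^*$ is defined with the roles of $A$ and $A^*$ exchanged. Given standard orderings, there are unique scalars $\{\varphi_i\}_{i=1}^d$ such that in some basis $A$ is lower bidiagonal with diagonal $\theta_0,\dots,\theta_d$ and all subdiagonal entries $1$, while $A^*$ is upper bidiagonal with diagonal $\theta^*_0,\dots,\theta^*_d$ and superdiagonal $\varphi_1,\dots,\varphi_d$; and unique scalars $\{\phi_i\}_{i=1}^d$ such that in some basis $A$ is lower bidiagonal with diagonal $\theta_d,\theta_{d-1},\dots,\theta_0$ and all subdiagonal entries $1$, while $A^*$ is upper bidiagonal with diagonal $\theta^*_0,\dots,\theta^*_d$ and superdiagonal $\phi_1,\dots,\phi_d$. The sequence $(\{\theta_i\};\{\theta^*_i\};\{\varphi_i\};\{\phi_i\})$ is a parameter array of $A,A^*$. Types: for $d\ge 3$ it is known that $\frac{\theta_{i-2}-\theta_{i+1}}{\theta_{i-1}-\theta_i}$ and $\frac{\theta^*_{i-2}-\theta^*_{i+1}}{\theta^*_{i-1}-\theta^*_i}$ are equal and independent of $i$ for $2\le i\le d-1$; their common value is written $\beta+1$, and $\beta$ is the fundamental constant of $A,A^*$ (it does not depend on the chosen parameter array). $A,A^*$ has type I if $\beta\neq\pm 2$, and type II if $\beta=2$. For type I, write $\beta=q^2+q^{-2}$ with $0\ne q\in\mathbb{F}$ (so $q^4\neq 1$). Let $(\{\theta_i\};\{\theta^*_i\};\{\varphi_i\};\{\phi_i\})$ be a parameter array of $A,A^*$. $A,A^*$ has dual $q$-Krawtchouk type if it has type I, $(\theta^*_{i-1}-\theta^*_i)/(\theta^*_i-\theta^*_{i+1})$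 is independent of $i$ for $1\le i\le d-1$, and $\varphi_i/\phi_i$ is independent of $i$ for $1\le i\le d$. Such a pair is reinforced if $q^{2i}\neq -1$ for $1\le i\le d-1$. $A,A^*$ has Krawtchouk type if it has type II and both $\theta_i-\theta_{i-1}$ and $\theta^*_i-\theta^*_{i-1}$ are independent of $i$ for $1\le i\le d$. (These notions do not depend on the choice of parameter array or of $q$.) *)

theory Defs
  imports
    "HOL-Computational_Algebra.Polynomial"
    "Jordan_Normal_Form.Matrix"
begin

text \<open>
  The vector space \<open>V\<close> is the whole type \<open>'b\<close>, over the field \<open>'a\<close>, with scalar multiplication \<open>sc\<close>
  passed explicitly: definitions inside the locale \<^locale>\<open>vector_space\<close> would be shadowed by their
  instances under its global interpretation for real vector spaces.
  Sequences indexed by \<open>0, ..., d\<close> (or \<open>1, ..., d\<close>) are functions on \<^typ>\<open>nat\<close> of which only the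
  values in that range matter.
\<close>

definition irreducible_tridiagonal :: "'a::zero mat \<Rightarrow> bool" where
  "irreducible_tridiagonal B \<longleftrightarrow> square_mat B \<and>
     (\<forall>i<dim_row B. \<forall>j<dim_col B.
        (i + 1 < j \<or> j + 1 < i \<longrightarrow> B $$ (i, j) = 0) \<and>
        (i + 1 = j \<or> j + 1 = i \<longrightarrow> B $$ (i, j) \<noteq> 0))"

definition diag_seq_mat :: "nat \<Rightarrow> (nat \<Rightarrow> 'a::zero) \<Rightarrow> 'a mat" where
  "diag_seq_mat d \<theta> = mat (d + 1) (d + 1) (\<lambda>(i, j). if i = j then \<theta> i else 0)"

definition lower_bidiagonal_mat :: "nat \<Rightarrow> (nat \<Rightarrow> 'a::zero_neq_one) \<Rightarrow> 'a mat" where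
  "lower_bidiagonal_mat d \<theta> =
     mat (d + 1) (d + 1) (\<lambda>(i, j). if i = j then \<theta> i else if i = j + 1 then 1 else 0)"

text \<open>The superdiagonal entry in position \<open>(i - 1, i)\<close> is \<open>\<phi> i\<close>, for \<open>1 \<le> i \<le> d\<close>.\<close>

definition upper_bidiagonal_mat :: "nat \<Rightarrow> (nat \<Rightarrow> 'a::zero) \<Rightarrow> (nat \<Rightarrow> 'a) \<Rightarrow> 'a mat" where
  "upper_bidiagonal_mat d \<theta> \<phi> =
     mat (d + 1) (d + 1) (\<lambda>(i, j). if i = j then \<theta> i else if j = i + 1 then \<phi> j else 0)"

text \<open>
  Since \<open>v\<close> lists \<open>d + 1\<close> distinct vectors, the existence of such a basis says that \<open>V\<close> has
  dimension \<open>d + 1\<close>.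
\<close>

definition ordered_basis ::
    "('a::field \<Rightarrow> 'b::ab_group_add \<Rightarrow> 'b) \<Rightarrow> nat \<Rightarrow> (nat \<Rightarrow> 'b) \<Rightarrow> bool" where
  "ordered_basis sc d v \<longleftrightarrow>
     inj_on v {..d} \<and> \<not> module.dependent sc (v ` {..d}) \<and> module.span sc (v ` {..d}) = UNIV"

text \<open>Column convention: \<open>A v\<^sub>j = \<Sum>\<^sub>i B\<^sub>i\<^sub>j v\<^sub>i\<close>.\<close>

definition matrix_wrt ::
    "('a::field \<Rightarrow> 'b::ab_group_add \<Rightarrow> 'b) \<Rightarrow> nat \<Rightarrow> (nat \<Rightarrow> 'b) \<Rightarrow> ('b \<Rightarrow> 'b) \<Rightarrow> 'a mat" where
  "matrix_wrt sc d v A =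
     mat (d + 1) (d + 1) (\<lambda>(i, j). module.representation sc (v ` {..d}) (A (v j)) (v i))"

definition leonard_pair ::
    "('a::field \<Rightarrow> 'b::ab_group_add \<Rightarrow> 'b) \<Rightarrow> nat \<Rightarrow> ('b \<Rightarrow> 'b) \<Rightarrow> ('b \<Rightarrow> 'b) \<Rightarrow> bool" where
  "leonard_pair sc d A As \<longleftrightarrow>
     Vector_Spaces.linear sc sc A \<and> Vector_Spaces.linear sc sc As \<and>
     (\<exists>v. ordered_basis sc d v \<and>
        irreducible_tridiagonal (matrix_wrt sc d v A) \<and> diagonal_mat (matrix_wrt sc d v As)) \<and>
     (\<exists>v. ordered_basis sc d v \<and>
        irreducible_tridiagonal (matrix_wrt sc d v As) \<and> diagonal_mat (matrix_wrt sc d v A))"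

definition eigenspace ::
    "('a::field \<Rightarrow> 'b::ab_group_add \<Rightarrow> 'b) \<Rightarrow> ('b \<Rightarrow> 'b) \<Rightarrow> 'a \<Rightarrow> 'b set" where
  "eigenspace sc A t = {v. A v = sc t v}"

definition eigenvalues ::
    "('a::field \<Rightarrow> 'b::ab_group_add \<Rightarrow> 'b) \<Rightarrow> ('b \<Rightarrow> 'b) \<Rightarrow> 'a set" where
  "eigenvalues sc A = {t. \<exists>v. v \<noteq> 0 \<and> v \<in> eigenspace sc A t}"

text \<open>
  The projection onto the eigenspace for \<open>t\<close> along the sum of the other eigenspaces; it is
  uniquely determined whenever \<open>A\<close> is diagonalizable.
\<close>

definition primitive_idempotent ::
    "('a::field \<Rightarrow> 'b::ab_group_add \<Rightarrow> 'b) \<Rightarrow> ('b \<Rightarrow> 'b) \<Rightarrow> 'a \<Rightarrow> 'b \<Rightarrow> 'b" where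
  "primitive_idempotent sc A t = (THE E. Vector_Spaces.linear sc sc E \<and>
     (\<forall>v \<in> eigenspace sc A t. E v = v) \<and>
     (\<forall>v \<in> module.span sc (\<Union>s \<in> eigenvalues sc A - {t}. eigenspace sc A s). E v = 0))"

definition flat_part ::
    "('a::field \<Rightarrow> 'b::ab_group_add \<Rightarrow> 'b) \<Rightarrow> ('b \<Rightarrow> 'b) \<Rightarrow> ('b \<Rightarrow> 'b) \<Rightarrow> 'b \<Rightarrow> 'b" where
  "flat_part sc A As = (\<lambda>v. \<Sum>t \<in> eigenvalues sc As.
     primitive_idempotent sc As t (A (primitive_idempotent sc As t v)))"

definition essentially_bipartite ::
    "('a::field \<Rightarrow> 'b::ab_group_add \<Rightarrow> 'b) \<Rightarrow> ('b \<Rightarrow> 'b) \<Rightarrow> ('b \<Rightarrow> 'b) \<Rightarrow> bool" where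
  "essentially_bipartite sc A As \<longleftrightarrow> (\<exists>c. flat_part sc A As = (\<lambda>v. sc c v))"

definition near_bipartite ::
    "('a::field \<Rightarrow> 'b::ab_group_add \<Rightarrow> 'b) \<Rightarrow> nat \<Rightarrow> ('b \<Rightarrow> 'b) \<Rightarrow> ('b \<Rightarrow> 'b) \<Rightarrow> bool" where
  "near_bipartite sc d A As \<longleftrightarrow> leonard_pair sc d (\<lambda>v. A v - flat_part sc A As v) As"

definition standard_ordering ::
    "('a::field \<Rightarrow> 'b::ab_group_add \<Rightarrow> 'b) \<Rightarrow> nat \<Rightarrow> ('b \<Rightarrow> 'b) \<Rightarrow> ('b \<Rightarrow> 'b) \<Rightarrow> (nat \<Rightarrow> 'a) \<Rightarrow> bool" where
  "standard_ordering sc d A As \<theta> \<longleftrightarrow> (\<exists>v. ordered_basis sc d v \<and>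
     matrix_wrt sc d v A = diag_seq_mat d \<theta> \<and> irreducible_tridiagonal (matrix_wrt sc d v As))"

definition parameter_array ::
    "('a::field \<Rightarrow> 'b::ab_group_add \<Rightarrow> 'b) \<Rightarrow> nat \<Rightarrow> ('b \<Rightarrow> 'b) \<Rightarrow> ('b \<Rightarrow> 'b) \<Rightarrow>
     (nat \<Rightarrow> 'a) \<Rightarrow> (nat \<Rightarrow> 'a) \<Rightarrow> (nat \<Rightarrow> 'a) \<Rightarrow> (nat \<Rightarrow> 'a) \<Rightarrow> bool" where
  "parameter_array sc d A As \<theta> \<theta>s \<phi>1 \<phi>2 \<longleftrightarrow>
     standard_ordering sc d A As \<theta> \<and> standard_ordering sc d As A \<theta>s \<and>
     (\<exists>v. ordered_basis sc d v \<and>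
        matrix_wrt sc d v A = lower_bidiagonal_mat d \<theta> \<and>
        matrix_wrt sc d v As = upper_bidiagonal_mat d \<theta>s \<phi>1) \<and>
     (\<exists>v. ordered_basis sc d v \<and>
        matrix_wrt sc d v A = lower_bidiagonal_mat d (\<lambda>i. \<theta> (d - i)) \<and>
        matrix_wrt sc d v As = upper_bidiagonal_mat d \<theta>s \<phi>2)"

text \<open>
  The notions below do not depend on the choice of the parameter array of a Leonard pair, so it is
  quantified existentially.  \<open>\<phi>1\<close> is the first split sequence (the scalars \<open>\<phi>\<^sub>i\<close> written with a
  ``varphi'' in the literature) and \<open>\<phi>2\<close> the second.
\<close>

definition fundamental_constant ::
    "('a::field \<Rightarrow> 'b::ab_group_add \<Rightarrow> 'b) \<Rightarrow> nat \<Rightarrow> ('b \<Rightarrow> 'b) \<Rightarrow> ('b \<Rightarrow> 'b) \<Rightarrow> 'a \<Rightarrow> bool" where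
  "fundamental_constant sc d A As \<beta> \<longleftrightarrow> d \<ge> 3 \<and>
     (\<exists>\<theta> \<theta>s \<phi>1 \<phi>2. parameter_array sc d A As \<theta> \<theta>s \<phi>1 \<phi>2 \<and>
        (\<forall>i \<in> {2..d - 1}.
           (\<theta> (i - 2) - \<theta> (i + 1)) / (\<theta> (i - 1) - \<theta> i) = \<beta> + 1 \<and>
           (\<theta>s (i - 2) - \<theta>s (i + 1)) / (\<theta>s (i - 1) - \<theta>s i) = \<beta> + 1))"

definition type_I ::
    "('a::field \<Rightarrow> 'b::ab_group_add \<Rightarrow> 'b) \<Rightarrow> nat \<Rightarrow> ('b \<Rightarrow> 'b) \<Rightarrow> ('b \<Rightarrow> 'b) \<Rightarrow> bool" where
  "type_I sc d A As \<longleftrightarrow> (\<exists>\<beta>. fundamental_constant sc d A As \<beta> \<and> \<beta> \<noteq> 2 \<and> \<beta> \<noteq> - 2)"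

definition type_II ::
    "('a::field \<Rightarrow> 'b::ab_group_add \<Rightarrow> 'b) \<Rightarrow> nat \<Rightarrow> ('b \<Rightarrow> 'b) \<Rightarrow> ('b \<Rightarrow> 'b) \<Rightarrow> bool" where
  "type_II sc d A As \<longleftrightarrow> fundamental_constant sc d A As 2"

definition dual_q_Krawtchouk_type ::
    "('a::field \<Rightarrow> 'b::ab_group_add \<Rightarrow> 'b) \<Rightarrow> nat \<Rightarrow> ('b \<Rightarrow> 'b) \<Rightarrow> ('b \<Rightarrow> 'b) \<Rightarrow> bool" where
  "dual_q_Krawtchouk_type sc d A As \<longleftrightarrow> type_I sc d A As \<and>
     (\<exists>\<theta> \<theta>s \<phi>1 \<phi>2. parameter_array sc d A As \<theta> \<theta>s \<phi>1 \<phi>2 \<and>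
        (\<exists>c. \<forall>i \<in> {1..d - 1}. (\<theta>s (i - 1) - \<theta>s i) / (\<theta>s i - \<theta>s (i + 1)) = c) \<and>
        (\<exists>c. \<forall>i \<in> {1..d}. \<phi>1 i / \<phi>2 i = c))"

text \<open>
  The scalar \<open>q\<close> is determined by \<open>\<beta>\<close> up to sign and inversion, neither of which affects the
  condition on its powers.
\<close>

definition reinforced_dual_q_Krawtchouk_type ::
    "('a::field \<Rightarrow> 'b::ab_group_add \<Rightarrow> 'b) \<Rightarrow> nat \<Rightarrow> ('b \<Rightarrow> 'b) \<Rightarrow> ('b \<Rightarrow> 'b) \<Rightarrow> bool" where
  "reinforced_dual_q_Krawtchouk_type sc d A As \<longleftrightarrow> dual_q_Krawtchouk_type sc d A As \<and>
     (\<exists>\<beta> q. fundamental_constant sc d A As \<beta> \<and> q \<noteq> 0 \<and> \<beta> = q ^ 2 + inverse (q ^ 2) \<and>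
        (\<forall>i \<in> {1..d - 1}. q ^ (2 * i) \<noteq> - 1))"

definition Krawtchouk_type ::
    "('a::field \<Rightarrow> 'b::ab_group_add \<Rightarrow> 'b) \<Rightarrow> nat \<Rightarrow> ('b \<Rightarrow> 'b) \<Rightarrow> ('b \<Rightarrow> 'b) \<Rightarrow> bool" where
  "Krawtchouk_type sc d A As \<longleftrightarrow> type_II sc d A As \<and>
     (\<exists>\<theta> \<theta>s \<phi>1 \<phi>2. parameter_array sc d A As \<theta> \<theta>s \<phi>1 \<phi>2 \<and>
        (\<exists>c. \<forall>i \<in> {1..d}. \<theta> i - \<theta> (i - 1) = c) \<and>
        (\<exists>c. \<forall>i \<in> {1..d}. \<theta>s i - \<theta>s (i - 1) = c))"

end

theory Submission
  imports Defs
begin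

text \<open>
  Let \<open>v\<close> be an eigenbasis of \<open>A\<^sup>*\<close> with \<open>A v\<^sub>i = v\<^sub>i\<^sub>+\<^sub>1 + a\<^sub>i v\<^sub>i + x\<^sub>i v\<^sub>i\<^sub>-\<^sub>1\<close>; then \<open>A - F\<close> has the same
  \<open>x\<^sub>i\<close> and zero diagonal.  Put \<open>\<delta>\<^sub>i = \<theta>\<^sup>*\<^sub>i - \<theta>\<^sup>*\<^sub>i\<^sub>-\<^sub>1\<close> and let \<open>f\<^sub>i\<close>, \<open>g\<^sub>i\<close> be the quotients by \<open>\<delta>\<^sub>i\<close> of the first
  and second split sequence.  The leading coefficients of a split basis express \<open>a\<close> and \<open>x\<close> through
  \<open>f\<close>, and likewise through \<open>g\<close>.  With \<open>T = f - g\<close> this gives \<open>x\<^sub>i T\<^sub>i = - f\<^sub>i g\<^sub>i L\<^sub>i\<close>, where \<open>L\<close> depends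
  only on \<open>T\<close> and \<open>\<theta>\<^sup>*\<close>, and \<open>T\<close> depends up to a factor only on \<open>\<beta>\<close> and \<open>d\<close>; moreover
  \<open>(f\<^sub>i + g\<^sub>i) \<delta>\<^sub>i = T\<^sub>i (K + w (\<theta>\<^sup>*\<^sub>i\<^sub>-\<^sub>1 + \<theta>\<^sup>*\<^sub>i))\<close> for constants \<open>K\<close> and \<open>w\<close>.

  If \<open>A - F, A\<^sup>*\<close> is a Leonard pair, then it satisfies \<open>g = - f\<close>, so comparison of the \<open>x\<^sub>i\<close> yields
  \<open>f\<^sub>i + g\<^sub>i = \<plusminus> c T\<^sub>i\<close> for a constant \<open>c\<close>.  If \<open>c = 0\<close>, the \<open>a\<^sub>i\<close> are all equal.  Otherwise the
  formula above shows that the sign is constant and that \<open>\<delta>\<close> is a geometric progression.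
  Conversely, if \<open>\<delta>\<close> is geometric with ratio \<open>h\<close>, no \<open>h\<^sup>i\<close> with \<open>1 \<le> i < d\<close> equals \<open>-1\<close>, and
  \<open>f\<^sub>i / g\<^sub>i\<close> is constant, then \<open>x\<close> has a closed form, and explicit
  split bases of \<open>A - F\<close> for both orderings of its eigenvalues show that it forms a Leonard pair
  with \<open>A\<^sup>*\<close>.
\<close>

section \<open>Recurrences on an interval\<close>

text \<open>The pairs \<open>A, As\<close> and \<open>A - F, As\<close> share
  \<open>\<theta>s\<close> and all \<open>x k\<close>, while the eigenvalues of \<open>A\<close> and
  \<open>A - F\<close> are unrelated a priori. The pairs become comparable because
  \<open>\<beta>\<close> is already determined by \<open>\<theta>s\<close>, and \<open>T\<close>
  consists of partial sums of \<open>\<theta> k - \<theta> (d - k)\<close>, an antisymmetric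
  solution of a recurrence that depends only on \<open>\<beta>\<close>. As 2 is nonzero, such
  solutions form a space of dimension at most one. The comparison of \<open>x\<close> is quadratic
  in the split numbers, hence leaves a sign free at each index; the affine formula for
  \<open>F k * \<delta> k / T k\<close> is what couples neighbouring signs. In the converse, the
  condition on the powers \<open>h ^ i\<close> gives distinct eigenvalues of \<open>A - F\<close>,
  and a square root \<open>l\<close> enters \<open>x\<close> only as \<open>l * l\<close>: the
  choices \<open>l\<close> and \<open>- l\<close> produce the split bases for the two opposite
  orderings. Sums \<open>1 + h + ... + h ^ (n - 1)\<close> in place of quotients make Krawtchouk
  type the case \<open>h = 1\<close>.\<close>

lemma recurrence_unique:
  fixes z :: "nat \<Rightarrow> 'a::comm_ring_1"
  assumes rec: "\<And>k. 1 \<le> k \<Longrightarrow> k + 2 \<le> n \<Longrightarrow> z k + z (k + 2) = \<beta> * z (k + 1)"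
    and m: "1 \<le> m" "m + 1 \<le> n" "z m = 0" "z (m + 1) = 0"
    and k: "1 \<le> k" "k \<le> n"
  shows "z k = 0"
proof -
  have up: "m + j + 1 \<le> n \<longrightarrow> z (m + j) = 0 \<and> z (m + j + 1) = 0" for j
  proof (induction j)
    case (Suc j)
    then show ?case using rec[of "m + j"] m by auto
  qed (use m in auto)
  have down: "j < m \<longrightarrow> z (m - j) = 0 \<and> z (m - j + 1) = 0" for j
  proof (induction j)
    case (Suc j)
    show ?case
    proof
      assume j: "Suc j < m"
      then have "m - j = m - Suc j + 1" "m - j + 1 = m - Suc j + 2" by auto
      then show "z (m - Suc j) = 0 \<and> z (m - Suc j + 1) = 0"
        using rec[of "m - Suc j"] Suc j m by (auto simp del: diff_Suc_Suc)
    qed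
  qed (use m in auto)
  show ?thesis
  proof (cases "k \<le> m")
    case True
    then show ?thesis using down[of "m - k"] k by auto
  next
    case False
    then show ?thesis using up[of "k - m - 1"] k by auto
  qed
qed

text \<open>Antisymmetry leaves a single free value at the middle of the interval: for even
  \<open>n\<close> the two middle values are opposite, for odd \<open>n\<close> the middle value
  vanishes because 2 is nonzero. With the recurrence this makes the solution space at most
  one-dimensional.\<close>

lemma antisymmetric_recurrence_proportional:
  fixes z P :: "nat \<Rightarrow> 'a::field"
  assumes two: "(2::'a) \<noteq> 0" and n: "n \<ge> 2"
    and zrec: "\<And>k. 1 \<le> k \<Longrightarrow> k + 2 \<le> n \<Longrightarrow> z k + z (k + 2) = \<beta> * z (k + 1)"
    and Prec: "\<And>k. 1 \<le> k \<Longrightarrow> k + 2 \<le> n \<Longrightarrow> P k + P (k + 2) = \<beta> * P (k + 1)"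
    and zanti: "\<And>k. 1 \<le> k \<Longrightarrow> k \<le> n \<Longrightarrow> z (n + 1 - k) = - z k"
    and Panti: "\<And>k. 1 \<le> k \<Longrightarrow> k \<le> n \<Longrightarrow> P (n + 1 - k) = - P k"
    and nz: "1 \<le> j" "j \<le> n" "P j \<noteq> 0"
  obtains w where "\<And>k. 1 \<le> k \<Longrightarrow> k \<le> n \<Longrightarrow> z k = w * P k"
proof -
  have "\<exists>m. 1 \<le> m \<and> m + 1 \<le> n \<and>
      (\<forall>z :: nat \<Rightarrow> 'a. (\<forall>k. 1 \<le> k \<longrightarrow> k \<le> n \<longrightarrow> z (n + 1 - k) = - z k) \<longrightarrow> z (m + 1) = 0 \<longrightarrow> z m = 0)"
  proof (cases "even n")
    case True
    then obtain m where m: "n = 2 * m" by blast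
    then have e: "n + 1 - m = m + 1" "1 \<le> m" "m \<le> n" using n by auto
    show ?thesis
      by (intro exI[of _ m] conjI allI impI) (use m n e in \<open>force+\<close>)
  next
    case False
    then obtain m where m: "n = 2 * m + 1" by (auto elim: oddE)
    then have e: "n + 1 - m = m + 1 + 1" "1 \<le> m" "m \<le> n" "n + 1 - (m + 1) = m + 1" using n by auto
    show ?thesis
    proof (intro exI[of _ "m + 1"] conjI allI impI)
      fix z :: "nat \<Rightarrow> 'a"
      assume z: "\<forall>k. 1 \<le> k \<longrightarrow> k \<le> n \<longrightarrow> z (n + 1 - k) = - z k" and "z (m + 1 + 1) = 0"
      have "z (m + 1) = - z (m + 1)" using z[rule_format, of "m + 1"] m e by simp
      then have "2 * z (m + 1) = 0" by (metis add.right_inverse mult_2)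
      then show "z (m + 1) = 0" using two by simp
    qed (use m n e in auto)
  qed
  then obtain m where m: "1 \<le> m" "m + 1 \<le> n"
    and c2: "\<And>z. (\<forall>k. 1 \<le> k \<longrightarrow> k \<le> n \<longrightarrow> z (n + 1 - k) = - z k) \<Longrightarrow>
       z (m + 1) = (0::'a) \<Longrightarrow> z m = 0"
    by blast
  have P1: "P (m + 1) \<noteq> 0"
  proof
    assume "P (m + 1) = 0"
    moreover from this have "P m = 0" using c2 Panti by blast
    ultimately show False using recurrence_unique[of n P \<beta> m j] Prec m nz by blast
  qed
  define w where "w = z (m + 1) / P (m + 1)"
  have y: "z k - w * P k = 0" if "1 \<le> k" "k \<le> n" for k
  proof (rule recurrence_unique[of n "\<lambda>k. z k - w * P k" \<beta> m])
    show "(z k - w * P k) + (z (k + 2) - w * P (k + 2)) = \<beta> * (z (k + 1) - w * P (k + 1))"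
      if "1 \<le> k" "k + 2 \<le> n" for k
      using zrec[OF that] Prec[OF that] by Groebner_Basis.algebra
    show y1: "z (m + 1) - w * P (m + 1) = 0" using P1 by (simp add: w_def)
    then show "z m - w * P m = 0"
      using c2[of "\<lambda>k. z k - w * P k"] zanti Panti by auto
  qed (use m that in auto)
  show thesis by (rule that[of w]) (use y in auto)
qed

section \<open>The numbers attached to a pair of split decompositions\<close>

text \<open>Up to the leading coefficient and the factors \<open>f k\<close> and
  \<open>f (k - 1)\<close>, the number \<open>1 - kap \<theta>s k\<close> is the coordinate of the
  split vector \<open>u k\<close> two places below its leading one. The values at
  \<open>k = 1\<close> and \<open>k = d + 1\<close> carry no information; they occur multiplied by a
  boundary value 0.\<close>

definition kap :: "(nat \<Rightarrow> 'a::field) \<Rightarrow> nat \<Rightarrow> 'a" where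
  "kap \<theta>s k = (\<theta>s (k - 1) - \<theta>s (k - 2)) / (\<theta>s k - \<theta>s (k - 2))"

text \<open>A Leonard pair reduced to scalars, so that the same facts apply both to the given pair
  and to its bipartite part, with \<open>\<theta>s\<close>, \<open>x\<close> and
  \<open>\<beta>\<close> in common.\<close>

locale split_numbers =
  fixes d :: nat and \<theta> \<theta>s a x f g :: "nat \<Rightarrow> 'a::field" and \<beta> \<gamma> :: 'a
  assumes two: "(2::'a) \<noteq> 0" and d3: "d \<ge> 3"
    and \<theta>_inj: "inj_on \<theta> {..d}" and \<theta>s_inj: "inj_on \<theta>s {..d}"
    and \<theta>_rec: "\<And>k. 1 \<le> k \<Longrightarrow> k < d \<Longrightarrow> \<theta> (k - 1) + \<theta> (k + 1) = \<beta> * \<theta> k + \<gamma>"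
    and \<theta>s_rec: "\<And>k. 1 \<le> k \<Longrightarrow> k + 2 \<le> d \<Longrightarrow>
      (\<theta>s k - \<theta>s (k - 1)) + (\<theta>s (k + 2) - \<theta>s (k + 1)) = \<beta> * (\<theta>s (k + 1) - \<theta>s k)"
    and f0: "f 0 = 0" and g0: "g 0 = 0" and fd: "f (d + 1) = 0" and gd: "g (d + 1) = 0"
    and a_f: "\<And>k. k \<le> d \<Longrightarrow> a k = \<theta> k + f k - f (k + 1)"
    and a_g: "\<And>k. k \<le> d \<Longrightarrow> a k = \<theta> (d - k) + g k - g (k + 1)"
    and x_f: "\<And>k. 1 \<le> k \<Longrightarrow> k \<le> d \<Longrightarrow>
      x k = f k * (f (k - 1) * kap \<theta>s k - f (k + 1) * kap \<theta>s (k + 1) + \<theta> (k - 1) - a k)"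
    and x_g: "\<And>k. 1 \<le> k \<Longrightarrow> k \<le> d \<Longrightarrow>
      x k = g k * (g (k - 1) * kap \<theta>s k - g (k + 1) * kap \<theta>s (k + 1) + \<theta> (d + 1 - k) - a k)"
    and x_nz: "\<And>k. 1 \<le> k \<Longrightarrow> k \<le> d \<Longrightarrow> x k \<noteq> 0"
begin

abbreviation "\<delta> k \<equiv> \<theta>s k - \<theta>s (k - 1)"

definition "T k = f k - g k"
definition "F k = f k + g k"
definition "u k = \<theta> k - \<theta> (d - k)"
definition "s k = \<theta> k + \<theta> (d - k)"
definition "L k = T (k - 1) * kap \<theta>s k - T (k + 1) * kap \<theta>s (k + 1) + u (k - 1)"

lemma \<theta>s_neq: "i \<le> d \<Longrightarrow> j \<le> d \<Longrightarrow> i \<noteq> j \<Longrightarrow> \<theta>s i - \<theta>s j \<noteq> 0"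
  using \<theta>s_inj by (auto simp: inj_on_def)

lemma \<theta>_neq: "i \<le> d \<Longrightarrow> j \<le> d \<Longrightarrow> i \<noteq> j \<Longrightarrow> \<theta> i - \<theta> j \<noteq> 0"
  using \<theta>_inj by (auto simp: inj_on_def)

lemma f_nz: "1 \<le> k \<Longrightarrow> k \<le> d \<Longrightarrow> f k \<noteq> 0"
  using x_f x_nz by fastforce

lemma g_nz: "1 \<le> k \<Longrightarrow> k \<le> d \<Longrightarrow> g k \<noteq> 0"
  using x_g x_nz by fastforce

lemma T_0 [simp]: "T 0 = 0" and F_0 [simp]: "F 0 = 0"
  and T_end [simp]: "T (d + 1) = 0" and F_end [simp]: "F (d + 1) = 0"
  using f0 g0 fd gd by (simp_all add: T_def F_def)

lemma T_Suc: "k \<le> d \<Longrightarrow> T (k + 1) = T k + u k"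
  using a_f[of k] a_g[of k] unfolding T_def u_def by (simp add: algebra_simps)

lemma F_Suc: "k \<le> d \<Longrightarrow> 2 * a k = s k + F k - F (k + 1)"
  using a_f[of k] a_g[of k] unfolding F_def s_def by Groebner_Basis.algebra

lemma u_anti: "k \<le> d \<Longrightarrow> u (d - k) = - u k"
  by (simp add: u_def)

lemma s_sym: "k \<le> d \<Longrightarrow> s (d - k) = s k"
  by (simp add: s_def add.commute)

lemma \<theta>_rec_rev: "1 \<le> k \<Longrightarrow> k < d \<Longrightarrow> \<theta> (d - (k - 1)) + \<theta> (d - (k + 1)) = \<beta> * \<theta> (d - k) + \<gamma>"
  using \<theta>_rec[of "d - k"] by (simp add: Suc_diff_le add.commute)

lemma u_rec: "1 \<le> k \<Longrightarrow> k < d \<Longrightarrow> u (k - 1) + u (k + 1) = \<beta> * u k"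
  using \<theta>_rec[of k] \<theta>_rec_rev[of k] unfolding u_def by Groebner_Basis.algebra

lemma s_rec: "1 \<le> k \<Longrightarrow> k < d \<Longrightarrow> s (k - 1) + s (k + 1) = \<beta> * s k + 2 * \<gamma>"
  using \<theta>_rec[of k] \<theta>_rec_rev[of k] unfolding s_def by Groebner_Basis.algebra

lemma u_0: "u 0 \<noteq> 0"
  using \<theta>_neq[of 0 d] d3 by (simp add: u_def)

text \<open>Dividing the two expressions for \<open>x k\<close> by \<open>f k\<close> and
  \<open>g k\<close> and subtracting removes \<open>a k\<close>; what remains of the difference is
  \<open>L k\<close>.\<close>

lemma x_T: assumes k: "1 \<le> k" "k \<le> d" shows "x k * T k = - f k * g k * L k"
proof -
  have e: "d + 1 - k = d - (k - 1)" using k by auto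
  show ?thesis
    using x_f[OF k] x_g[OF k] unfolding T_def L_def u_def e by Groebner_Basis.algebra
qed

lemma kap_T:
  assumes k: "1 \<le> k" "k \<le> d"
  shows "T (k - 1) * (1 - kap \<theta>s k) = T (k - 1) * \<delta> k / (\<theta>s k - \<theta>s (k - 2))"
proof (cases "k = 1")
  case False
  then have "\<theta>s k - \<theta>s (k - 2) \<noteq> 0" using \<theta>s_neq k by auto
  then have "1 - kap \<theta>s k = \<delta> k / (\<theta>s k - \<theta>s (k - 2))"
    unfolding kap_def by (simp add: divide_simps)
  then show ?thesis by simp
qed simp

definition "y k = F k * \<delta> k / T k"

text \<open>Adding the two quotients instead of subtracting them brings in \<open>F\<close> and
  \<open>2 * a k\<close>. Once \<open>x k\<close> is eliminated by \<open>x_T\<close> and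
  \<open>a k\<close> by \<open>F_Suc\<close>, the remaining terms group into divided differences of
  \<open>y\<close>.\<close>

lemma y_relation:
  assumes nz: "\<And>k. 1 \<le> k \<Longrightarrow> k \<le> d \<Longrightarrow> T k \<noteq> 0" and k: "1 \<le> k" "k \<le> d"
  shows "T (k + 1) * ((y (k + 1) - y k) / (\<theta>s (k + 1) - \<theta>s (k - 1)))
     - T (k - 1) * ((y k - y (k - 1)) / (\<theta>s k - \<theta>s (k - 2))) = s k - s (k - 1)"
proof -
  define P where "P = inverse (\<theta>s k - \<theta>s (k - 2))"
  define N where "N = inverse (\<theta>s (k + 1) - \<theta>s (k - 1))"
  define D where "D = inverse (\<delta> k)"
  have \<delta>: "\<delta> j \<noteq> 0" if "1 \<le> j" "j \<le> d" for j using \<theta>s_neq that by auto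
  have D: "D * \<delta> k = 1" using \<delta>[OF k] by (simp add: D_def)
  have F: "F k = y k * T k * D" using \<delta>[OF k] nz[OF k] by (simp add: y_def D_def field_simps)
  have e: "d + 1 - k = d - (k - 1)" using k by auto
  have k1: "T (k - 1) * (1 - kap \<theta>s k) = T (k - 1) * \<delta> k * P"
    using kap_T[OF k] by (simp add: P_def divide_inverse)
  have k2: "T (k + 1) * kap \<theta>s (k + 1) = T (k + 1) * \<delta> k * N"
    by (simp add: kap_def N_def divide_inverse)
  have k3: "F (k - 1) * kap \<theta>s k = T (k - 1) * y (k - 1) * P"
  proof (cases "k = 1")
    case False
    then have "F (k - 1) * \<delta> (k - 1) = T (k - 1) * y (k - 1)" using nz[of "k - 1"] k
      by (simp add: y_def)
    moreover have "kap \<theta>s k = \<delta> (k - 1) * P"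
      by (simp add: kap_def P_def divide_inverse numeral_2_eq_2)
    ultimately show ?thesis by (simp only: mult.assoc[symmetric])
  qed simp
  have k4: "F (k + 1) * (1 - kap \<theta>s (k + 1)) = T (k + 1) * y (k + 1) * N"
  proof (cases "k = d")
    case False
    then have "F (k + 1) * \<delta> (k + 1) = T (k + 1) * y (k + 1)" using nz[of "k + 1"] k
      by (simp add: y_def)
    moreover have "\<theta>s (k + 1) - \<theta>s (k - 1) \<noteq> 0" using \<theta>s_neq[of "k + 1" "k - 1"] k False by auto
    then have "1 - kap \<theta>s (k + 1) = \<delta> (k + 1) * N"
      unfolding kap_def N_def by (simp add: divide_simps)
    ultimately show ?thesis by (simp only: mult.assoc[symmetric])
  next
    \<comment> \<open>Both sides carry a factor with index \<open>d + 1\<close>, which is 0, so the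
      unspecified value \<open>\<theta>s (d + 1)\<close> inside \<open>kap\<close> and
      \<open>N\<close> is harmless.\<close>
    case True
    then show ?thesis using F_end T_end by (metis mult_zero_left)
  qed
  have u: "u (k - 1) = T k - T (k - 1)" using T_Suc[of "k - 1"] k by simp
  have "x k * F k = f k * g k * (F (k - 1) * kap \<theta>s k - F (k + 1) * kap \<theta>s (k + 1) + s (k - 1) - 2 * a k)"
    using x_f[OF k] x_g[OF k] unfolding F_def s_def e by Groebner_Basis.algebra
  then have "f k * g k * (- F k * L k) = f k * g k * (T k * (F (k - 1) * kap \<theta>s k - F (k + 1) * kap \<theta>s (k + 1) + s (k - 1) - 2 * a k))"
    using x_T[OF k] by Groebner_Basis.algebra
  moreover have "f k * g k \<noteq> 0" using f_nz[OF k] g_nz[OF k] by simp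
  ultimately have "- F k * L k = T k * (F (k - 1) * kap \<theta>s k - F (k + 1) * kap \<theta>s (k + 1) + s (k - 1) - (s k + F k - F (k + 1)))"
    unfolding F_Suc[OF k(2)] by (rule mult_left_cancel[THEN iffD1, rotated])
  then have "T k * (- y k * D * L k) = T k * (F (k - 1) * kap \<theta>s k - F (k + 1) * kap \<theta>s (k + 1) + s (k - 1) - (s k + F k - F (k + 1)))"
    unfolding F by (simp add: algebra_simps)
  then have "- y k * D * L k = F (k - 1) * kap \<theta>s k - F (k + 1) * kap \<theta>s (k + 1) + s (k - 1) - (s k + F k - F (k + 1))"
    by (rule mult_left_cancel[THEN iffD1, OF nz[OF k]])
  then have "- y k * D * (- T (k - 1) * \<delta> k * P - T (k + 1) * \<delta> k * N + T k) =
     T (k - 1) * y (k - 1) * P + T (k + 1) * y (k + 1) * N + s (k - 1) - s k - F k"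
    using k1 k2 k3 k4 unfolding L_def u by Groebner_Basis.algebra
  then have "y k * T (k - 1) * P + y k * T (k + 1) * N =
     T (k - 1) * y (k - 1) * P + T (k + 1) * y (k + 1) * N + s (k - 1) - s k"
    using D F by Groebner_Basis.algebra
  then show ?thesis unfolding divide_inverse P_def[symmetric] N_def[symmetric] by Groebner_Basis.algebra
qed

text \<open>Both sides are antisymmetric under \<open>k \<mapsto> d + 1 - k\<close> and solve the
  homogeneous recurrence: differencing \<open>s\<close> removes the constant
  \<open>2 * \<gamma>\<close>, and \<open>T (k + 1) - T (k - 1)\<close> is
  \<open>u k + u (k - 1)\<close>. The assumption says that the latter is nonzero at
  \<open>k = 1\<close>, since \<open>T 0 = 0\<close>.\<close>

lemma s_difference_proportional:
  assumes "T 2 \<noteq> 0"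
  obtains w where "\<And>k. 1 \<le> k \<Longrightarrow> k \<le> d \<Longrightarrow> s k - s (k - 1) = w * (T (k + 1) - T (k - 1))"
proof (rule antisymmetric_recurrence_proportional[where n = d and \<beta> = \<beta> and
      z = "\<lambda>k. s k - s (k - 1)" and P = "\<lambda>k. T (k + 1) - T (k - 1)" and j = 1])
  have P: "T (k + 1) - T (k - 1) = u k + u (k - 1)" if "1 \<le> k" "k \<le> d" for k
    using T_Suc[of k] T_Suc[of "k - 1"] that by simp
  show "(T (k + 1) - T (k - 1)) + (T (k + 2 + 1) - T (k + 2 - 1)) = \<beta> * (T (k + 1 + 1) - T (k + 1 - 1))"
    if "1 \<le> k" "k + 2 \<le> d" for k
  proof -
    have "T (k + 1) - T (k - 1) = u k + u (k - 1)" "T (k + 2) - T k = u (k + 1) + u k"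
      "T (k + 3) - T (k + 1) = u (k + 2) + u (k + 1)"
      using P[of k] P[of "k + 1"] P[of "k + 2"] that by (simp_all add: numeral_3_eq_3)
    moreover have "u (k - 1) + u (k + 1) = \<beta> * u k" "u k + u (k + 2) = \<beta> * u (k + 1)"
      using u_rec[of k] u_rec[of "k + 1"] that by simp_all
    ultimately have "(T (k + 1) - T (k - 1)) + (T (k + 3) - T (k + 1)) = \<beta> * (T (k + 2) - T k)"
      by Groebner_Basis.algebra
    then show ?thesis by (simp add: numeral_3_eq_3)
  qed
  show "s k - s (k - 1) + (s (k + 2) - s (k + 2 - 1)) = \<beta> * (s (k + 1) - s (k + 1 - 1))"
    if "1 \<le> k" "k + 2 \<le> d" for k
    using s_rec[of k] s_rec[of "k + 1"] that by (simp add: algebra_simps)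
  show "T (d + 1 - k + 1) - T (d + 1 - k - 1) = - (T (k + 1) - T (k - 1))"
    if k: "1 \<le> k" "k \<le> d" for k
  proof -
    have "d + 1 - k - 1 = d - k" "d + 1 - k = d - (k - 1)" using k by auto
    then show ?thesis
      using P[of k] P[of "d + 1 - k"] u_anti[of k] u_anti[of "k - 1"] k by simp
  qed
  show "s (d + 1 - k) - s (d + 1 - k - 1) = - (s k - s (k - 1))" if k: "1 \<le> k" "k \<le> d" for k
  proof -
    have "d + 1 - k - 1 = d - k" "d + 1 - k = d - (k - 1)" using k by auto
    then show ?thesis using s_sym[of k] s_sym[of "k - 1"] k by simp
  qed
  show "T (1 + 1) - T (1 - 1) \<noteq> 0" using assms by (simp add: numeral_2_eq_2)
qed (use two d3 that in auto)

text \<open>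
  The ratio of \<open>F\<^sub>k \<delta>\<^sub>k\<close> to \<open>T\<^sub>k\<close> is an affine function of \<open>\<theta>\<^sup>*\<^sub>k\<^sub>-\<^sub>1 + \<theta>\<^sup>*\<^sub>k\<close>,
  because its divided differences obey a first-order recurrence that a constant also solves.
\<close>

lemma F_formula:
  assumes nz: "\<And>k. 1 \<le> k \<Longrightarrow> k \<le> d \<Longrightarrow> T k \<noteq> 0"
  obtains w K where
    "\<And>k. 1 \<le> k \<Longrightarrow> k \<le> d \<Longrightarrow> s k - s (k - 1) = w * (T (k + 1) - T (k - 1))"
    "\<And>k. 1 \<le> k \<Longrightarrow> k \<le> d \<Longrightarrow> F k * \<delta> k = T k * (K + w * (\<theta>s (k - 1) + \<theta>s k))"
proof -
  obtain w where w: "\<And>k. 1 \<le> k \<Longrightarrow> k \<le> d \<Longrightarrow> s k - s (k - 1) = w * (T (k + 1) - T (k - 1))"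
    using s_difference_proportional nz d3 by (metis one_le_numeral order.trans numeral_le_iff semiring_norm(68,69,72,73))
  define W where "W k = (y k - y (k - 1)) / (\<theta>s k - \<theta>s (k - 2))" for k
  have rel: "T (k + 1) * W (k + 1) - T (k - 1) * W k = w * (T (k + 1) - T (k - 1))"
    if "1 \<le> k" "k \<le> d" for k
    using y_relation[of k] nz w[OF that] that by (simp add: W_def)
  \<comment> \<open>At \<open>k = 1\<close> the relation loses the term with \<open>T 0 = 0\<close>,
    which starts the induction at \<open>W 2\<close>.\<close>
  have W: "k + 2 \<le> d \<Longrightarrow> W (k + 2) = w" for k
  proof (induction k)
    case 0
    have "T 2 * (W 2 - w) = 0" using rel[of 1] d3 by (simp add: algebra_simps numeral_2_eq_2)
    then show ?case using nz[of 2] d3 by (simp add: numeral_2_eq_2)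
  next
    case (Suc k)
    then have "T (k + 3) * (W (k + 3) - w) = 0" using rel[of "k + 2"]
      by (simp add: algebra_simps numeral_3_eq_3)
    then show ?case using nz[of "k + 3"] Suc by (simp add: numeral_3_eq_3)
  qed
  have yd: "y (k + 2) - y (k + 1) = w * (\<theta>s (k + 2) - \<theta>s k)" if "k + 2 \<le> d" for k
    using W[OF that] \<theta>s_neq[of "k + 2" k] that by (simp add: W_def divide_simps)
  define K where "K = y 1 - w * (\<theta>s 0 + \<theta>s 1)"
  have yk: "k + 1 \<le> d \<Longrightarrow> y (k + 1) = K + w * (\<theta>s k + \<theta>s (k + 1))" for k
  proof (induction k)
    case (Suc k)
    then show ?case using yd[of k] by (simp add: algebra_simps)
  qed (simp add: K_def)
  show thesis
  proof (rule that[of w K])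
    fix k assume k: "1 \<le> k" "k \<le> d"
    then have "y k = K + w * (\<theta>s (k - 1) + \<theta>s k)" using yk[of "k - 1"] by simp
    then show "F k * \<delta> k = T k * (K + w * (\<theta>s (k - 1) + \<theta>s k))"
      using nz[OF k] by (simp add: y_def divide_simps mult.commute)
  qed (use w in blast)
qed

end

text \<open>Solutions combine the powers of \<open>x\<close> and of \<open>inverse x\<close>, and
  both take the value -1 at \<open>i\<close> and 1 at 0. The proof follows the two first-order
  combinations in which one of these modes cancels; \<open>x * x \<noteq> 1\<close> keeps the modes
  apart.\<close>

lemma power_eq_minus_one_recurrence:
  fixes z :: "nat \<Rightarrow> 'a::field"
  assumes rec: "\<And>k. 1 \<le> k \<Longrightarrow> k < d \<Longrightarrow> z (k - 1) + z (k + 1) = \<beta> * z k"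
    and x: "x \<noteq> 0" "\<beta> = x + inverse x" "x * x \<noteq> 1" and i: "i < d" "x ^ i = - 1"
  shows "z i = - z 0"
proof -
  define y where "y = inverse x"
  have xy: "x * y = 1" using x by (simp add: y_def)
  have b: "\<beta> = x + y" by (simp add: x y_def)
  have A: "n < d \<Longrightarrow> (z (n + 1) - x * z n) * x ^ n = z 1 - x * z 0" for n
  proof (induction n)
    case (Suc n)
    have "z n + z (n + 2) = (x + y) * z (n + 1)" using rec[of "n + 1"] Suc b by simp
    then have "(z (n + 2) - x * z (n + 1)) * x = z (n + 1) - x * z n"
      using xy by Groebner_Basis.algebra
    then have "(z (n + 2) - x * z (n + 1)) * x ^ Suc n = (z (n + 1) - x * z n) * x ^ n"
      by (simp add: mult.assoc[symmetric])
    with Suc show ?case by simp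
  qed simp
  have B: "n < d \<Longrightarrow> z (n + 1) - y * z n = x ^ n * (z 1 - y * z 0)" for n
  proof (induction n)
    case (Suc n)
    have "z n + z (n + 2) = (x + y) * z (n + 1)" using rec[of "n + 1"] Suc b by simp
    then have "z (n + 2) - y * z (n + 1) = x * (z (n + 1) - y * z n)"
      using xy by Groebner_Basis.algebra
    with Suc show ?case by (simp add: mult.assoc)
  qed simp
  have "(x - y) * (z i + z 0) = 0"
    using A[OF i(1)] B[OF i(1)] unfolding i(2) by Groebner_Basis.algebra
  moreover have "x - y \<noteq> 0"
  proof
    assume "x - y = 0"
    then have "x * x = 1" using xy by simp
    then show False using x by simp
  qed
  ultimately show ?thesis by (simp add: eq_neg_iff_add_eq_0)
qed

section \<open>Comparison of a pair with its bipartite part\<close>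

context split_numbers
begin

text \<open>For both pairs \<open>u\<close> is antisymmetric and solves the same recurrence, and
  \<open>T\<close> is its sequence of partial sums. The factor is nonzero since
  \<open>\<theta>' 0 \<noteq> \<theta>' d\<close>.\<close>

lemma T_proportional:
  assumes "split_numbers d \<theta>' \<theta>s a' x f' g' \<beta> \<gamma>'"
  obtains w where "w \<noteq> 0"
    "\<And>k. k \<le> d \<Longrightarrow> split_numbers.u d \<theta>' k = w * u k"
    "\<And>k. k \<le> d + 1 \<Longrightarrow> split_numbers.T f' g' k = w * T k"
proof -
  interpret B: split_numbers d \<theta>' \<theta>s a' x f' g' \<beta> \<gamma>' by (rule assms)
  obtain w where w: "\<And>k. 1 \<le> k \<Longrightarrow> k \<le> d + 1 \<Longrightarrow> B.u (k - 1) = w * u (k - 1)"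
  proof (rule antisymmetric_recurrence_proportional[where n = "d + 1" and \<beta> = \<beta> and
      z = "\<lambda>k. B.u (k - 1)" and P = "\<lambda>k. u (k - 1)" and j = 1])
    show "B.u (k - 1) + B.u (k + 2 - 1) = \<beta> * B.u (k + 1 - 1)" if "1 \<le> k" "k + 2 \<le> d + 1" for k
      using B.u_rec[of k] that by simp
    show "u (k - 1) + u (k + 2 - 1) = \<beta> * u (k + 1 - 1)" if "1 \<le> k" "k + 2 \<le> d + 1" for k
      using u_rec[of k] that by simp
    show "B.u (d + 1 + 1 - k - 1) = - B.u (k - 1)" if "1 \<le> k" "k \<le> d + 1" for k
      using B.u_anti[of "k - 1"] that by simp
    show "u (d + 1 + 1 - k - 1) = - u (k - 1)" if "1 \<le> k" "k \<le> d + 1" for k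
      using u_anti[of "k - 1"] that by simp
    show "u (1 - 1) \<noteq> 0" using u_0 by simp
    fix w assume "\<And>k. 1 \<le> k \<Longrightarrow> k \<le> d + 1 \<Longrightarrow> B.u (k - 1) = w * u (k - 1)"
    then show thesis by (rule that)
  qed (use two d3 in auto)
  have w: "B.u k = w * u k" if "k \<le> d" for k using w[of "k + 1"] that by simp
  have "B.T k = w * T k" if "k \<le> d + 1" for k
    using that
  proof (induction k)
    case (Suc k)
    then show ?case using T_Suc[of k] B.T_Suc[of k] w[of k] by (simp add: algebra_simps)
  qed simp
  moreover have "w \<noteq> 0" using w[of 0] B.u_0 by auto
  ultimately show thesis using w that by blast
qed

text \<open>Here \<open>s\<close> and \<open>a\<close> vanish, so \<open>f + g\<close> never leaves
  its initial value 0.\<close>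

lemma bipartite_T_nz:
  assumes a: "\<And>k. k \<le> d \<Longrightarrow> a k = 0" and \<theta>: "\<And>k. k \<le> d \<Longrightarrow> \<theta> (d - k) = - \<theta> k"
    and k: "1 \<le> k" "k \<le> d"
  shows "g k = - f k" "T k = 2 * f k" "T k \<noteq> 0"
proof -
  have "j \<le> d + 1 \<Longrightarrow> g j = - f j" for j
  proof (induction j)
    case (Suc j)
    then have j: "j \<le> d" "g j = - f j" by simp_all
    show ?case using a_f[OF j(1)] a_g[OF j(1)] a[OF j(1)] \<theta>[OF j(1)] j(2)
      unfolding Suc_eq_plus1 by Groebner_Basis.algebra
  qed (simp add: f0 g0)
  then show "g k = - f k" using k by simp
  then show "T k = 2 * f k" by (simp add: T_def)
  then show "T k \<noteq> 0" using f_nz[OF k] two by simp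
qed

text \<open>With \<open>f' = w * T / 2\<close> and \<open>g' = - f'\<close>, equality of the two
  expressions for \<open>x k\<close> reads \<open>4 * f k * g k = - w * w * T k * T k\<close> once
  the nonzero \<open>L k\<close> is cancelled, and \<open>4 * f k * g k\<close> is
  \<open>F k * F k - T k * T k\<close>.\<close>

lemma near_bipartite_squares:
  assumes B: "split_numbers d \<theta>' \<theta>s a' x f' g' \<beta> \<gamma>'"
    and a': "\<And>k. k \<le> d \<Longrightarrow> a' k = 0" and \<theta>': "\<And>k. k \<le> d \<Longrightarrow> \<theta>' (d - k) = - \<theta>' k"
  obtains c where "\<And>k. 1 \<le> k \<Longrightarrow> k \<le> d \<Longrightarrow> T k \<noteq> 0"
    "\<And>k. 1 \<le> k \<Longrightarrow> k \<le> d \<Longrightarrow> F k = c * T k \<or> F k = - c * T k"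
proof -
  interpret B: split_numbers d \<theta>' \<theta>s a' x f' g' \<beta> \<gamma>' by (rule B)
  obtain w where w: "w \<noteq> 0" "\<And>k. k \<le> d \<Longrightarrow> B.u k = w * u k"
    "\<And>k. k \<le> d + 1 \<Longrightarrow> B.T k = w * T k"
    using T_proportional[OF B] by blast
  have T: "T k \<noteq> 0" if "1 \<le> k" "k \<le> d" for k
    using B.bipartite_T_nz(3)[OF a' \<theta>' that] w(3)[of k] that by auto
  have F2: "F k * F k = (1 - w * w) * (T k * T k)" if k: "1 \<le> k" "k \<le> d" for k
  proof -
    have L: "B.L k = w * L k"
      unfolding B.L_def L_def using w k by (simp add: algebra_simps)
    have h: "2 * f' k = w * T k" "g' k = - f' k"
      using B.bipartite_T_nz(1,2)[OF a' \<theta>' k] w(3)[of k] k by simp_all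
    have xT: "x k * T k = - f k * g k * L k" by (rule x_T[OF k])
    have "x k * (w * T k) = f' k * f' k * (w * L k)"
      using B.x_T[OF k] w(3)[of k] k h L by simp
    then have "w * L k * (4 * f k * g k + w * w * T k * T k) = 0" using xT h(1)
      by Groebner_Basis.algebra
    moreover have "L k \<noteq> 0" using xT T[OF k] x_nz[OF k] by auto
    ultimately have "4 * f k * g k + w * w * T k * T k = 0" using w(1) by simp
    then show ?thesis unfolding F_def T_def by Groebner_Basis.algebra
  qed
  \<comment> \<open>This ratio is a square root of \<open>1 - w * w\<close>, so none has to be
    extracted from the field.\<close>
  define c where "c = F 1 / T 1"
  have T1: "T 1 \<noteq> 0" using T[of 1] d3 by simp
  have c1: "F 1 = c * T 1" using T1 by (simp add: c_def)
  have c: "c * c = 1 - w * w"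
  proof -
    have "(c * c) * (T 1 * T 1) = (1 - w * w) * (T 1 * T 1)"
      using F2[of 1] d3 unfolding c1 by (simp add: mult_ac)
    then show ?thesis using T1 by simp
  qed
  show thesis
  proof (rule that[of c])
    show "F k = c * T k \<or> F k = - c * T k" if "1 \<le> k" "k \<le> d" for k
    proof -
      have "(F k - c * T k) * (F k + c * T k) = 0" using F2[OF that] c by Groebner_Basis.algebra
      then show ?thesis by (auto simp: eq_neg_iff_add_eq_0)
    qed
  qed (use T in blast)
qed

lemma \<delta>_nz: "1 \<le> k \<Longrightarrow> k \<le> d \<Longrightarrow> \<delta> k \<noteq> 0"
  using \<theta>s_neq by auto

lemma \<delta>\<delta>_nz: "1 \<le> k \<Longrightarrow> k < d \<Longrightarrow> \<delta> (k + 1) + \<delta> k \<noteq> 0"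
  using \<theta>s_neq[of "k + 1" "k - 1"] by auto

text \<open>
  Two consecutive indices with opposite signs force \<open>W = \<plusminus> c\<close>, two with equal signs exclude it;
  and two consecutive sign changes contradict each other.  Hence the sign is constant.
\<close>

lemma sign_constant:
  assumes c: "c \<noteq> 0"
    and t: "\<And>k. 1 \<le> k \<Longrightarrow> k \<le> d \<Longrightarrow> t k = c \<or> t k = - c"
    and eq: "\<And>k. 1 \<le> k \<Longrightarrow> k \<le> d \<Longrightarrow> t k * \<delta> k = K + W * (\<theta>s (k - 1) + \<theta>s k)"
  shows "W - t 1 \<noteq> 0" "\<And>k. 1 \<le> k \<Longrightarrow> k \<le> d \<Longrightarrow> t k = t 1"
    "\<And>k. 1 \<le> k \<Longrightarrow> k < d \<Longrightarrow> (W - t 1) * \<delta> (k + 1) + (W + t 1) * \<delta> k = 0"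
proof -
  have diff: "t (k + 1) * \<delta> (k + 1) - t k * \<delta> k = W * (\<delta> (k + 1) + \<delta> k)" if "1 \<le> k" "k < d" for k
    using eq[of k] eq[of "k + 1"] that by (simp add: algebra_simps)
  have flip: "W = - t k" if k: "1 \<le> k" "k < d" and "t (k + 1) = - t k" for k
  proof -
    have "(W + t k) * (\<delta> (k + 1) + \<delta> k) = 0"
      using diff[OF k] that(3) by Groebner_Basis.algebra
    then show ?thesis using \<delta>\<delta>_nz[OF k] by (simp add: eq_neg_iff_add_eq_0)
  qed
  have same: "(W - t k) * \<delta> (k + 1) + (W + t k) * \<delta> k = 0" if k: "1 \<le> k" "k < d" and "t (k + 1) = t k" for k
    using diff[OF k] that(3) by Groebner_Basis.algebra
  have tnz: "t k \<noteq> 0" if "1 \<le> k" "k \<le> d" for k using t[OF that] c by auto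
  have same': "W \<noteq> c \<and> W \<noteq> - c" if k: "1 \<le> k" "k < d" and e: "t (k + 1) = t k" for k
  proof -
    have nz: "\<delta> k \<noteq> 0" "\<delta> (k + 1) \<noteq> 0" "t k \<noteq> 0" using k \<delta>_nz[of k] \<delta>_nz[of "k + 1"] tnz[of k] by auto
    have "W \<noteq> t k"
    proof
      assume "W = t k"
      then have "(t k + t k) * \<delta> k = 0" using same[OF k e] by simp
      then show False using nz two unfolding mult_2[symmetric] by (simp del: mult_2)
    qed
    moreover have "W \<noteq> - t k"
    proof
      assume "W = - t k"
      then have "(t k + t k) * \<delta> (k + 1) = 0" using same[OF k e] by simp
      then show False using nz two unfolding mult_2[symmetric] by (simp del: mult_2)
    qed
    ultimately show ?thesis using t[of k] k by auto
  qed
  have alt: "t (k + 1) = t k \<or> t (k + 1) = - t k" if "1 \<le> k" "k < d" for k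
    using t[of k] t[of "k + 1"] that by auto
  have noflip: "t (k + 1) = t k" if k: "1 \<le> k" "k < d" for k
  proof (rule ccontr)
    assume "t (k + 1) \<noteq> t k"
    then have "W = - t k" using alt flip k by blast
    then have W: "W = c \<or> W = - c" using t[of k] k by auto
    \<comment> \<open>Since \<open>W\<close> is now \<open>c\<close> or \<open>- c\<close>, equal
      neighbouring signs are excluded everywhere, so the sign changes from 1 to 2 and again from 2
      to 3.\<close>
    then have f: "t 2 = - t 1" "t 3 = - t 2"
      using alt[of 1] same'[of 1] alt[of 2] same'[of 2] d3 by (auto simp: numeral_2_eq_2 numeral_3_eq_3)
    then have "W = - t 1" "W = - t 2" using flip[of 1] flip[of 2] d3 by (auto simp: numeral_2_eq_2 numeral_3_eq_3)
    then have "2 * t 1 = 0" using f by Groebner_Basis.algebra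
    then show False using two tnz[of 1] d3 by auto
  qed
  show const: "t k = t 1" if "1 \<le> k" "k \<le> d" for k
    using that
  proof (induction k rule: nat_induct_at_least)
    case (Suc k)
    then show ?case using noflip[of k] by simp
  qed simp
  show "(W - t 1) * \<delta> (k + 1) + (W + t 1) * \<delta> k = 0" if "1 \<le> k" "k < d" for k
    using same[OF that noflip[OF that]] const[of k] that by simp
  show "W - t 1 \<noteq> 0"
    using same'[of 1] noflip[of 1] t[of 1] d3 by auto
qed

text \<open>For \<open>\<beta> = 2\<close> the increments of \<open>\<theta>\<close> form an
  arithmetic progression, and constancy of \<open>s\<close> makes them palindromic. Comparing terms
  at the middle shows that the common difference is 0; for odd \<open>d\<close> these terms are two
  apart, so one divides by 2.\<close>

lemma \<theta>_arithmetic: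
  assumes \<beta>: "\<beta> = 2" and s: "\<And>k. 1 \<le> k \<Longrightarrow> k \<le> d \<Longrightarrow> s k = s (k - 1)" and k: "1 \<le> k" "k \<le> d"
  shows "\<theta> k - \<theta> (k - 1) = \<theta> 1 - \<theta> 0"
proof -
  define e where "e = (\<lambda>k. \<theta> k - \<theta> (k - 1))"
  have sym: "e (d + 1 - k) = e k" if k: "1 \<le> k" "k \<le> d" for k
  proof -
    have e1: "d + 1 - k - 1 = d - k" and e2: "d + 1 - k = d - (k - 1)" using k by auto
    show ?thesis using s[OF k] unfolding s_def e_def e1 unfolding e2 by Groebner_Basis.algebra
  qed
  have step: "e (k + 2) - e (k + 1) = e (k + 1) - e k" if "1 \<le> k" "k + 2 \<le> d" for k
  proof -
    have "\<theta> (k - 1) + \<theta> (k + 1) = 2 * \<theta> k + \<gamma>" "\<theta> k + \<theta> (k + 2) = 2 * \<theta> (k + 1) + \<gamma>"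
      using \<theta>_rec[of k] \<theta>_rec[of "k + 1"] that \<beta> by simp_all
    then show ?thesis unfolding e_def by (simp add: algebra_simps)
  qed
  have lin: "1 \<le> k \<Longrightarrow> k + 1 \<le> d \<Longrightarrow> e (k + 1) - e k = e 2 - e 1" for k
  proof (induction k rule: nat_induct_at_least)
    case (Suc k)
    then show ?case using step[of k] by simp
  qed (simp add: numeral_2_eq_2)
  have z: "e 2 - e 1 = 0"
  proof (cases "even d")
    case True
    then obtain m where m: "d = 2 * m" by blast
    then have "d + 1 - m = m + 1" by simp
    then show ?thesis using sym[of m] lin[of m] m d3 by simp
  next
    case False
    then obtain m where m: "d = 2 * m + 1" by (auto elim: oddE)
    then have "d + 1 - m = m + 2" by simp
    then have "e (m + 2) = e m" using sym[of m] m d3 by simp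
    moreover have "e (m + 2) - e (m + 1) = e 2 - e 1" "e (m + 1) - e m = e 2 - e 1"
      using lin[of m] lin[of "m + 1"] m d3 by simp_all
    ultimately have "(e 2 - e 1) + (e 2 - e 1) = 0" by (metis add.commute diff_add_cancel diff_add_eq eq_iff_diff_eq_0 add_diff_eq)
    then have "2 * (e 2 - e 1) = 0" by (simp only: mult_2)
    then show ?thesis using two by simp
  qed
  have "e k = e 1" using k
  proof (induction k rule: nat_induct_at_least)
    case (Suc k)
    then show ?case using lin[of k] z by simp
  qed simp
  then show ?thesis by (simp add: e_def)
qed

text \<open>The recurrence for the first three increments makes \<open>h\<close> a root of
  \<open>h * h - \<beta> * h + 1\<close>; the root -1 is impossible because
  \<open>\<theta>s 0 \<noteq> \<theta>s 2\<close>. Hence \<open>\<beta> = -2\<close> cannot occur,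
  and \<open>\<beta> = 2\<close> leaves only the double root 1.\<close>

lemma geometric_\<beta>:
  assumes h: "\<And>k. 1 \<le> k \<Longrightarrow> k < d \<Longrightarrow> \<delta> (k + 1) = h * \<delta> k"
  shows "h \<noteq> 0" "1 + h \<noteq> 0" "1 + h * h = \<beta> * h" "\<beta> = h + inverse h" "\<beta> \<noteq> - 2" "\<beta> = 2 \<Longrightarrow> h = 1"
proof -
  have d1: "\<delta> 1 \<noteq> 0" "\<delta> 2 \<noteq> 0" using \<delta>_nz[of 1] \<delta>_nz[of 2] d3 by auto
  have d2: "\<delta> 2 = h * \<delta> 1" "\<delta> 3 = h * \<delta> 2" using h[of 1] h[of 2] d3 by (simp_all add: numeral_2_eq_2 numeral_3_eq_3)
  show h0: "h \<noteq> 0" using d1 d2 by auto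
  show h1: "1 + h \<noteq> 0"
  proof
    assume "1 + h = 0"
    then have "\<delta> 2 + \<delta> 1 = 0" using d2(1) by Groebner_Basis.algebra
    then show False using \<delta>\<delta>_nz[of 1] d3 by (simp add: numeral_2_eq_2)
  qed
  have "\<delta> 1 + \<delta> 3 = \<beta> * \<delta> 2" using \<theta>s_rec[of 1] d3 by (simp add: numeral_2_eq_2 numeral_3_eq_3)
  then have "\<delta> 1 * (1 + h * h - \<beta> * h) = 0" using d2 by Groebner_Basis.algebra
  then show q: "1 + h * h = \<beta> * h" using d1 by simp
  then show "\<beta> = h + inverse h" using h0 by (simp add: field_simps)
  show "\<beta> \<noteq> - 2"
  proof
    assume "\<beta> = - 2"
    then have "(1 + h) * (1 + h) = 0" using q by Groebner_Basis.algebra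
    then show False using h1 by simp
  qed
  show "h = 1" if "\<beta> = 2"
  proof -
    have "(h - 1) * (h - 1) = 0" using q that by Groebner_Basis.algebra
    then show ?thesis by simp
  qed
qed

lemma near_bipartite_numbers:
  assumes B: "split_numbers d \<theta>' \<theta>s a' x f' g' \<beta> \<gamma>'"
    and a': "\<And>k. k \<le> d \<Longrightarrow> a' k = 0" and \<theta>': "\<And>k. k \<le> d \<Longrightarrow> \<theta>' (d - k) = - \<theta>' k"
    and not_const: "\<not> (\<forall>k\<le>d. a k = a 0)"
  obtains h r where "\<And>k. 1 \<le> k \<Longrightarrow> k < d \<Longrightarrow> \<delta> (k + 1) = h * \<delta> k"
    "\<And>k. 1 \<le> k \<Longrightarrow> k \<le> d \<Longrightarrow> f k = r * g k"
    "\<And>k. \<beta> = 2 \<Longrightarrow> 1 \<le> k \<Longrightarrow> k \<le> d \<Longrightarrow> \<theta> k - \<theta> (k - 1) = \<theta> 1 - \<theta> 0"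
    "\<And>i. \<beta> \<noteq> 2 \<Longrightarrow> 1 \<le> i \<Longrightarrow> i < d \<Longrightarrow> h ^ i \<noteq> - 1"
proof -
  interpret B: split_numbers d \<theta>' \<theta>s a' x f' g' \<beta> \<gamma>' by (rule B)
  obtain c where T: "\<And>k. 1 \<le> k \<Longrightarrow> k \<le> d \<Longrightarrow> T k \<noteq> 0"
    and c: "\<And>k. 1 \<le> k \<Longrightarrow> k \<le> d \<Longrightarrow> F k = c * T k \<or> F k = - c * T k"
    using near_bipartite_squares[OF B a' \<theta>'] by blast
  obtain W K where W: "\<And>k. 1 \<le> k \<Longrightarrow> k \<le> d \<Longrightarrow> s k - s (k - 1) = W * (T (k + 1) - T (k - 1))"
    and K: "\<And>k. 1 \<le> k \<Longrightarrow> k \<le> d \<Longrightarrow> F k * \<delta> k = T k * (K + W * (\<theta>s (k - 1) + \<theta>s k))"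
    using F_formula[OF T] by blast
  \<comment> \<open>For \<open>c = 0\<close> the affine function in \<open>F_formula\<close>
    vanishes at two distinct arguments, so \<open>W = 0\<close>; then \<open>s\<close>, and with it
    \<open>a\<close>, is constant.\<close>
  have c0: "c \<noteq> 0"
  proof
    assume "c = 0"
    then have F: "F k = 0" if "1 \<le> k" "k \<le> d" for k using c[OF that] by auto
    then have "K + W * (\<theta>s (k - 1) + \<theta>s k) = 0" if "1 \<le> k" "k \<le> d" for k
      using K[OF that] T[OF that] that by simp
    from this[of 1] this[of 2] have "K + W * (\<theta>s 0 + \<theta>s 1) = 0" "K + W * (\<theta>s 1 + \<theta>s 2) = 0"
      using d3 by simp_all
    then have "W * (\<theta>s 2 - \<theta>s 0) = 0" by Groebner_Basis.algebra
    then have "W = 0" using \<theta>s_neq[of 2 0] d3 by auto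
    then have st: "s k = s (k - 1)" if "1 \<le> k" "k \<le> d" for k using W[OF that] by simp
    have s: "k \<le> d \<Longrightarrow> s k = s 0" for k
    proof (induction k)
      case (Suc k)
      then show ?case using st[of "Suc k"] by simp
    qed simp
    have F': "F k = 0" if "k \<le> d + 1" for k
      using F[of k] that F_end by (cases "k = 0 \<or> k = d + 1") auto
    have a: "2 * a k = s 0" if "k \<le> d" for k
      unfolding F_Suc[OF that] by (use s[OF that] F'[of k] F'[of "k + 1"] that in simp)
    have "a k = a 0" if "k \<le> d" for k
    proof -
      have "2 * a k = 2 * a 0" by (simp only: a[OF that] a[of 0])
      then show ?thesis using two by (metis mult_left_cancel)
    qed
    then show False using not_const by blast
  qed
  define t where "t k = F k / T k" for k
  have Ft: "F k = t k * T k" if "1 \<le> k" "k \<le> d" for k using T[OF that] by (simp add: t_def)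
  have tc: "t k = c \<or> t k = - c" if "1 \<le> k" "k \<le> d" for k
    using c[OF that] T[OF that] by (auto simp: t_def)
  have te: "t k * \<delta> k = K + W * (\<theta>s (k - 1) + \<theta>s k)" if "1 \<le> k" "k \<le> d" for k
    using K[OF that] T[OF that] by (simp add: t_def divide_simps mult_ac)
  have sc1: "W - t 1 \<noteq> 0" by (rule sign_constant(1)[OF c0 tc te])
  have sc2: "t k = t 1" if "1 \<le> k" "k \<le> d" for k by (rule sign_constant(2)[OF c0 tc te that])
  have sc3: "(W - t 1) * \<delta> (k + 1) + (W + t 1) * \<delta> k = 0" if "1 \<le> k" "k < d" for k
    by (rule sign_constant(3)[OF c0 tc te that])
  define h where "h = (W + t 1) / (t 1 - W)"
  have W1: "t 1 - W \<noteq> 0" using sc1 by simp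
  have h: "\<delta> (k + 1) = h * \<delta> k" if "1 \<le> k" "k < d" for k
  proof -
    have "(t 1 - W) * \<delta> (k + 1) = (W + t 1) * \<delta> k" using sc3[OF that] by Groebner_Basis.algebra
    then show ?thesis using W1 by (simp add: h_def divide_simps mult_ac)
  qed
  have F1: "F k = t 1 * T k" if "1 \<le> k" "k \<le> d" for k using Ft[OF that] sc2[OF that] by simp
  have t1: "t 1 - 1 \<noteq> 0"
  proof
    assume "t 1 - 1 = 0"
    then have "2 * g 1 = 0" using F1[of 1] d3 by (simp add: F_def T_def)
    then show False using g_nz[of 1] two d3 by simp
  qed
  \<comment> \<open>The constant \<open>(t 1 + 1) / (t 1 - 1)\<close> solves
    \<open>f + g = t 1 * (f - g)\<close> for \<open>f / g\<close>.\<close>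
  show thesis
  proof (rule that[of h "(t 1 + 1) / (t 1 - 1)"])
    show "f k = (t 1 + 1) / (t 1 - 1) * g k" if "1 \<le> k" "k \<le> d" for k
    proof -
      have "(t 1 - 1) * f k = (t 1 + 1) * g k"
        using F1[OF that] unfolding F_def T_def by Groebner_Basis.algebra
      then show ?thesis using t1 by (simp add: divide_simps mult_ac)
    qed
    show "\<theta> k - \<theta> (k - 1) = \<theta> 1 - \<theta> 0" if \<beta>: "\<beta> = 2" and k: "1 \<le> k" "k \<le> d" for k
    proof (rule \<theta>_arithmetic[OF \<beta> _ k])
      have "h = 1" using geometric_\<beta>(6)[OF h \<beta>] by blast
      then have "(W + t 1) = (t 1 - W)" using W1 by (simp add: h_def)
      then have "2 * W = 0" by Groebner_Basis.algebra
      then have "W = 0" using two by simp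
      then show "s k = s (k - 1)" if "1 \<le> k" "k \<le> d" for k using W[OF that] by simp
    qed
    \<comment> \<open>Antisymmetry of \<open>\<theta>'\<close> forces \<open>\<gamma>' = 0\<close>,
      so its recurrence is homogeneous and \<open>h ^ i = -1\<close> would give
      \<open>\<theta>' i = - \<theta>' 0 = \<theta>' d\<close>, against distinctness.\<close>
    show "h ^ i \<noteq> - 1" if \<beta>: "\<beta> \<noteq> 2" and i: "1 \<le> i" "i < d" for i
    proof
      assume hi: "h ^ i = - 1"
      have gb: "h \<noteq> 0" "1 + h \<noteq> 0" "1 + h * h = \<beta> * h" "\<beta> = h + inverse h"
        using geometric_\<beta>[OF h] by blast+
      have "2 * \<gamma>' = 0"
        using B.\<theta>_rec[of 1] B.\<theta>_rec[of "d - 1"] \<theta>'[of 0] \<theta>'[of 1] \<theta>'[of 2] d3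
        by (simp add: numeral_2_eq_2 algebra_simps)
      then have \<gamma>: "\<gamma>' = 0" using two by simp
      have hh: "h * h \<noteq> 1"
      proof
        assume e: "h * h = 1"
        then have "(h - 1) * (h + 1) = 0" by Groebner_Basis.algebra
        then have "h = 1" using gb(2) by (auto simp: add.commute)
        then show False using gb(3) \<beta> by simp
      qed
      have "\<theta>' i = - \<theta>' 0"
      proof (rule power_eq_minus_one_recurrence[of d \<theta>' \<beta> h])
        show "\<theta>' (k - 1) + \<theta>' (k + 1) = \<beta> * \<theta>' k" if "1 \<le> k" "k < d" for k
          using B.\<theta>_rec[OF that] \<gamma> by simp
      qed (use gb hh i hi in auto)
      then have "\<theta>' i = \<theta>' d" using \<theta>'[of 0] by simp
      then show False using B.\<theta>_neq[of i d] i by simp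
    qed
  qed (use h in blast)
qed

end

section \<open>Geometric dual eigenvalues\<close>

text \<open>The q-integer with base \<open>h\<close>, written as a sum so that \<open>h = 1\<close>
  is included.\<close>

definition qnum :: "'a::field \<Rightarrow> nat \<Rightarrow> 'a" where
  "qnum h n = (\<Sum>i<n. h ^ i)"

lemma qnum_0 [simp]: "qnum h 0 = 0" and qnum_1 [simp]: "qnum h (Suc 0) = 1"
  by (simp_all add: qnum_def)

lemma qnum_Suc: "qnum h (Suc n) = qnum h n + h ^ n"
  by (simp add: qnum_def)

text \<open>Rewriting powers in this way turns the later identities into polynomial identities in
  q-integers, valid also for \<open>h = 1\<close>.\<close>

lemma power_qnum: "h ^ n = 1 + (h - 1) * qnum h n"
proof (induction n)
  case (Suc n)
  obtain H where H: "h ^ n = H" by blast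
  show ?case using Suc unfolding qnum_Suc power_Suc H by Groebner_Basis.algebra
qed simp

lemma qnum_add: "qnum h (m + n) = qnum h m + qnum h n + (h - 1) * qnum h m * qnum h n"
proof (induction n)
  case (Suc n)
  have "qnum h (m + Suc n) = qnum h (m + n) + h ^ m * h ^ n" by (simp add: qnum_Suc power_add)
  then show ?case
    unfolding Suc qnum_Suc power_qnum[of h m] power_qnum[of h n] by Groebner_Basis.algebra
qed simp

text \<open>Up to a factor, the eigenvalues of the bipartite pair:
  \<open>(h ^ (d - k) - h ^ k) / (h - 1)\<close> if \<open>h \<noteq> 1\<close>, and
  \<open>d - 2 * k\<close> if \<open>h = 1\<close>.\<close>

definition qeig :: "'a::field \<Rightarrow> nat \<Rightarrow> nat \<Rightarrow> 'a" where
  "qeig h d k = h ^ k * qnum h (d - k) - qnum h k * h ^ (d - k)"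

lemma qeig_anti: "k \<le> d \<Longrightarrow> qeig h d (d - k) = - qeig h d k"
  by (simp add: qeig_def mult.commute)

lemma qeig_rec:
  assumes h: "1 + h * h = \<beta> * h" "h \<noteq> 0" and k: "1 \<le> k" "k < d"
  shows "qeig h d (k - 1) + qeig h d (k + 1) = \<beta> * qeig h d k"
proof -
  obtain i m where i: "k = i + 1" "d = (i + 1) + (m + 1)"
    using k by (metis Suc_eq_plus1 add.commute less_imp_Suc_add not_one_le_zero old.nat.exhaust add_Suc_right)
  have e: "d - (k - 1) = m + 1 + 1" "d - (k + 1) = m" "d - k = m + 1" "k - 1 = i" "k + 1 = i + 1 + 1"
    using i by auto
  have q: "qnum h 1 = 1" by simp
  have "h * (qeig h d (k - 1) + qeig h d (k + 1)) = h * (\<beta> * qeig h d k)"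
    unfolding qeig_def e(1-3) unfolding e(4,5)
    unfolding i(1) power_qnum[of h "_ + _"] power_qnum[of h i] power_qnum[of h m] qnum_add q
    using h(1) by Groebner_Basis.algebra
  then show ?thesis using h(2) by simp
qed

text \<open>This factorization reduces distinctness to nonzero q-integers and nonzero sums of two
  powers of \<open>h\<close>, that is, to powers of \<open>h\<close> different from -1.\<close>

lemma qeig_diff:
  assumes "i < j" "j \<le> d"
  shows "qeig h d i - qeig h d j = qnum h (j - i) * (h ^ i + h ^ (d - j))"
proof -
  obtain n m where i: "j = i + n" "d = i + n + m"
    using assms by (metis le_Suc_ex less_imp_le_nat)
  have e: "d - i = n + m" "d - j = m" "j - i = n" using i by auto
  show ?thesis
    unfolding qeig_def e unfolding i(1) power_qnum[of h "_ + _"] power_qnum[of h i] power_qnum[of h m] qnum_add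
    by Groebner_Basis.algebra
qed

lemma qeig_inj:
  assumes two: "(2::'a::field) \<noteq> 0" and h0: "(h::'a) \<noteq> 0"
    and nz: "\<And>k. 1 \<le> k \<Longrightarrow> k \<le> d \<Longrightarrow> qnum h k \<noteq> 0"
    and h: "\<And>i. 1 \<le> i \<Longrightarrow> i < d \<Longrightarrow> h ^ i \<noteq> - 1"
  shows "inj_on (qeig h d) {..d}"
proof -
  have pm: "h ^ k + h ^ l \<noteq> 0" if kl: "k \<le> l" "l - k < d" for k l
  proof
    assume "h ^ k + h ^ l = 0"
    moreover have "h ^ l = h ^ k * h ^ (l - k)" using kl by (simp flip: power_add)
    ultimately have "h ^ k * (1 + h ^ (l - k)) = 0" by (simp add: distrib_left)
    then have e: "1 + h ^ (l - k) = 0" using h0 by simp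
    show False
    proof (cases "k = l")
      case True
      then show ?thesis using e two by simp
    next
      case False
      then have "1 \<le> l - k" using kl by simp
      then show ?thesis using h[of "l - k"] e kl by (simp add: eq_neg_iff_add_eq_0 add.commute)
    qed
  qed
  have "qeig h d i \<noteq> qeig h d j" if ij: "i < j" "j \<le> d" for i j
  proof -
    have "h ^ i + h ^ (d - j) \<noteq> 0"
    proof (cases "i \<le> d - j")
      case True
      then show ?thesis using pm[of i "d - j"] ij by auto
    next
      case False
      then show ?thesis using pm[of "d - j" i] ij by (auto simp: add.commute)
    qed
    then show ?thesis using qeig_diff[OF ij, of h] nz[of "j - i"] ij by auto
  qed
  then show ?thesis by (intro inj_onI) (metis atMost_iff linorder_neqE_nat)
qed

text \<open>
  The coordinates, in an eigenbasis of \<open>A\<^sup>*\<close> whose eigenvalues are in geometric progression,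
  of a basis that splits the bipartite pair.
\<close>

fun split_coeff :: "'a::field \<Rightarrow> 'a \<Rightarrow> nat \<Rightarrow> nat \<Rightarrow> nat \<Rightarrow> 'a" where
  "split_coeff l h d 0 i = (if i = 0 then 1 else 0)"
| "split_coeff l h d (Suc j) i = (if i = Suc j then 1 else if i \<le> j then
     l * h ^ (j - i) * qnum h (Suc j) * qnum h (d - j) / qnum h (Suc j - i) * split_coeff l h d j i else 0)"

lemma split_coeff_diag [simp]: "split_coeff l h d j j = 1"
  by (cases j) auto

lemma split_coeff_beyond: "j < i \<Longrightarrow> split_coeff l h d j i = 0"
  by (cases j) auto

text \<open>The recursion has the factor \<open>qnum h (d - d) = 0\<close> at this stage, so the
  chain of split vectors stops after \<open>d + 1\<close> of them.\<close>

lemma split_coeff_end: "i \<le> d \<Longrightarrow> split_coeff l h d (Suc d) i = 0"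
  by simp

text \<open>The definition of \<open>split_coeff\<close> recurses from one vector to the next at a
  fixed coordinate. The action of \<open>A\<close> also involves neighbouring coordinates of the
  same vector; this relation links them.\<close>

lemma split_coeff_col:
  assumes nz: "\<And>k. 1 \<le> k \<Longrightarrow> k \<le> d \<Longrightarrow> qnum h k \<noteq> 0"
  shows "j + n + 1 \<le> d \<Longrightarrow> split_coeff l h d (j + n + 1) j * qnum h (n + 1) =
     l * h ^ n * qnum h (j + 1) * qnum h (d - j) * split_coeff l h d (j + n + 1) (j + 1)"
proof (induction n)
  case (Suc n)
  define N where "N = qnum h (j + n + 2) * qnum h (d - (j + n + 1))"
  have q: "qnum h (n + 1) \<noteq> 0" "qnum h (n + 2) \<noteq> 0" using nz[of "n + 1"] nz[of "n + 2"] Suc by auto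
  have 1: "split_coeff l h d (j + n + 2) j * qnum h (n + 2) = l * h ^ (n + 1) * N * split_coeff l h d (j + n + 1) j"
    using q by (simp add: N_def)
  have 2: "split_coeff l h d (j + n + 2) (j + 1) * qnum h (n + 1) = l * h ^ n * N * split_coeff l h d (j + n + 1) (j + 1)"
    using q by (simp add: N_def)
  have IH: "split_coeff l h d (j + n + 1) j * qnum h (n + 1) =
     l * h ^ n * qnum h (j + 1) * qnum h (d - j) * split_coeff l h d (j + n + 1) (j + 1)"
    using Suc by simp
  obtain H where H: "h ^ n = H" by blast
  have "qnum h (n + 1) * (split_coeff l h d (j + n + 2) j * qnum h (n + 2)) =
     qnum h (n + 1) * (l * h ^ (n + 1) * qnum h (j + 1) * qnum h (d - j) * split_coeff l h d (j + n + 2) (j + 1))"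
    using 1 2 IH unfolding power_add power_one_right H by Groebner_Basis.algebra
  then have "split_coeff l h d (j + n + 2) j * qnum h (n + 2) =
     l * h ^ (n + 1) * qnum h (j + 1) * qnum h (d - j) * split_coeff l h d (j + n + 2) (j + 1)"
    by (rule mult_left_cancel[THEN iffD1, OF q(1)])
  then show ?case by (simp del: split_coeff.simps)
qed simp

text \<open>After multiplication by \<open>qnum h (j - i + 1)\<close> every term is a multiple of
  \<open>split_coeff l h d j i\<close>, which leaves an identity of q-integers. The equation is the
  coordinate form of the action of a zero-diagonal \<open>A\<close> on a split vector.\<close>

lemma split_coeff_A:
  assumes nz: "\<And>k. 1 \<le> k \<Longrightarrow> k \<le> d \<Longrightarrow> qnum h k \<noteq> 0"
    and x: "\<And>k. 1 \<le> k \<Longrightarrow> k \<le> d \<Longrightarrow> x k = l * l * qnum h k * qnum h (d + 1 - k) * h ^ (d - k)"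
    and ij: "i \<le> d" "j \<le> d"
  shows "(if i = 0 then 0 else split_coeff l h d j (i - 1)) + x (i + 1) * split_coeff l h d j (i + 1)
     = - l * qeig h d j * split_coeff l h d j i + split_coeff l h d (Suc j) i"
proof (cases "i \<le> j")
  case False
  then show ?thesis
    by (cases "i = Suc j") (auto simp: split_coeff_beyond)
next
  case True
  then obtain n where n: "j = i + n" using le_Suc_ex by blast
  obtain m where m: "d = i + n + m" using ij n le_Suc_ex by blast
  define c where "c = split_coeff l h d j i"
  have e: "d - j = m" "d - i = n + m" using n m by auto
  have up: "x (i + 1) * split_coeff l h d j (i + 1) = l * h ^ m * qnum h n * c"
  proof (cases n)
    case 0
    then show ?thesis using n by (simp add: split_coeff_beyond)
  next
    case (Suc n')
    have col: "c * qnum h n = l * h ^ n' * qnum h (i + 1) * qnum h (d - i) * split_coeff l h d j (i + 1)"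
      using split_coeff_col[where j = i and n = n' and l = l and d = d and h = h, OF nz] Suc n m by (simp add: c_def del: split_coeff.simps)
    have xi: "x (i + 1) = l * l * qnum h (i + 1) * qnum h (d - i) * (h ^ n' * h ^ m)"
      using x[of "i + 1"] Suc n m by (simp add: power_add)
    obtain H H' where H: "h ^ n' = H" "h ^ m = H'" by blast
    show ?thesis using col unfolding xi H by Groebner_Basis.algebra
  qed
  have nxt: "split_coeff l h d (Suc j) i * qnum h (n + 1) = l * h ^ n * qnum h (j + 1) * qnum h m * c"
  proof (cases "j = d")
    case True
    then have "m = 0" using n m by simp
    then show ?thesis using split_coeff_end[OF ij(1), of l h] True by (simp del: split_coeff.simps)
  next
    case False
    then have "qnum h (n + 1) \<noteq> 0" using nz[of "n + 1"] ij n by auto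
    then show ?thesis using n e by (simp add: c_def)
  qed
  show ?thesis
  proof (cases "n = d")
    \<comment> \<open>Now \<open>qnum h (n + 1)\<close> is \<open>qnum h (d + 1)\<close>, which may
      be 0 and must not be cancelled.\<close>
    case True
    then have "i = 0" "m = 0" "j = d" using n m by auto
    moreover have "split_coeff l h d (Suc d) 0 = 0" by (rule split_coeff_end) simp
    ultimately show ?thesis using up True
      by (simp add: qeig_def c_def del: split_coeff.simps)
  next
    case False
    then have q: "qnum h (n + 1) \<noteq> 0" using nz[of "n + 1"] n ij by auto
    have down: "(if i = 0 then 0 else split_coeff l h d j (i - 1)) * qnum h (n + 1)
       = l * h ^ n * qnum h i * qnum h (n + m + 1) * c"
    proof (cases i)
      case (Suc i')
      then show ?thesis using split_coeff_col[where j = i' and n = n and l = l and d = d and h = h, OF nz] n m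
        by (simp add: c_def del: split_coeff.simps)
    qed simp
    have q1: "qnum h 1 = 1" by simp
    define z where "z = (if i = 0 then 0 else split_coeff l h d j (i - 1))"
    have "qnum h (n + 1) * (z + x (i + 1) * split_coeff l h d j (i + 1)) =
      qnum h (n + 1) * (- l * qeig h d j * c + split_coeff l h d (Suc j) i)"
      using nxt up down[folded z_def] unfolding qeig_def e unfolding n power_qnum[of h "_ + _"] power_qnum[of h i]
        power_qnum[of h m] power_qnum[of h n] qnum_add q1 by Groebner_Basis.algebra
    then show ?thesis unfolding z_def[symmetric] c_def[symmetric]
      by (rule mult_left_cancel[THEN iffD1, OF q])
  qed
qed

section \<open>Closed forms for geometric increments of the dual eigenvalues\<close>

context split_numbers
begin

context
  fixes h
  assumes h: "\<And>k. 1 \<le> k \<Longrightarrow> k < d \<Longrightarrow> \<delta> (k + 1) = h * \<delta> k"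
begin

lemma \<theta>s_geometric: "k \<le> d \<Longrightarrow> \<theta>s k = \<theta>s 0 + \<delta> 1 * qnum h k"
proof -
  have \<delta>: "k + 1 \<le> d \<Longrightarrow> \<delta> (k + 1) = \<delta> 1 * h ^ k" for k
  proof (induction k)
    case (Suc k)
    then show ?case using h[of "k + 1"] by simp
  qed simp
  show "k \<le> d \<Longrightarrow> \<theta>s k = \<theta>s 0 + \<delta> 1 * qnum h k"
  proof (induction k)
    case (Suc k)
    obtain H where H: "h ^ k = H" by blast
    have "\<theta>s (Suc k) - \<theta>s k = (\<theta>s 1 - \<theta>s 0) * H" "\<theta>s k = \<theta>s 0 + (\<theta>s 1 - \<theta>s 0) * qnum h k"
      using \<delta>[of k] Suc H by simp_all
    then show ?case unfolding qnum_Suc H by simp Groebner_Basis.algebra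
  qed simp
qed

lemma qnum_nz: "1 \<le> k \<Longrightarrow> k \<le> d \<Longrightarrow> qnum h k \<noteq> 0"
  using \<theta>s_geometric[of k] \<theta>s_neq[of k 0] by auto

text \<open>By uniqueness of antisymmetric solutions \<open>u\<close> is proportional to
  \<open>qeig h d\<close>, and the sums telescope because \<open>qeig h d k\<close> is the increment
  of \<open>qnum h k * qnum h (d + 1 - k)\<close>.\<close>

lemma T_geometric:
  assumes "k \<le> d + 1" shows "T k = u 0 / qnum h d * (qnum h k * qnum h (d + 1 - k))"
proof -
  have h0: "h \<noteq> 0" "1 + h * h = \<beta> * h" using geometric_\<beta>[OF h] by blast+
  have qd: "qnum h d \<noteq> 0" using qnum_nz[of d] d3 by simp
  obtain w where w: "\<And>k. 1 \<le> k \<Longrightarrow> k \<le> d + 1 \<Longrightarrow> u (k - 1) = w * qeig h d (k - 1)"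
  proof (rule antisymmetric_recurrence_proportional[where n = "d + 1" and \<beta> = \<beta> and
      z = "\<lambda>k. u (k - 1)" and P = "\<lambda>k. qeig h d (k - 1)" and j = 1])
    show "qeig h d (k - 1) + qeig h d (k + 2 - 1) = \<beta> * qeig h d (k + 1 - 1)" if "1 \<le> k" "k + 2 \<le> d + 1" for k
      using qeig_rec[OF h0(2,1), of k d] that by simp
    show "u (k - 1) + u (k + 2 - 1) = \<beta> * u (k + 1 - 1)" if "1 \<le> k" "k + 2 \<le> d + 1" for k
      using u_rec[of k] that by simp
    show "u (d + 1 + 1 - k - 1) = - u (k - 1)" if "1 \<le> k" "k \<le> d + 1" for k
      using u_anti[of "k - 1"] that by simp
    show "qeig h d (d + 1 + 1 - k - 1) = - qeig h d (k - 1)" if "1 \<le> k" "k \<le> d + 1" for k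
      using qeig_anti[of "k - 1" d h] that by simp
    show "qeig h d (1 - 1) \<noteq> 0" using qd by (simp add: qeig_def)
    fix w assume "\<And>k. 1 \<le> k \<Longrightarrow> k \<le> d + 1 \<Longrightarrow> u (k - 1) = w * qeig h d (k - 1)"
    then show thesis by (rule that)
  qed (use two d3 in auto)
  have w: "u k = w * qeig h d k" if "k \<le> d" for k using w[of "k + 1"] that by simp
  have "u 0 = w * qnum h d" using w[of 0] by (simp add: qeig_def)
  then have w': "u 0 / qnum h d = w" using qd by simp
  have "k \<le> d + 1 \<Longrightarrow> T k = w * (qnum h k * qnum h (d + 1 - k))"
  proof (induction k)
    case (Suc k)
    have "d + 1 - k = Suc (d - k)" using Suc by simp
    then have "qnum h (d + 1 - k) = qnum h (d - k) + h ^ (d - k)" by (simp add: qnum_Suc)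
    moreover have "T (Suc k) = w * (qnum h k * qnum h (d + 1 - k)) + w * qeig h d k"
      using Suc T_Suc[of k] w[of k] by simp
    ultimately show ?case by (simp add: qeig_def qnum_Suc algebra_simps)
  qed simp
  then show ?thesis using assms w' by simp
qed

lemma T_geometric_nz: "1 \<le> k \<Longrightarrow> k \<le> d \<Longrightarrow> T k \<noteq> 0"
  using T_geometric[of k] u_0 qnum_nz[of k] qnum_nz[of "d + 1 - k"] qnum_nz[of d] d3 by auto

text \<open>All relevant \<open>kap\<close> equal \<open>1 / (1 + h)\<close>, so \<open>L k\<close>
  collapses to a multiple of \<open>h ^ (d - k)\<close>; inserting \<open>f = p * T\<close> and
  \<open>g = (p - 1) * T\<close> into \<open>x_T\<close> gives the closed form.\<close>

lemma x_geometric: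
  assumes p: "\<And>k. 1 \<le> k \<Longrightarrow> k \<le> d \<Longrightarrow> f k = p * T k" and l: "l * l = p * (1 - p) * (u 0 / qnum h d)\<^sup>2"
    and k: "1 \<le> k" "k \<le> d"
  shows "x k = l * l * qnum h k * qnum h (d + 1 - k) * h ^ (d - k)"
proof -
  define w where "w = u 0 / qnum h d"
  have h1: "1 + h \<noteq> 0" using geometric_\<beta>[OF h] by blast
  have kap: "kap \<theta>s j = inverse (1 + h)" if "2 \<le> j" "j \<le> d" for j
  proof -
    have "j - 1 - 1 = j - 2" using that by simp
    then have "\<delta> j = h * \<delta> (j - 1)" "\<delta> (j - 1) = \<theta>s (j - 1) - \<theta>s (j - 2)" using h[of "j - 1"] that by auto
    then have e: "\<theta>s j - \<theta>s (j - 2) = (1 + h) * (\<theta>s (j - 1) - \<theta>s (j - 2))" by (simp add: algebra_simps)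
    have "\<theta>s (j - 1) - \<theta>s (j - 2) \<noteq> 0" using \<theta>s_neq[of "j - 1" "j - 2"] that by auto
    then show ?thesis unfolding kap_def e using h1 by (simp add: divide_simps)
  qed
  \<comment> \<open>At \<open>k = 1\<close> the value of \<open>kap\<close> is different and at
    \<open>d + 1\<close> it is meaningless, but there the factors \<open>T 0\<close> and
    \<open>T (d + 1)\<close> vanish.\<close>
  have 1: "T (k - 1) * kap \<theta>s k = T (k - 1) * inverse (1 + h)"
    using kap[of k] k by (cases "k = 1") auto
  have 2: "T (k + 1) * kap \<theta>s (k + 1) = T (k + 1) * inverse (1 + h)"
  proof (cases "k = d")
    case False
    then show ?thesis using kap[of "k + 1"] k by simp
  next
    case True
    then show ?thesis using T_end by (metis mult_zero_left)
  qed
  obtain i where i: "k = i + 1" using k by (metis Suc_eq_plus1 Suc_le_D One_nat_def)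
  obtain m where m: "d = i + 1 + m" using k i le_Suc_ex by blast
  have e: "d + 1 - k = m + 1" "d + 1 - (k - 1) = m + 1 + 1" "d + 1 - (k + 1) = m" "k - 1 = i" "k + 1 = i + 1 + 1" "d - k = m"
    using i m by auto
  have Tk: "T k = u 0 / qnum h d * (qnum h k * qnum h (d + 1 - k))"
    using T_geometric[of k] k by simp
  have q1: "qnum h 1 = 1" by simp
  have uk: "u (k - 1) = T k - T (k - 1)" using T_Suc[of "k - 1"] k by simp
  have "T (k - 1) = w * (qnum h (k - 1) * qnum h (d + 1 - (k - 1)))"
    unfolding w_def by (rule T_geometric) (use k in simp)
  then have T1: "T (k - 1) = w * (qnum h i * qnum h (m + 1 + 1))" unfolding e(2) unfolding e(4) .
  have "T (k + 1) = w * (qnum h (k + 1) * qnum h (d + 1 - (k + 1)))"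
    unfolding w_def by (rule T_geometric) (use k in simp)
  then have T2: "T (k + 1) = w * (qnum h (i + 1 + 1) * qnum h m)" unfolding e(3) unfolding e(5) .
  have T3: "T k = w * (qnum h (i + 1) * qnum h (m + 1))" using Tk unfolding w_def[symmetric] e(1) unfolding i .
  have "(1 + h) * L k = (1 + h) * T k - h * T (k - 1) - T (k + 1)"
    unfolding L_def uk 1 2 using right_inverse[OF h1] by Groebner_Basis.algebra
  also have "\<dots> = (1 + h) * (w * h ^ m)"
    unfolding T1 T2 T3 qnum_add q1 power_qnum[of h m] by Groebner_Basis.algebra
  finally have L: "L k = w * h ^ m" using h1 by simp
  have g: "g k = (p - 1) * T k" using p[OF k] by (simp add: T_def algebra_simps)
  have "x k * T k = p * (1 - p) * T k * L k * T k" using x_T[OF k] unfolding p[OF k] g by Groebner_Basis.algebra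
  then have "x k = p * (1 - p) * T k * L k" using T_geometric_nz[OF k] by simp
  then show ?thesis unfolding L Tk w_def[symmetric] e l
    by (simp add: power2_eq_square mult_ac)
qed

end

text \<open>Krawtchouk type constrains only the eigenvalue sequences, so the proportionality of the
  split numbers has to be derived. Constant increments give \<open>s 1 = s 0\<close>; then
  \<open>w\<close> in \<open>F_formula\<close> is 0, \<open>F\<close> is a multiple of
  \<open>T\<close>, and so is \<open>f = (F + T) / 2\<close>.\<close>

lemma f_proportional:
  assumes h: "\<And>k. 1 \<le> k \<Longrightarrow> k < d \<Longrightarrow> \<delta> (k + 1) = \<delta> k"
    and \<epsilon>: "\<And>k. 1 \<le> k \<Longrightarrow> k \<le> d \<Longrightarrow> \<theta> k - \<theta> (k - 1) = e"
  obtains p where "\<And>k. 1 \<le> k \<Longrightarrow> k \<le> d \<Longrightarrow> f k = p * T k"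
proof -
  have h': "\<And>k. 1 \<le> k \<Longrightarrow> k < d \<Longrightarrow> \<delta> (k + 1) = 1 * \<delta> k" using h by simp
  have T: "T k \<noteq> 0" if "1 \<le> k" "k \<le> d" for k by (rule T_geometric_nz[OF h' that])
  obtain W K where W: "\<And>k. 1 \<le> k \<Longrightarrow> k \<le> d \<Longrightarrow> s k - s (k - 1) = W * (T (k + 1) - T (k - 1))"
    and K: "\<And>k. 1 \<le> k \<Longrightarrow> k \<le> d \<Longrightarrow> F k * \<delta> k = T k * (K + W * (\<theta>s (k - 1) + \<theta>s k))"
    using F_formula[OF T] by blast
  have "s 1 = s 0"
    using \<epsilon>[of 1] \<epsilon>[of d] d3 unfolding s_def by (simp add: algebra_simps)
  then have "W * T 2 = 0" using W[of 1] d3 by (simp add: numeral_2_eq_2)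
  then have W0: "W = 0" using T[of 2] d3 by simp
  have \<delta>: "1 \<le> k \<Longrightarrow> k \<le> d \<Longrightarrow> \<delta> k = \<delta> 1" for k
  proof (induction k rule: nat_induct_at_least)
    case (Suc k)
    then show ?case using h[of k] by simp
  qed simp
  have \<delta>1: "\<delta> 1 \<noteq> 0" using \<theta>s_neq[of 1 0] d3 by simp
  show thesis
  proof (rule that)
    fix k assume k: "1 \<le> k" "k \<le> d"
    have "F k * \<delta> 1 = T k * K" using K[OF k] \<delta>[OF k] W0 by simp
    then have "F k = K / \<delta> 1 * T k" using \<delta>1 by (simp add: field_simps)
    moreover have "2 * f k = F k + T k" by (simp add: F_def T_def)
    ultimately have "2 * f k = (K / \<delta> 1 + 1) * T k" by (simp add: algebra_simps)
    then show "f k = (K / \<delta> 1 + 1) / 2 * T k" using two by (simp add: field_simps)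
  qed
qed

end

section \<open>Coordinates with respect to an ordered basis\<close>

text \<open>Extended by 0 beyond \<open>d\<close>, so that coordinate \<open>i + 1\<close> at
  \<open>i = d\<close> vanishes without a case distinction.\<close>

definition crd :: "('a::field \<Rightarrow> 'b::ab_group_add \<Rightarrow> 'b) \<Rightarrow> nat \<Rightarrow> (nat \<Rightarrow> 'b) \<Rightarrow> 'b \<Rightarrow> nat \<Rightarrow> 'a" where
  "crd sc d v y i = (if i \<le> d then module.representation sc (v ` {..d}) y (v i) else 0)"

lemma crd_outside [simp]: "d < i \<Longrightarrow> crd sc d v y i = 0"
  by (simp add: crd_def)

lemma matrix_wrt_crd:
  "matrix_wrt sc d v A = mat (d + 1) (d + 1) (\<lambda>(i, j). crd sc d v (A (v j)) i)"
  by (rule eq_matI) (auto simp: matrix_wrt_def crd_def)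

lemma linear_add: "Vector_Spaces.linear s1 s2 f \<Longrightarrow> f (x + y) = f x + f y"
  and linear_diff: "Vector_Spaces.linear s1 s2 f \<Longrightarrow> f (x - y) = f x - f y"
  and linear_scale: "Vector_Spaces.linear s1 s2 f \<Longrightarrow> f (s1 r x) = s2 r (f x)"
  and linear_zero: "Vector_Spaces.linear s1 s2 f \<Longrightarrow> f 0 = 0"
  and linear_sum: "Vector_Spaces.linear s1 s2 f \<Longrightarrow> f (sum g S) = (\<Sum>i\<in>S. f (g i))"
  unfolding linear_iff_module_hom
  by (simp_all add: module_hom.add module_hom.diff module_hom.scale module_hom.zero module_hom.sum)

locale vspace = vector_space scale
  for scale :: "'a::field \<Rightarrow> 'b::ab_group_add \<Rightarrow> 'b" (infixr \<open>*s\<close> 75)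
begin

abbreviation "basis \<equiv> ordered_basis scale"
abbreviation "coord \<equiv> crd scale"
abbreviation "lin \<equiv> Vector_Spaces.linear scale scale"

lemma linI: "(\<And>x y. f (x + y) = f x + f y) \<Longrightarrow> (\<And>r x. f (r *s x) = r *s f x) \<Longrightarrow> lin f"
  using vector_space_axioms by (simp add: Vector_Spaces.linear_iff)

lemma coord_zero [simp]: "coord d v 0 i = 0"
  by (simp add: crd_def representation_zero)

lemma
  assumes "basis d v"
  shows coord_add: "coord d v (y + z) i = coord d v y i + coord d v z i"
    and coord_diff: "coord d v (y - z) i = coord d v y i - coord d v z i"
    and coord_scale: "coord d v (r *s y) i = r * coord d v y i"
    and coord_uminus: "coord d v (- y) i = - coord d v y i"
  using assms
  by (auto simp: ordered_basis_def crd_def representation_add representation_diff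
      representation_scale representation_neg)

lemma coord_sum:
  assumes "basis d v"
  shows "coord d v (sum g S) i = (\<Sum>j\<in>S. coord d v (g j) i)"
  by (induction S rule: infinite_finite_induct) (auto simp: coord_add[OF assms] coord_zero)

lemma coord_basis:
  assumes "basis d v" "j \<le> d"
  shows "coord d v (v j) i = (if i = j then 1 else 0)"
  using assms by (auto simp: ordered_basis_def crd_def representation_basis inj_on_def)

lemma coord_expand:
  assumes "basis d v"
  shows "y = (\<Sum>i\<le>d. coord d v y i *s v i)"
proof -
  have "y = (\<Sum>b\<in>v ` {..d}. representation (v ` {..d}) y b *s b)"
    using assms by (intro sum_representation_eq[symmetric]) (auto simp: ordered_basis_def)
  also have "\<dots> = (\<Sum>i\<le>d. representation (v ` {..d}) y (v i) *s v i)"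
    using assms by (intro sum.reindex_cong[of v]) (auto simp: ordered_basis_def)
  finally show ?thesis by (simp add: crd_def)
qed

lemma coord_eqI:
  assumes "basis d v" "\<And>i. i \<le> d \<Longrightarrow> coord d v y i = coord d v z i"
  shows "y = z"
  using coord_expand[OF assms(1), of y] coord_expand[OF assms(1), of z] assms(2) by simp

lemma lin_eqI:
  assumes "basis d v" "lin f" "lin g" "\<And>i. i \<le> d \<Longrightarrow> f (v i) = g (v i)"
  shows "f y = g y"
proof -
  have "f (\<Sum>i\<le>d. coord d v y i *s v i) = g (\<Sum>i\<le>d. coord d v y i *s v i)"
    using assms by (simp add: linear_sum linear_scale)
  then show ?thesis using coord_expand[OF assms(1), of y] by simp
qed

lemma basis_nonzero:
  assumes "basis d v" "i \<le> d" shows "v i \<noteq> 0"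
  using coord_basis[OF assms, of i] coord_zero by auto

lemma basisI:
  assumes ind: "\<And>c. (\<Sum>i\<le>d. c i *s v i) = 0 \<Longrightarrow> \<forall>i\<le>d. c i = 0"
    and gen: "\<And>y. \<exists>c. y = (\<Sum>i\<le>d. c i *s v i)"
  shows "basis d v"
proof -
  have inj: "inj_on v {..d}"
  proof (rule inj_onI, rule ccontr)
    fix i j assume ij: "i \<in> {..d}" "j \<in> {..d}" "v i = v j" "i \<noteq> j"
    define c where "c k = (if k = i then 1 else if k = j then - 1 else (0::'a))" for k
    have "(\<Sum>k\<le>d. c k *s v k) = (\<Sum>k\<in>{i, j}. c k *s v k)"
      using ij by (intro sum.mono_neutral_right) (auto simp: c_def)
    also have "\<dots> = 0" using ij by (simp add: c_def)
    finally show False using ind[of c] ij by (auto simp: c_def)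
  qed
  have "independent (v ` {..d})"
    unfolding independent_explicit_module
  proof (intro allI impI)
    fix T u w assume T: "finite T" "T \<subseteq> v ` {..d}" "(\<Sum>w\<in>T. u w *s w) = 0" "w \<in> T"
    define c where "c k = (if v k \<in> T then u (v k) else 0)" for k
    have "(\<Sum>k\<le>d. c k *s v k) = (\<Sum>w\<in>v ` {..d}. (if w \<in> T then u w else 0) *s w)"
      by (subst sum.reindex[OF inj]) (simp add: c_def)
    also have "\<dots> = (\<Sum>w\<in>T. u w *s w)"
      using T by (intro sum.mono_neutral_cong_right) auto
    finally have "\<forall>i\<le>d. c i = 0" using T ind[of c] by simp
    moreover obtain i where "i \<le> d" "w = v i" using T by auto
    ultimately show "u w = 0" using T(4) by (auto simp: c_def)
  qed
  moreover have "y \<in> span (v ` {..d})" for y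
  proof -
    obtain c where "y = (\<Sum>i\<le>d. c i *s v i)" using gen by blast
    also have "\<dots> \<in> span (v ` {..d})" by (intro span_sum span_scale span_base) auto
    finally show ?thesis .
  qed
  ultimately show ?thesis using inj by (auto simp: ordered_basis_def)
qed

lemma image_reverse: "(\<lambda>i. f (d - i)) ` {..d} = f ` {..d::nat}"
  by (auto simp: image_iff) (metis atMost_iff diff_diff_cancel diff_le_self)

lemma basis_reverse:
  assumes "basis d v" shows "basis d (\<lambda>i. v (d - i))"
proof -
  have "inj_on (\<lambda>i. v (d - i)) {..d}"
  proof (rule inj_onI)
    fix i j assume ij: "i \<in> {..d}" "j \<in> {..d}" "v (d - i) = v (d - j)"
    have "inj_on v {..d}" using assms by (simp add: ordered_basis_def)
    then have "d - i = d - j" by (rule inj_onD) (use ij in auto)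
    then show "i = j" using ij by auto
  qed
  then show ?thesis using assms by (simp add: ordered_basis_def image_reverse)
qed

lemma coord_reverse:
  assumes "i \<le> d" shows "coord d (\<lambda>i. v (d - i)) y i = coord d v y (d - i)"
  using assms by (simp add: crd_def image_reverse)

lemma coord_combination:
  assumes "basis d v" "j \<le> d"
  shows "coord d v (\<Sum>i\<le>d. c i *s v i) j = c j"
proof -
  have "coord d v (\<Sum>i\<le>d. c i *s v i) j = (\<Sum>i\<le>d. if i = j then c i else 0)"
    unfolding coord_sum[OF assms(1)]
    by (intro sum.cong) (auto simp: coord_scale[OF assms(1)] coord_basis[OF assms(1)])
  then show ?thesis using assms by simp
qed

lemma triangular_span:
  assumes v: "basis d v"
    and u: "\<And>k. k \<le> d \<Longrightarrow> coord d v (u k) k \<noteq> 0" "\<And>k i. k \<le> d \<Longrightarrow> k < i \<Longrightarrow> coord d v (u k) i = 0"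
  shows "k \<le> d + 1 \<Longrightarrow> (\<And>i. k \<le> i \<Longrightarrow> coord d v y i = 0) \<Longrightarrow> \<exists>c. y = (\<Sum>i<k. c i *s u i)"
proof (induction k arbitrary: y)
  case 0
  then have "y = 0" by (intro coord_eqI[OF v]) (auto simp: coord_zero)
  then show ?case by simp
next
  case (Suc k)
  define r where "r = coord d v y k / coord d v (u k) k"
  have "\<exists>c. y - r *s u k = (\<Sum>i<k. c i *s u i)"
  proof (rule Suc.IH)
    show "coord d v (y - r *s u k) i = 0" if "k \<le> i" for i
      using that Suc.prems u[of k] by (cases "i = k") (auto simp: coord_diff[OF v] coord_scale[OF v] r_def)
  qed (use Suc in auto)
  then obtain c where c: "y - r *s u k = (\<Sum>i<k. c i *s u i)" by blast
  have "y = (\<Sum>i<Suc k. (c(k := r)) i *s u i)" using c by (simp add: algebra_simps)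
  then show ?case by blast
qed

lemma triangular_basis:
  assumes v: "basis d v"
    and u: "\<And>k. k \<le> d \<Longrightarrow> coord d v (u k) k \<noteq> 0" "\<And>k i. k \<le> d \<Longrightarrow> k < i \<Longrightarrow> coord d v (u k) i = 0"
  shows "basis d u"
proof (rule basisI)
  show "\<exists>c. y = (\<Sum>i\<le>d. c i *s u i)" for y
    using triangular_span[OF v u, of "d + 1" y] by (simp add: lessThan_Suc_atMost)
  fix c assume c: "(\<Sum>i\<le>d. c i *s u i) = 0"
  show "\<forall>i\<le>d. c i = 0"
  proof (rule ccontr)
    assume "\<not> (\<forall>i\<le>d. c i = 0)"
    then have ne: "{i. i \<le> d \<and> c i \<noteq> 0} \<noteq> {}" by auto
    define m where "m = Max {i. i \<le> d \<and> c i \<noteq> 0}"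
    have fin: "finite {i. i \<le> d \<and> c i \<noteq> 0}" by simp
    have m: "m \<le> d" "c m \<noteq> 0" using Max_in[OF fin ne] by (auto simp: m_def)
    have above: "c i = 0" if "i \<le> d" "m < i" for i
      using Max_ge[OF fin, of i] that unfolding m_def[symmetric] by auto
    have "0 = coord d v (\<Sum>i\<le>d. c i *s u i) m" unfolding c by (simp add: coord_zero)
    also have "\<dots> = (\<Sum>i\<le>d. c i * coord d v (u i) m)"
      by (simp add: coord_sum[OF v] coord_scale[OF v])
    also have "\<dots> = (\<Sum>i\<in>{m}. c i * coord d v (u i) m)"
    proof (intro sum.mono_neutral_right ballI)
      fix i assume "i \<in> {..d} - {m}"
      then show "c i * coord d v (u i) m = 0"
        using above[of i] u(2)[of i m] by (cases "m < i") auto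
    qed (use m in auto)
    finally show False using m u(1)[of m] by simp
  qed
qed

text \<open>The product of the operators \<open>A - \<theta> j\<close> for
  \<open>k \<le> j < k + n\<close>, applied to \<open>y\<close>; with \<open>\<theta> = 0\<close> it
  is a power of \<open>A\<close>.\<close>

primrec shift_prod :: "('b \<Rightarrow> 'b) \<Rightarrow> (nat \<Rightarrow> 'a) \<Rightarrow> nat \<Rightarrow> nat \<Rightarrow> 'b \<Rightarrow> 'b" where
  "shift_prod A \<theta> k 0 y = y"
| "shift_prod A \<theta> k (Suc n) y = A (shift_prod A \<theta> k n y) - \<theta> (k + n) *s shift_prod A \<theta> k n y"

lemma shift_prod_lin: "lin A \<Longrightarrow> lin (shift_prod A \<theta> k n)"
proof (induction n)
  case 0
  then show ?case using vector_space_axioms by (simp add: Vector_Spaces.linear_iff)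
next
  case (Suc n)
  then show ?case
    by (intro linI) (simp_all add: linear_add linear_scale algebra_simps)
qed

lemma shift_prod_eigen:
  assumes "lin A" "A y = m *s y"
  shows "shift_prod A \<theta> k n y = (\<Prod>h<n. m - \<theta> (k + h)) *s y"
  by (induction n) (simp_all add: linear_scale[OF assms(1)] assms(2) algebra_simps)

lemma coord_eigen:
  assumes "basis d w" "lin A" "\<And>i. i \<le> d \<Longrightarrow> A (w i) = m i *s w i"
  shows "coord d w (A y) i = m i * coord d w y i"
proof (cases "i \<le> d")
  case True
  have "A y = (\<Sum>j\<le>d. (coord d w y j * m j) *s w j)"
    using assms by (subst coord_expand[OF assms(1), of y]) (simp add: linear_sum linear_scale)
  then show ?thesis using coord_combination[OF assms(1) True, of "\<lambda>j. coord d w y j * m j"]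
    by (simp add: mult.commute)
qed simp

lemma coord_shift_prod:
  assumes "basis d w" "lin A" "\<And>i. i \<le> d \<Longrightarrow> A (w i) = m i *s w i"
  shows "coord d w (shift_prod A \<theta> k n y) i = (\<Prod>h<n. m i - \<theta> (k + h)) * coord d w y i"
  by (induction n) (simp_all add: coord_diff[OF assms(1)] coord_eigen[OF assms] coord_scale[OF assms(1)] algebra_simps)

lemma coord_image:
  assumes "basis d v" "lin A"
  shows "coord d v (A y) i = (\<Sum>j\<le>d. coord d v y j * coord d v (A (v j)) i)"
proof -
  have "A y = (\<Sum>j\<le>d. coord d v y j *s A (v j))"
    using assms by (subst coord_expand[OF assms(1), of y]) (simp add: linear_sum linear_scale)
  then show ?thesis by (simp add: coord_sum[OF assms(1)] coord_scale[OF assms(1)])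
qed

end

section \<open>Tridiagonal systems and split bases\<close>

text \<open>The eigenbasis of \<open>As\<close> is scaled so that the subdiagonal of
  \<open>A\<close> is 1. Then \<open>x\<close> consists of the products of opposite off-diagonal
  entries, and monic polynomials in \<open>A\<close> preserve leading coefficients.\<close>

locale tri_system = vspace scale
  for scale :: "'a::field \<Rightarrow> 'b::ab_group_add \<Rightarrow> 'b" (infixr \<open>*s\<close> 75) +
  fixes d :: nat and A As :: "'b \<Rightarrow> 'b" and v :: "nat \<Rightarrow> 'b" and \<theta>s a x :: "nat \<Rightarrow> 'a"
  assumes v: "basis d v" and A: "lin A" and As: "lin As"
    and As_v: "\<And>i. i \<le> d \<Longrightarrow> As (v i) = \<theta>s i *s v i"
    and A_v: "\<And>i. i \<le> d \<Longrightarrow> A (v i) =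
      (if i < d then v (i + 1) else 0) + a i *s v i + (if 0 < i then x i *s v (i - 1) else 0)"
    and x_nz: "\<And>i. 1 \<le> i \<Longrightarrow> i \<le> d \<Longrightarrow> x i \<noteq> 0"
begin

abbreviation "c \<equiv> coord d v"

lemmas c_simps = coord_add[OF v] coord_diff[OF v] coord_scale[OF v] coord_zero coord_basis[OF v]

lemma c_As: "c (As y) i = \<theta>s i * c y i"
  by (rule coord_eigen[OF v As As_v])

lemma c_A:
  assumes i: "i \<le> d"
  shows "c (A y) i = (if i = 0 then 0 else c y (i - 1)) + a i * c y i + x (i + 1) * c y (i + 1)"
proof -
  have e: "c (A (v j)) i = (if j + 1 = i then 1 else 0) + (if j = i then a i else 0) + (if j = i + 1 then x (i + 1) else 0)"
    if "j \<le> d" for j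
    using that i by (simp add: A_v c_simps) auto
  have "c (A y) i = (\<Sum>j\<le>d. c y j * c (A (v j)) i)" by (rule coord_image[OF v A])
  also have "\<dots> = (\<Sum>j\<le>d. (if j + 1 = i then c y j else 0) + (if j = i then a i * c y j else 0)
      + (if j = i + 1 then x (i + 1) * c y j else 0))"
    by (intro sum.cong refl) (auto simp: e algebra_simps)
  also have "\<dots> = (\<Sum>j\<le>d. (if j + 1 = i then c y j else 0)) + (\<Sum>j\<le>d. if j = i then a i * c y j else 0)
      + (\<Sum>j\<le>d. if j = i + 1 then x (i + 1) * c y j else 0)"
    by (simp only: sum.distrib)
  also have "(\<Sum>j\<le>d. (if j + 1 = i then c y j else 0)) = (if i = 0 then 0 else c y (i - 1))"
  proof (cases i)
    case (Suc k)
    then have "(\<Sum>j\<le>d. (if j + 1 = i then c y j else 0)) = (\<Sum>j\<le>d. (if j = k then c y j else 0))"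
      by (intro sum.cong) auto
    then show ?thesis using Suc i by simp
  qed simp
  also have "(\<Sum>j\<le>d. if j = i then a i * c y j else 0) = a i * c y i" using i by simp
  also have "(\<Sum>j\<le>d. if j = i + 1 then x (i + 1) * c y j else 0) = x (i + 1) * c y (i + 1)"
    using i by (cases "i = d") auto
  finally show ?thesis .
qed

text \<open>The tridiagonal recurrence with nonzero \<open>x\<close> determines an eigenvector from
  its coordinate 0, so the eigenspaces of \<open>A\<close> are at most one-dimensional.\<close>

lemma eigenvector_zero:
  assumes y: "A y = m *s y" and 0: "c y 0 = 0"
  shows "y = 0"
proof -
  have "k \<le> d \<Longrightarrow> c y k = 0 \<and> (0 < k \<longrightarrow> c y (k - 1) = 0)" for k
  proof (induction k)
    case (Suc k)
    have "m * c y k = (if k = 0 then 0 else c y (k - 1)) + a k * c y k + x (k + 1) * c y (k + 1)"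
      using c_A[of k y] Suc unfolding y by (simp add: c_simps)
    then have "x (k + 1) * c y (k + 1) = 0" using Suc by (auto split: if_splits)
    then show ?case using x_nz[of "k + 1"] Suc by auto
  qed (use 0 in simp)
  then show ?thesis by (intro coord_eqI[OF v]) (auto simp: c_simps)
qed

lemma eigenvalues_distinct:
  assumes w: "basis d w" and Aw: "\<And>i. i \<le> d \<Longrightarrow> A (w i) = \<theta> i *s w i"
  shows "inj_on \<theta> {..d}"
proof (rule inj_onI, rule ccontr)
  fix i j assume ij: "i \<in> {..d}" "j \<in> {..d}" "\<theta> i = \<theta> j" "i \<noteq> j"
  define y where "y = c (w j) 0 *s w i - c (w i) 0 *s w j"
  have "A y = \<theta> i *s y"
    using Aw[of i] Aw[of j] ij by (simp add: y_def linear_diff[OF A] linear_scale[OF A] scale_right_diff_distrib mult.commute)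
  moreover have "c y 0 = 0" by (simp add: y_def c_simps mult.commute)
  ultimately have "y = 0" by (rule eigenvector_zero)
  moreover have "coord d w y i = c (w j) 0"
    using ij by (simp add: y_def coord_diff[OF w] coord_scale[OF w] coord_basis[OF w])
  ultimately have "c (w j) 0 = 0" by (simp add: coord_zero)
  then have "w j = 0" using eigenvector_zero Aw[of j] ij by auto
  then show False using basis_nonzero[OF w, of j] ij by simp
qed

lemma c_shift_prod:
  assumes y: "\<And>i. m < i \<Longrightarrow> c y i = 0"
  shows "m + n \<le> d \<Longrightarrow> c (shift_prod A \<theta> k n y) (m + n) = c y m \<and>
     (\<forall>i. m + n < i \<longrightarrow> c (shift_prod A \<theta> k n y) i = 0)"
proof (induction n)
  case (Suc n)
  let ?z = "shift_prod A \<theta> k n y"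
  have IH: "c ?z (m + n) = c y m" "\<And>i. m + n < i \<Longrightarrow> c ?z i = 0" using Suc by auto
  have "c (A ?z) (m + Suc n) = c y m" using Suc IH by (subst c_A) auto
  moreover have "c (A ?z) i = 0" if "m + Suc n < i" for i
  proof (cases "i \<le> d")
    case True
    then show ?thesis using that IH(2) by (subst c_A) auto
  qed simp
  ultimately show ?case using IH(2) by (auto simp: c_simps)
qed (use y in auto)

text \<open>
  A split basis \<open>u\<close> turns \<open>A\<close> and \<open>A\<^sup>*\<close> into bidiagonal matrices.  The leading coefficients of
  \<open>u\<^sub>k\<close> in the basis \<open>v\<close> determine \<open>a\<^sub>k\<close> and \<open>x\<^sub>k\<close>.
\<close>

definition "split_basis \<theta> \<phi> u \<longleftrightarrow> basis d u \<and>
  (\<forall>k\<le>d. A (u k) = \<theta> k *s u k + (if k < d then u (k + 1) else 0)) \<and>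
  (\<forall>k\<le>d. As (u k) = \<theta>s k *s u k + (if 0 < k then \<phi> k *s u (k - 1) else 0))"

text \<open>The value 0 outside \<open>1, ..., d\<close> lets the same formulas cover the first and
  the last vector.\<close>

definition "split_f \<phi> k = (if 1 \<le> k \<and> k \<le> d then \<phi> k / (\<theta>s k - \<theta>s (k - 1)) else 0)"

lemma split_relations:
  assumes inj: "inj_on \<theta>s {..d}" and u: "split_basis \<theta> \<phi> u"
  shows "k \<le> d \<Longrightarrow> a k = \<theta> k + split_f \<phi> k - split_f \<phi> (k + 1)"
    and "1 \<le> k \<Longrightarrow> k \<le> d \<Longrightarrow> x k = split_f \<phi> k * (split_f \<phi> (k - 1) * kap \<theta>s k
      - split_f \<phi> (k + 1) * kap \<theta>s (k + 1) + \<theta> (k - 1) - a k)"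
proof -
  let ?f = "split_f \<phi>"
  have Au: "A (u k) = \<theta> k *s u k + (if k < d then u (k + 1) else 0)"
    and Asu: "As (u k) = \<theta>s k *s u k + (if 0 < k then \<phi> k *s u (k - 1) else 0)" if "k \<le> d" for k
    using u that by (auto simp: split_basis_def)
  have ub: "basis d u" using u by (simp add: split_basis_def)
  have \<theta>s: "\<theta>s i - \<theta>s j \<noteq> 0" if "i \<le> d" "j \<le> d" "i \<noteq> j" for i j
    using inj that by (auto simp: inj_on_def)
  define r where "r = c (u 0) 0"
  have u0: "c (u 0) i = 0" if "0 < i" for i
  proof (cases "i \<le> d")
    case True
    have "\<theta>s i * c (u 0) i = \<theta>s 0 * c (u 0) i" using c_As[of "u 0" i] Asu[of 0] by (auto simp: c_simps)
    then show ?thesis using \<theta>s[of i 0] True that by auto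
  qed simp
  have r: "r \<noteq> 0"
  proof
    assume "r = 0"
    then have "c (u 0) i = 0" for i using u0[of i] by (cases i) (auto simp: r_def)
    then have "u 0 = 0" by (intro coord_eqI[OF v]) simp
    then show False using basis_nonzero[OF ub, of 0] by simp
  qed
  have cA: "c (A (u k)) i = \<theta> k * c (u k) i + (if k < d then c (u (k + 1)) i else 0)" if "k \<le> d" for k i
    using Au[OF that] by (simp add: c_simps)
  \<comment> \<open>\<open>A\<close> moves the leading coordinate up by one without changing its
    coefficient, so every \<open>u k\<close> ends at index \<open>k\<close> with the same
    \<open>r\<close>.\<close>
  have tri: "k \<le> d \<Longrightarrow> c (u k) k = r \<and> (\<forall>i>k. c (u k) i = 0)" for k
  proof (induction k)
    case (Suc k)
    then have IH: "c (u k) k = r" "\<And>i. k < i \<Longrightarrow> c (u k) i = 0" by auto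
    have "c (u (k + 1)) i = c (A (u k)) i - \<theta> k * c (u k) i" for i using cA[of k i] Suc by simp
    then have "c (u (k + 1)) i = (if i = k + 1 then r else 0)" if "k < i" "i \<le> d" for i
      using that IH by (simp add: c_A)
    then show ?case using Suc by (metis Suc_eq_plus1 crd_outside lessI not_le_imp_less Suc_lessD less_irrefl_nat)
  qed (use u0 in \<open>auto simp: r_def\<close>)
  \<comment> \<open>Coordinate \<open>k - 1\<close> of the equation for \<open>As (u k)\<close>
    gives the second coefficient of \<open>u k\<close>, and coordinate \<open>k - 2\<close> gives
    the third.\<close>
  have f1: "c (u k) (k - 1) = - r * ?f k" if k: "1 \<le> k" "k \<le> d" for k
  proof -
    have "\<theta>s (k - 1) * c (u k) (k - 1) = \<theta>s k * c (u k) (k - 1) + \<phi> k * c (u (k - 1)) (k - 1)"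
      using c_As[of "u k" "k - 1"] Asu[of k] k by (simp add: c_simps)
    then have "(\<theta>s k - \<theta>s (k - 1)) * c (u k) (k - 1) = - \<phi> k * r" using tri[of "k - 1"] k by (simp add: algebra_simps)
    then show ?thesis using \<theta>s[of k "k - 1"] k by (simp add: split_f_def field_simps)
  qed
  have e1: "c (u k) (k - 2) = r * ?f k * ?f (k - 1) * (1 - kap \<theta>s k)" if k: "2 \<le> k" "k \<le> d" for k
  proof -
    have "\<theta>s (k - 2) * c (u k) (k - 2) = \<theta>s k * c (u k) (k - 2) + \<phi> k * c (u (k - 1)) (k - 2)"
      using c_As[of "u k" "k - 2"] Asu[of k] k by (simp add: c_simps)
    moreover have "k - 2 = k - 1 - 1" by simp
    then have "c (u (k - 1)) (k - 2) = - r * ?f (k - 1)" using f1[of "k - 1"] k by simp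
    ultimately have 1: "(\<theta>s k - \<theta>s (k - 2)) * c (u k) (k - 2) = \<phi> k * r * ?f (k - 1)"
      by (simp add: algebra_simps)
    have n: "\<theta>s k - \<theta>s (k - 2) \<noteq> 0" "\<theta>s k - \<theta>s (k - 1) \<noteq> 0" using \<theta>s[of k "k - 2"] \<theta>s[of k "k - 1"] k by auto
    have "(1 - kap \<theta>s k) * (\<theta>s k - \<theta>s (k - 2)) = \<theta>s k - \<theta>s (k - 1)"
      using n by (simp add: kap_def divide_simps)
    moreover have "\<phi> k = ?f k * (\<theta>s k - \<theta>s (k - 1))" using n k by (simp add: split_f_def)
    ultimately have "(\<theta>s k - \<theta>s (k - 2)) * c (u k) (k - 2)
        = (\<theta>s k - \<theta>s (k - 2)) * (r * ?f k * ?f (k - 1) * (1 - kap \<theta>s k))"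
      using 1 by Groebner_Basis.algebra
    then show ?thesis by (rule mult_left_cancel[THEN iffD1, OF n(1)])
  qed
  have end0: "?f 0 = 0" "?f (d + 1) = 0" by (simp_all add: split_f_def)
  have f2: "(if k < d then c (u (k + 1)) k else 0) = - r * ?f (k + 1)" if "k \<le> d" for k
    using f1[of "k + 1"] end0 that by (cases "k = d") auto
  \<comment> \<open>Coordinate \<open>k\<close> of the equation for \<open>A (u k)\<close> yields
    \<open>a k\<close>; coordinate \<open>k - 1\<close> yields \<open>x k\<close>.\<close>
  show ak: "a k = \<theta> k + ?f k - ?f (k + 1)" if k: "k \<le> d" for k
  proof -
    have "(if k = 0 then 0 else c (u k) (k - 1)) + a k * r = \<theta> k * r - r * ?f (k + 1)"
      using cA[OF k, of k] f2[OF k] tri[OF k] c_A[OF k, of "u k"] by simp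
    moreover have "(if k = 0 then 0 else c (u k) (k - 1)) = - r * ?f k" using f1[of k] k end0 by auto
    ultimately have "r * a k = r * (\<theta> k + ?f k - ?f (k + 1))" by (simp add: algebra_simps)
    then show ?thesis using r by simp
  qed
  show "x k = ?f k * (?f (k - 1) * kap \<theta>s k - ?f (k + 1) * kap \<theta>s (k + 1) + \<theta> (k - 1) - a k)"
    if k: "1 \<le> k" "k \<le> d"
  proof -
    have low: "(if k - 1 = 0 then 0 else c (u k) (k - 1 - 1)) = r * ?f k * ?f (k - 1) * (1 - kap \<theta>s k)"
      using e1[of k] k end0 by (cases "k = 1") (auto simp: numeral_2_eq_2)
    have up: "(if k < d then c (u (k + 1)) (k - 1) else 0) = r * ?f (k + 1) * ?f k * (1 - kap \<theta>s (k + 1))"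
      using e1[of "k + 1"] k end0 by (cases "k = d") auto
    have "(if k - 1 = 0 then 0 else c (u k) (k - 1 - 1)) + a (k - 1) * (- r * ?f k) + x k * r
       = \<theta> k * (- r * ?f k) + r * ?f (k + 1) * ?f k * (1 - kap \<theta>s (k + 1))"
      using cA[OF k(2), of "k - 1"] up c_A[of "k - 1" "u k"] f1[OF k] tri[OF k(2)] k by simp
    moreover have "a (k - 1) = \<theta> (k - 1) + ?f (k - 1) - ?f k" using ak[of "k - 1"] k by simp
    ultimately have "r * x k = r * (?f k * (?f (k - 1) * kap \<theta>s k - ?f (k + 1) * kap \<theta>s (k + 1) + \<theta> (k - 1) - a k))"
      unfolding low ak[OF k(2)] by Groebner_Basis.algebra
    then show ?thesis using r by simp
  qed
qed

end

section \<open>Leonard pairs\<close>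

lemma poly_interpolation:
  fixes \<theta> z :: "nat \<Rightarrow> 'a::field"
  assumes "inj_on \<theta> {..n}"
  shows "\<exists>p. degree p \<le> n \<and> (\<forall>i\<le>n. poly p (\<theta> i) = z i)"
  using assms
proof (induction n)
  case 0
  show ?case by (intro exI[of _ "[:z 0:]"]) auto
next
  case (Suc n)
  then obtain p where p: "degree p \<le> n" "\<And>i. i \<le> n \<Longrightarrow> poly p (\<theta> i) = z i"
    using inj_on_subset[of \<theta> "{..Suc n}" "{..n}"] by auto
  define q where "q = (\<Prod>h\<le>n. [:- \<theta> h, 1:])"
  have q0: "poly q (\<theta> i) = 0" if "i \<le> n" for i using that by (auto simp: q_def poly_prod)
  have "\<theta> (Suc n) \<noteq> \<theta> h" if "h \<le> n" for h
    using inj_onD[OF Suc.prems, of "Suc n" h] that by auto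
  then have q1: "poly q (\<theta> (Suc n)) \<noteq> 0"
    by (auto simp: q_def poly_prod)
  have dq: "degree q \<le> Suc n"
    unfolding q_def by (rule order.trans[OF degree_prod_sum_le]) auto
  define r where "r = p + Polynomial.smult ((z (Suc n) - poly p (\<theta> (Suc n))) / poly q (\<theta> (Suc n))) q"
  have "poly r (\<theta> i) = z i" if "i \<le> Suc n" for i
    using p(2)[of i] q0[of i] q1 that by (cases "i = Suc n") (auto simp: r_def)
  moreover have "degree r \<le> Suc n"
    unfolding r_def using p(1) dq by (intro degree_add_le order.trans[OF degree_smult_le]) auto
  ultimately show ?case by blast
qed

context vspace
begin

text \<open>Multiplying \<open>v i\<close> by the product of the first \<open>i\<close> subdiagonal
  entries normalizes these to 1 and keeps the vectors eigenvectors of \<open>As\<close>; the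
  superdiagonal entries absorb the factors.\<close>

lemma monic_exists:
  assumes v: "basis d v" and A: "lin A" and As: "lin As"
    and tri: "irreducible_tridiagonal (matrix_wrt scale d v A)"
    and As_v: "\<And>i. i \<le> d \<Longrightarrow> As (v i) = \<theta>s i *s v i"
  obtains v' a x where "tri_system scale d A As v' \<theta>s a x"
proof -
  define B where "B i j = coord d v (A (v j)) i" for i j
  have B0: "B i j = 0" if "i \<le> d" "j \<le> d" "i + 1 < j \<or> j + 1 < i" for i j
    using tri that by (auto simp: irreducible_tridiagonal_def matrix_wrt_crd B_def)
  have B1: "B i j \<noteq> 0" if "i \<le> d" "j \<le> d" "i + 1 = j \<or> j + 1 = i" for i j
    using tri that by (auto simp: irreducible_tridiagonal_def matrix_wrt_crd B_def)
  define p where "p i = (\<Prod>h<i. B (h + 1) h)" for i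
  have p_nz: "p i \<noteq> 0" if "i \<le> d" for i using that B1 by (auto simp: p_def)
  have p_Suc: "p (Suc i) = p i * B (Suc i) i" for i by (simp add: p_def)
  define v' where "v' i = p i *s v i" for i
  have v': "basis d v'"
    by (rule triangular_basis[OF v])
      (auto simp: v'_def coord_scale[OF v] coord_basis[OF v] p_nz)
  have "tri_system scale d A As v' \<theta>s (\<lambda>i. B i i) (\<lambda>i. B (i - 1) i * B i (i - 1))"
  proof (unfold_locales)
    show "As (v' i) = \<theta>s i *s v' i" if "i \<le> d" for i
      using As_v[OF that] by (simp add: v'_def linear_scale[OF As] mult.commute)
    show "B (i - 1) i * B i (i - 1) \<noteq> 0" if "1 \<le> i" "i \<le> d" for i
      using that B1[of "i - 1" i] B1[of i "i - 1"] by simp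
    show "A (v' i) = (if i < d then v' (i + 1) else 0) + B i i *s v' i +
        (if 0 < i then (B (i - 1) i * B i (i - 1)) *s v' (i - 1) else 0)" if i: "i \<le> d" for i
    proof (rule coord_eqI[OF v])
      fix j assume j: "j \<le> d"
      have L: "coord d v (A (v' i)) j = p i * B j i"
        by (simp add: v'_def linear_scale[OF A] coord_scale[OF v] B_def)
      have R: "coord d v ((if i < d then v' (i + 1) else 0) + B i i *s v' i +
          (if 0 < i then (B (i - 1) i * B i (i - 1)) *s v' (i - 1) else 0)) j =
          (if j = i + 1 then p (i + 1) else 0) + (if j = i then B i i * p i else 0)
          + (if j + 1 = i then B (i - 1) i * B i (i - 1) * p (i - 1) else 0)"
      proof -
        have cv: "coord d v (v' k) j = (if j = k then p k else 0)" if "k \<le> d" for k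
          using that by (simp add: v'_def coord_scale[OF v] coord_basis[OF v])
        have 1: "coord d v (if i < d then v' (i + 1) else 0) j = (if j = i + 1 then p (i + 1) else 0)"
          using cv[of "i + 1"] j by (cases "i < d") simp_all
        have 2: "coord d v (if 0 < i then (B (i - 1) i * B i (i - 1)) *s v' (i - 1) else 0) j
            = (if j + 1 = i then B (i - 1) i * B i (i - 1) * p (i - 1) else 0)"
          using cv[of "i - 1"] i by (cases i) (simp_all add: coord_scale[OF v])
        show ?thesis
          unfolding coord_add[OF v] coord_scale[OF v, of "B i i"] 1 2 cv[OF i] by simp
      qed
      consider "j = i + 1" | "j = i" | "i = j + 1" | "i + 1 < j \<or> j + 1 < i" by linarith
      then show "coord d v (A (v' i)) j = coord d v ((if i < d then v' (i + 1) else 0) + B i i *s v' i +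
        (if 0 < i then (B (i - 1) i * B i (i - 1)) *s v' (i - 1) else 0)) j"
      proof cases
        case 1
        show ?thesis unfolding L R unfolding 1 by (simp add: p_Suc)
      next
        case 2
        show ?thesis unfolding L R unfolding 2 by simp
      next
        case 3
        show ?thesis unfolding L R unfolding 3 by (simp add: p_Suc)
      next
        case 4
        then have "B j i = 0" using B0[OF j i] by auto
        then show ?thesis unfolding L R using 4 by auto
      qed
    qed
  qed (use v' A As in \<open>auto simp: linear_add[OF A] linear_scale[OF A] linear_add[OF As] linear_scale[OF As]\<close>)
  then show thesis by (rule that)
qed

end

locale leonard_data = tri_system +
  fixes w :: "nat \<Rightarrow> 'b" and \<theta> :: "nat \<Rightarrow> 'a"
  assumes w: "basis d w" and A_w: "\<And>i. i \<le> d \<Longrightarrow> A (w i) = \<theta> i *s w i"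
    and As_w: "irreducible_tridiagonal (matrix_wrt scale d w As)"
begin

abbreviation "cw \<equiv> coord d w"

lemma M_0: "i \<le> d \<Longrightarrow> j \<le> d \<Longrightarrow> i + 1 < j \<or> j + 1 < i \<Longrightarrow> cw (As (w j)) i = 0"
  and M_1: "i \<le> d \<Longrightarrow> j \<le> d \<Longrightarrow> i + 1 = j \<or> j + 1 = i \<Longrightarrow> cw (As (w j)) i \<noteq> 0"
  using As_w by (auto simp: irreducible_tridiagonal_def matrix_wrt_crd)

lemma \<theta>_inj: "inj_on \<theta> {..d}"
  by (rule eigenvalues_distinct[OF w A_w])

lemma \<theta>s_inj: "inj_on \<theta>s {..d}"
proof -
  obtain w' a' x' where "tri_system scale d As A w' \<theta> a' x'"
    using monic_exists[OF w As A As_w A_w] by blast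
  then show ?thesis by (rule tri_system.eigenvalues_distinct[OF _ v As_v])
qed

lemma cw_A: "cw (A y) i = \<theta> i * cw y i"
  by (rule coord_eigen[OF w A A_w])

lemma cw_As_support:
  assumes "\<And>i. i < k \<Longrightarrow> cw y i = 0" "i + 1 < k"
  shows "cw (As y) i = 0"
proof (cases "i \<le> d")
  case True
  have "cw (As y) i = (\<Sum>j\<le>d. cw y j * cw (As (w j)) i)" by (rule coord_image[OF w As])
  also have "\<dots> = 0"
  proof (intro sum.neutral ballI)
    fix j assume "j \<in> {..d}"
    then show "cw y j * cw (As (w j)) i = 0"
      using assms M_0[OF True, of j] by (cases "j < k") auto
  qed
  finally show ?thesis .
qed simp

text \<open>If \<open>t < m\<close> were the last nonzero coordinate of \<open>y\<close> in
  \<open>v\<close>, the product of \<open>A - \<theta> j\<close> over \<open>t < j \<le> d\<close>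
  would move it to index \<open>d\<close> with its coefficient intact, yet annihilate every
  \<open>w i\<close> occurring in \<open>y\<close>.\<close>

lemma disjoint_flags:
  assumes 1: "\<And>i. m \<le> i \<Longrightarrow> c y i = 0" and 2: "\<And>i. i < m \<Longrightarrow> cw y i = 0"
  shows "y = 0"
proof (rule ccontr)
  assume "y \<noteq> 0"
  then have ne: "{i. i \<le> d \<and> c y i \<noteq> 0} \<noteq> {}" using coord_eqI[OF v, of y 0] by auto
  define t where "t = Max {i. i \<le> d \<and> c y i \<noteq> 0}"
  have fin: "finite {i. i \<le> d \<and> c y i \<noteq> 0}" by simp
  have t: "t \<le> d" "c y t \<noteq> 0" using Max_in[OF fin ne] by (auto simp: t_def)
  have above: "c y i = 0" if "t < i" for i
    using Max_ge[OF fin, of i] that unfolding t_def[symmetric] by (cases "i \<le> d") auto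
  have tm: "t < m" using 1[of t] t by (meson not_le_imp_less)
  have "c (shift_prod A \<theta> (t + 1) (d - t) y) (t + (d - t)) = c y t"
    using c_shift_prod[of t y "d - t" \<theta> "t + 1"] above t by simp
  moreover have "shift_prod A \<theta> (t + 1) (d - t) y = 0"
  proof (rule coord_eqI[OF w])
    fix i assume i: "i \<le> d"
    have "(\<Prod>h<d - t. \<theta> i - \<theta> (t + 1 + h)) = 0" if "t < i"
    proof -
      have "i - t - 1 \<in> {..<d - t}" "\<theta> i - \<theta> (t + 1 + (i - t - 1)) = 0" using that i by auto
      then show ?thesis by (intro prod_zero) blast+
    qed
    moreover have "cw (shift_prod A \<theta> (t + 1) (d - t) y) i = (\<Prod>h<d - t. \<theta> i - \<theta> (t + 1 + h)) * cw y i"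
      by (rule coord_shift_prod[OF w A A_w])
    moreover have "cw y i = 0" if "\<not> t < i" using 2[of i] tm that by simp
    ultimately show "cw (shift_prod A \<theta> (t + 1) (d - t) y) i = cw 0 i"
      by (metis mult_zero_left mult_zero_right coord_zero)
  qed
  ultimately show False using t by simp
qed

text \<open>Applying \<open>A - \<theta> 0, ..., A - \<theta> (k - 1)\<close> to \<open>v 0\<close>
  puts \<open>u k\<close> into the span of \<open>v 0, ..., v k\<close> and into that of
  \<open>w k, ..., w d\<close>. Then \<open>As (u k) - \<theta>s k *s u k\<close> lies in the
  corresponding spans for \<open>k - 1\<close>, which by \<open>disjoint_flags\<close> meet in the
  line through \<open>u (k - 1)\<close>.\<close>

lemma split_exists: "\<exists>\<phi> u. split_basis \<theta> \<phi> u"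
proof -
  define u where "u k = shift_prod A \<theta> 0 k (v 0)" for k
  have cu: "c (u k) k = 1" "\<And>i. k < i \<Longrightarrow> c (u k) i = 0" if "k \<le> d" for k
    using c_shift_prod[of 0 "v 0" k \<theta> 0] that by (auto simp: u_def c_simps)
  have cwu: "cw (u k) i = 0" if "i < k" for k i
  proof -
    have "(\<Prod>h<k. \<theta> i - \<theta> (0 + h)) = 0" using that by (intro prod_zero) auto
    then show ?thesis unfolding u_def by (subst coord_shift_prod[OF w A A_w]) auto
  qed
  have ud: "u (Suc d) = 0"
    using cwu[of _ "Suc d"] by (intro coord_eqI[OF w]) (simp add: less_Suc_eq_le)
  have ub: "basis d u"
    by (rule triangular_basis[OF v]) (use cu in auto)
  have Au: "A (u k) = \<theta> k *s u k + u (Suc k)" for k by (simp add: u_def)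
  define z where "z k = As (u k) - \<theta>s k *s u k" for k
  have cz: "c (z k) i = 0" if "k \<le> i" "k \<le> d" for k i
    using that cu[of k] by (cases "i = k") (auto simp: z_def c_simps c_As)
  have cwz: "cw (z k) i = 0" if "i + 1 < k" for k i
    using that cwu[of i k] cw_As_support[of k "u k" i, OF cwu]
    by (simp add: z_def coord_diff[OF w] coord_scale[OF w])
  have "\<exists>r. z k = r *s u (k - 1)" if k: "1 \<le> k" "k \<le> d" for k
  proof
    have "z k - c (z k) (k - 1) *s u (k - 1) = 0"
    proof (rule disjoint_flags[of "k - 1"])
      show "c (z k - c (z k) (k - 1) *s u (k - 1)) i = 0" if "k - 1 \<le> i" for i
        using that k cz[of k i] cu[of "k - 1"] by (cases "i = k - 1") (auto simp: c_simps)
      show "cw (z k - c (z k) (k - 1) *s u (k - 1)) i = 0" if "i < k - 1" for i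
        using that cwz[of i k] cwu[of i "k - 1"] by (simp add: coord_diff[OF w] coord_scale[OF w])
    qed
    then show "z k = c (z k) (k - 1) *s u (k - 1)" by simp
  qed
  then obtain \<phi> where \<phi>: "\<And>k. 1 \<le> k \<Longrightarrow> k \<le> d \<Longrightarrow> z k = \<phi> k *s u (k - 1)" by metis
  have z0: "z 0 = 0" by (simp add: z_def u_def As_v)
  have "split_basis \<theta> \<phi> u"
    unfolding split_basis_def
  proof (intro conjI allI impI)
    show "basis d u" by (rule ub)
    fix k assume k: "k \<le> d"
    show "A (u k) = \<theta> k *s u k + (if k < d then u (k + 1) else 0)"
      using Au[of k] ud k by (cases "k = d") auto
    have "As (u k) = \<theta>s k *s u k + z k" by (simp add: z_def)
    then show "As (u k) = \<theta>s k *s u k + (if 0 < k then \<phi> k *s u (k - 1) else 0)"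
      using \<phi>[of k] z0 k by (cases "k = 0") auto
  qed
  then show ?thesis by blast
qed

lemma reversed: "leonard_data scale d A As v \<theta>s a x (\<lambda>i. w (d - i)) (\<lambda>i. \<theta> (d - i))"
proof unfold_locales
  have "cw (As (w (d - j))) (d - i) = 0" if "i \<le> d" "j \<le> d" "i + 1 < j \<or> j + 1 < i" for i j
    by (rule M_0) (use that in arith)+
  moreover have "cw (As (w (d - j))) (d - i) \<noteq> 0" if "i \<le> d" "j \<le> d" "i + 1 = j \<or> j + 1 = i" for i j
    by (rule M_1) (use that in arith)+
  ultimately show "irreducible_tridiagonal (matrix_wrt scale d (\<lambda>i. w (d - i)) As)"
    unfolding irreducible_tridiagonal_def matrix_wrt_crd by (auto simp: coord_reverse)
qed (auto simp: basis_reverse[OF w] A_w)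

lemma c_support_A:
  assumes "\<And>i. m < i \<Longrightarrow> c y i = 0"
  shows "\<And>i. m + 1 < i \<Longrightarrow> c (A y) i = 0" "m + 1 \<le> d \<Longrightarrow> c (A y) (m + 1) = c y m"
proof -
  show "c (A y) i = 0" if "m + 1 < i" for i
    by (cases "i \<le> d") (use that assms in \<open>auto simp: c_A\<close>)
  show "c (A y) (m + 1) = c y m" if "m + 1 \<le> d"
    using that assms by (simp add: c_A)
qed

lemma c_support_As: "(\<And>i. m < i \<Longrightarrow> c y i = 0) \<Longrightarrow> m < i \<Longrightarrow> c (As y) i = 0"
  by (simp add: c_As)

text \<open>
  The commutator \<open>A\<^sup>2 A\<^sup>* A - A A\<^sup>* A\<^sup>2\<close> equals \<open>p(A) A\<^sup>* - A\<^sup>* p(A)\<close> for the polynomial \<open>p\<close> with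
  \<open>p(\<theta>\<^sub>i\<^sub>+\<^sub>1) - p(\<theta>\<^sub>i) = \<theta>\<^sub>i \<theta>\<^sub>i\<^sub>+\<^sub>1 (\<theta>\<^sub>i\<^sub>+\<^sub>1 - \<theta>\<^sub>i)\<close>, and comparing leading coefficients in the basis \<open>v\<close>
  shows that \<open>p\<close> is a cubic.
\<close>

lemma cubic:
  obtains p where "degree p \<le> 3"
    "\<And>i. i + 1 \<le> d \<Longrightarrow> poly p (\<theta> (i + 1)) - poly p (\<theta> i) = \<theta> i * \<theta> (i + 1) * (\<theta> (i + 1) - \<theta> i)"
    "\<And>i. i + 3 \<le> d \<Longrightarrow> coeff p 3 * (\<theta>s i - \<theta>s (i + 3)) = \<theta>s (i + 1) - \<theta>s (i + 2)"
proof -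
  \<comment> \<open>Partial sums of the prescribed differences; \<open>p\<close> interpolates them
    at the eigenvalues.\<close>
  define z where "z i = (\<Sum>h<i. \<theta> h * \<theta> (h + 1) * (\<theta> (h + 1) - \<theta> h))" for i
  obtain p where p: "degree p \<le> d" "\<And>i. i \<le> d \<Longrightarrow> poly p (\<theta> i) = z i"
    using poly_interpolation[OF \<theta>_inj, of z] by blast
  define pow where "pow k = shift_prod A (\<lambda>_. 0) 0 k" for k
  define pA where "pA y = (\<Sum>k\<le>d. coeff p k *s pow k y)" for y
  have pow_lin: "lin (pow k)" for k unfolding pow_def by (rule shift_prod_lin[OF A])
  have pA_lin: "lin pA"
    by (intro linI) (simp_all add: pA_def linear_add[OF pow_lin] linear_scale[OF pow_lin]
        scale_right_distrib sum.distrib scale_sum_right mult.commute)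
  have pA_w: "pA (w i) = z i *s w i" if "i \<le> d" for i
  proof -
    have "pow k (w i) = \<theta> i ^ k *s w i" for k
      unfolding pow_def using shift_prod_eigen[OF A A_w[OF that], of "\<lambda>_. 0" 0 k] by simp
    then have "pA (w i) = (\<Sum>k\<le>d. coeff p k * \<theta> i ^ k) *s w i"
      by (simp add: pA_def scale_sum_left)
    also have "(\<Sum>k\<le>d. coeff p k * \<theta> i ^ k) = poly p (\<theta> i)"
      unfolding poly_altdef using p(1)
      by (intro sum.mono_neutral_right) (auto simp: coeff_eq_0)
    finally show ?thesis using p(2)[OF that] by simp
  qed
  note cw_pA = coord_eigen[OF w pA_lin pA_w]
  have zd: "z (i + 1) - z i = \<theta> i * \<theta> (i + 1) * (\<theta> (i + 1) - \<theta> i)" for i by (simp add: z_def)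
  have comm: "pA (As y) - As (pA y) = A (A (As (A y))) - A (As (A (A y)))" for y
  proof (rule lin_eqI[OF w, of "\<lambda>y. pA (As y) - As (pA y)" "\<lambda>y. A (A (As (A y))) - A (As (A (A y)))"])
    show "lin (\<lambda>y. pA (As y) - As (pA y))" "lin (\<lambda>y. A (A (As (A y))) - A (As (A (A y))))"
      by (intro linI; simp add: linear_add[OF A] linear_add[OF As] linear_add[OF pA_lin]
          linear_scale[OF A] linear_scale[OF As] linear_scale[OF pA_lin] scale_right_diff_distrib)+
    fix j assume j: "j \<le> d"
    show "pA (As (w j)) - As (pA (w j)) = A (A (As (A (w j)))) - A (As (A (A (w j))))"
    proof (rule coord_eqI[OF w])
      fix i assume i: "i \<le> d"
      define M where "M = cw (As (w j)) i"
      \<comment> \<open>Both sides of the commutator identity have entries that are multiples of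
        \<open>M\<close>, which is 0 unless \<open>i\<close> and \<open>j\<close> are equal or
        adjacent; there the factors agree by the choice of \<open>z\<close>.\<close>
      have "(z i - z j) * M = (\<theta> i * \<theta> i * \<theta> j - \<theta> i * \<theta> j * \<theta> j) * M"
      proof -
        consider "j = i + 1" | "j = i" | "i = j + 1" | "i + 1 < j \<or> j + 1 < i" by linarith
        then show ?thesis
        proof cases
          case 1
          have "z i - z j = \<theta> i * \<theta> i * \<theta> j - \<theta> i * \<theta> j * \<theta> j" using zd[of i] unfolding 1 by Groebner_Basis.algebra
          then show ?thesis by simp
        next
          case 3
          have "z i - z j = \<theta> i * \<theta> i * \<theta> j - \<theta> i * \<theta> j * \<theta> j" using zd[of j] unfolding 3 by Groebner_Basis.algebra
          then show ?thesis by simp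
        next
          case 4
          then show ?thesis using M_0[OF i j] by (simp add: M_def)
        qed simp
      qed
      then show "cw (pA (As (w j)) - As (pA (w j))) i = cw (A (A (As (A (w j)))) - A (As (A (A (w j))))) i"
        using j by (simp add: coord_diff[OF w] cw_pA cw_A pA_w A_w linear_scale[OF As] linear_scale[OF A]
            coord_scale[OF w] M_def algebra_simps)
    qed
  qed
  have cpow: "c (pow k (v i)) (i + k) = 1" "\<And>j. i + k < j \<Longrightarrow> c (pow k (v i)) j = 0" if "i + k \<le> d" for i k
    using c_shift_prod[of i "v i" k "\<lambda>_. 0" 0] that by (auto simp: pow_def c_simps)
  have cpA: "c (pA (v i)) j = (\<Sum>k\<le>d. coeff p k * c (pow k (v i)) j)" for i j
    by (simp add: pA_def coord_sum[OF v] c_simps)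
  have lhs: "c (pA (As (v i)) - As (pA (v i))) j = (\<theta>s i - \<theta>s j) * c (pA (v i)) j" if "i \<le> d" for i j
    using that by (simp add: c_simps As_v linear_scale[OF pA_lin] c_As algebra_simps)
  have pAn: "c (pA (v i)) (i + n) = coeff p n" if n: "i + n \<le> d" "\<And>k. n < k \<Longrightarrow> coeff p k = 0" for i n
  proof -
    have "c (pA (v i)) (i + n) = (\<Sum>k\<in>{n}. coeff p k * c (pow k (v i)) (i + n))"
      unfolding cpA
    proof (intro sum.mono_neutral_right ballI)
      fix k assume "k \<in> {..d} - {n}"
      then show "coeff p k * c (pow k (v i)) (i + n) = 0"
        using n cpow(2)[of i k "i + n"] by (cases "k < n") auto
    qed (use n in auto)
    then show ?thesis using cpow(1)[OF n(1)] by simp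
  qed
  \<comment> \<open>On \<open>v 0\<close> the right side of \<open>comm\<close> reaches only index
    3, whereas the left side has the nonzero coordinate
    \<open>(\<theta>s 0 - \<theta>s n) * coeff p n\<close> at \<open>n = degree p\<close>.\<close>
  have deg: "degree p \<le> 3"
  proof (rule ccontr)
    assume "\<not> degree p \<le> 3"
    then have n: "3 < degree p" by simp
    have s0: "\<And>i. 0 < i \<Longrightarrow> c (v 0) i = 0" by (simp add: c_simps)
    note s1 = c_support_A(1)[OF s0]
    note s2 = c_support_A(1)[OF s1]
    have "c (A (A (As (A (v 0))))) (degree p) = 0"
      by (rule c_support_A(1)[OF c_support_A(1)[OF c_support_As[OF s1]]]) (use n in auto)
    moreover have "c (A (As (A (A (v 0))))) (degree p) = 0"
      by (rule c_support_A(1)[OF c_support_As[OF s2]]) (use n in auto)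
    ultimately have "(\<theta>s 0 - \<theta>s (degree p)) * c (pA (v 0)) (degree p) = 0"
      using lhs[of 0 "degree p"] comm[of "v 0"] by (simp add: c_simps)
    moreover have "c (pA (v 0)) (0 + degree p) = coeff p (degree p)"
      by (rule pAn) (use p(1) in \<open>auto simp: coeff_eq_0\<close>)
    moreover have "coeff p (degree p) \<noteq> 0" using n by (metis leading_coeff_0_iff degree_0 not_less0)
    ultimately have "\<theta>s 0 = \<theta>s (degree p)" by simp
    then show False using inj_onD[OF \<theta>s_inj, of 0 "degree p"] n p(1) by auto
  qed
  show thesis
  proof (rule that[OF deg])
    show "poly p (\<theta> (i + 1)) - poly p (\<theta> i) = \<theta> i * \<theta> (i + 1) * (\<theta> (i + 1) - \<theta> i)" if "i + 1 \<le> d" for i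
      using p(2)[of i] p(2)[of "i + 1"] zd[of i] that by simp
    show "coeff p 3 * (\<theta>s i - \<theta>s (i + 3)) = \<theta>s (i + 1) - \<theta>s (i + 2)" if i: "i + 3 \<le> d" for i
    proof -
      have s0: "\<And>j. i < j \<Longrightarrow> c (v i) j = 0" using i by (simp add: c_simps)
      have l0: "c (v i) i = 1" using i by (simp add: c_simps)
      note s1 = c_support_A(1)[OF s0]
      have l1: "c (A (v i)) (i + 1) = 1" using c_support_A(2)[OF s0] l0 i by simp
      note s2 = c_support_A(1)[OF s1]
      have l2: "c (A (A (v i))) (i + 1 + 1) = 1" using c_support_A(2)[OF s1] l1 i by simp
      have t1: "c (As (A (v i))) (i + 1) = \<theta>s (i + 1)" using l1 by (simp add: c_As)
      note r1 = c_support_As[OF s1]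
      have t2: "c (A (As (A (v i)))) (i + 1 + 1) = \<theta>s (i + 1)" using c_support_A(2)[OF r1] t1 i by simp
      note r2 = c_support_A(1)[OF r1]
      have t3: "c (A (A (As (A (v i))))) (i + 1 + 1 + 1) = \<theta>s (i + 1)"
        using c_support_A(2)[OF r2] t2 i by simp
      have q1: "c (As (A (A (v i)))) (i + 1 + 1) = \<theta>s (i + 1 + 1)" using l2 by (simp add: c_As)
      note r3 = c_support_As[OF s2]
      have q2: "c (A (As (A (A (v i))))) (i + 1 + 1 + 1) = \<theta>s (i + 1 + 1)"
        using c_support_A(2)[OF r3] q1 i by simp
      have e: "i + 1 + 1 + 1 = i + 3" "i + 1 + 1 = i + 2" by simp_all
      have "c (pA (v i)) (i + 3) = coeff p 3"
        by (rule pAn) (use i deg in \<open>auto simp: coeff_eq_0\<close>)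
      moreover have "c (A (A (As (A (v i))))) (i + 3) = \<theta>s (i + 1)" using t3 unfolding e(1) .
      moreover have "c (A (As (A (A (v i))))) (i + 3) = \<theta>s (i + 2)" using q2 unfolding e(1) unfolding e(2) .
      moreover have "c (pA (As (v i)) - As (pA (v i))) (i + 3) = (\<theta>s i - \<theta>s (i + 3)) * c (pA (v i)) (i + 3)"
        by (rule lhs) (use i in simp)
      ultimately have "\<theta>s (i + 1) - \<theta>s (i + 2) = (\<theta>s i - \<theta>s (i + 3)) * coeff p 3"
        unfolding comm coord_diff[OF v] by (simp only:)
      then show ?thesis by (simp only: mult.commute)
    qed
  qed
qed

text \<open>Dividing the difference equation of the cubic by
  \<open>\<theta> (i + 1) - \<theta> i\<close>, subtracting neighbouring equations and dividing by
  \<open>\<theta> (i + 2) - \<theta> i\<close> leaves a linear relation. Its coefficient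
  \<open>p3\<close> also governs the equation for \<open>\<theta>s\<close>, which gives both
  sequences the same \<open>\<beta> = 1 / p3 - 1\<close>.\<close>

lemma three_term_recurrence:
  assumes d: "d \<ge> 3"
  obtains \<beta> \<gamma> where "\<And>k. 1 \<le> k \<Longrightarrow> k < d \<Longrightarrow> \<theta> (k - 1) + \<theta> (k + 1) = \<beta> * \<theta> k + \<gamma>"
    "\<And>k. 1 \<le> k \<Longrightarrow> k + 2 \<le> d \<Longrightarrow>
      (\<theta>s k - \<theta>s (k - 1)) + (\<theta>s (k + 2) - \<theta>s (k + 1)) = \<beta> * (\<theta>s (k + 1) - \<theta>s k)"
proof -
  obtain p where p: "degree p \<le> 3"
    "\<And>i. i + 1 \<le> d \<Longrightarrow> poly p (\<theta> (i + 1)) - poly p (\<theta> i) = \<theta> i * \<theta> (i + 1) * (\<theta> (i + 1) - \<theta> i)"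
    "\<And>i. i + 3 \<le> d \<Longrightarrow> coeff p 3 * (\<theta>s i - \<theta>s (i + 3)) = \<theta>s (i + 1) - \<theta>s (i + 2)"
    using cubic by blast
  define p0 p1 p2 p3 where "p0 = coeff p 0" and "p1 = coeff p 1" and "p2 = coeff p 2" and "p3 = coeff p 3"
  have poly: "poly p t = p0 + p1 * t + p2 * t * t + p3 * t * t * t" for t
  proof -
    have "poly p t = (\<Sum>k\<le>3. coeff p k * t ^ k)"
      unfolding poly_altdef using p(1) by (intro sum.mono_neutral_left) (auto simp: coeff_eq_0)
    then show ?thesis
      by (simp add: numeral_3_eq_3 numeral_2_eq_2 p0_def p1_def p2_def p3_def)
  qed
  have \<theta>: "\<theta> i - \<theta> j \<noteq> 0" if "i \<le> d" "j \<le> d" "i \<noteq> j" for i j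
    using \<theta>_inj that by (auto simp: inj_on_def)
  have \<theta>s: "\<theta>s i - \<theta>s j \<noteq> 0" if "i \<le> d" "j \<le> d" "i \<noteq> j" for i j
    using \<theta>s_inj that by (auto simp: inj_on_def)
  have p3: "p3 \<noteq> 0" using p(3)[of 0] \<theta>s[of 1 2] d by (auto simp: p3_def numeral_2_eq_2)
  define r where "r = inverse p3"
  have r: "r * p3 = 1" using p3 by (simp add: r_def)
  have two: "p3 * (\<theta> (i + 1) * \<theta> (i + 1) + \<theta> (i + 1) * \<theta> i + \<theta> i * \<theta> i) + p2 * (\<theta> (i + 1) + \<theta> i) + p1 = \<theta> i * \<theta> (i + 1)"
    if "i + 1 \<le> d" for i
  proof -
    have "(\<theta> (i + 1) - \<theta> i) * (p3 * (\<theta> (i + 1) * \<theta> (i + 1) + \<theta> (i + 1) * \<theta> i + \<theta> i * \<theta> i) + p2 * (\<theta> (i + 1) + \<theta> i) + p1)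
      = (\<theta> (i + 1) - \<theta> i) * (\<theta> i * \<theta> (i + 1))"
      using p(2)[OF that] unfolding poly by Groebner_Basis.algebra
    then show ?thesis by (rule mult_left_cancel[THEN iffD1, rotated]) (use \<theta>[of "i + 1" i] that in simp)
  qed
  show thesis
  proof (rule that[of "r - 1" "- r * p2"])
    show "\<theta> (k - 1) + \<theta> (k + 1) = (r - 1) * \<theta> k + - r * p2" if k: "1 \<le> k" "k < d" for k
    proof -
      obtain i where i: "k = i + 1" using k by (metis Suc_eq_plus1 Suc_le_D One_nat_def)
      have le: "i + 1 \<le> d" "i + 1 + 1 \<le> d" using k i by simp_all
      have "(\<theta> (i + 1 + 1) - \<theta> i) * (p3 * (\<theta> (i + 1 + 1) + \<theta> (i + 1) + \<theta> i) + p2) = (\<theta> (i + 1 + 1) - \<theta> i) * \<theta> (i + 1)"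
        using two[OF le(1)] two[OF le(2)] by Groebner_Basis.algebra
      then have "p3 * (\<theta> (i + 1 + 1) + \<theta> (i + 1) + \<theta> i) + p2 = \<theta> (i + 1)"
        by (rule mult_left_cancel[THEN iffD1, rotated]) (use \<theta>[of "i + 1 + 1" i] k i in simp)
      moreover obtain S where S: "\<theta> (i + 1 + 1) + \<theta> (i + 1) + \<theta> i = S" by blast
      ultimately have "r * (p3 * S + p2) = r * \<theta> (i + 1)" by simp
      then have "S + r * p2 = r * \<theta> (i + 1)" by (simp only: distrib_left mult.assoc[symmetric] r mult_1_left)
      then have "\<theta> i + \<theta> (i + 1 + 1) = (r - 1) * \<theta> (i + 1) + - r * p2"
        unfolding S[symmetric] by Groebner_Basis.algebra
      then show ?thesis using i by simp
    qed
    show "(\<theta>s k - \<theta>s (k - 1)) + (\<theta>s (k + 2) - \<theta>s (k + 1)) = (r - 1) * (\<theta>s (k + 1) - \<theta>s k)"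
      if k: "1 \<le> k" "k + 2 \<le> d" for k
    proof -
      obtain i where i: "k = i + 1" using k by (metis Suc_eq_plus1 Suc_le_D One_nat_def)
      have "p3 * (\<theta>s i - \<theta>s (i + 3)) = \<theta>s (i + 1) - \<theta>s (i + 2)" using p(3)[of i] k i by (simp add: p3_def)
      then have "\<theta>s i - \<theta>s (i + 3) = r * (\<theta>s (i + 1) - \<theta>s (i + 2))" using r by Groebner_Basis.algebra
      then have "(\<theta>s (i + 1) - \<theta>s i) + (\<theta>s (i + 3) - \<theta>s (i + 2)) = (r - 1) * (\<theta>s (i + 2) - \<theta>s (i + 1))"
        by Groebner_Basis.algebra
      then show ?thesis using i by (simp add: numeral_3_eq_3)
    qed
  qed
qed

end

section \<open>The flat part and bipartite pairs\<close>

text \<open>An injective walk on a path cannot turn back, so all its steps have the same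
  direction.\<close>

lemma path_automorphism:
  fixes \<sigma> :: "nat \<Rightarrow> nat"
  assumes inj: "inj_on \<sigma> {..d}" and ran: "\<And>i. i \<le> d \<Longrightarrow> \<sigma> i \<le> d"
    and adj: "\<And>i. i < d \<Longrightarrow> \<sigma> (i + 1) = \<sigma> i + 1 \<or> \<sigma> i = \<sigma> (i + 1) + 1"
  shows "(\<forall>i\<le>d. \<sigma> i = i) \<or> (\<forall>i\<le>d. \<sigma> i = d - i)"
proof (cases "d = 0")
  case True
  then show ?thesis using ran[of 0] by simp
next
  case False
  define s where "s = int (\<sigma> 1) - int (\<sigma> 0)"
  have step: "i < d \<Longrightarrow> int (\<sigma> (i + 1)) - int (\<sigma> i) = s" for i
  proof (induction i)
    case (Suc i)
    then have "\<sigma> (i + 2) \<noteq> \<sigma> i" using inj_onD[OF inj, of "i + 2" i] by auto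
    then show ?case using Suc adj[of i] adj[of "i + 1"] by auto
  qed (simp add: s_def)
  have lin: "i \<le> d \<Longrightarrow> int (\<sigma> i) = int (\<sigma> 0) + s * int i" for i
  proof (induction i)
    case (Suc i)
    then show ?case using step[of i] by (simp add: algebra_simps)
  qed simp
  have "s = 1 \<or> s = - 1" using adj[of 0] False by (auto simp: s_def)
  then show ?thesis
  proof
    assume s: "s = 1"
    then have "\<sigma> 0 = 0" using lin[of d] ran[of d] by simp
    then show ?thesis using lin s by simp
  next
    assume s: "s = - 1"
    then have "\<sigma> 0 = d" using lin[of d] ran[of 0] by simp
    then have "\<sigma> i = d - i" if "i \<le> d" for i using lin[OF that] s that by simp
    then show ?thesis by blast
  qed
qed

context tri_system
begin

lemma linear_combination: "lin (\<lambda>y. \<Sum>i\<le>d. (r i * c y i) *s v i)"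
  by (intro linI) (simp_all add: c_simps scale_left_distrib scale_sum_right sum.distrib distrib_left mult_ac)

lemma combination_v: "j \<le> d \<Longrightarrow> (\<Sum>i\<le>d. (r i * c (v j) i) *s v i) = r j *s v j"
proof -
  assume j: "j \<le> d"
  have "(\<Sum>i\<le>d. (r i * c (v j) i) *s v i) = (\<Sum>i\<le>d. if i = j then r j *s v j else 0)"
    using j by (intro sum.cong refl) (simp add: c_simps)
  then show ?thesis using j by simp
qed

lemma eigenspace_As:
  assumes inj: "inj_on \<theta>s {..d}" and y: "y \<in> eigenspace scale As (\<theta>s i)" and i: "i \<le> d"
  shows "y = c y i *s v i"
proof (rule coord_eqI[OF v])
  fix j assume j: "j \<le> d"
  have "\<theta>s j * c y j = \<theta>s i * c y j"
    using y c_As[of y j] by (auto simp: eigenspace_def c_simps)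
  then have "c y j = 0 \<or> j = i" using inj_onD[OF inj, of j i] i j by auto
  then show "c y j = c (c y i *s v i) j" using i by (auto simp: c_simps)
qed

lemma eigenvalues_As:
  assumes inj: "inj_on \<theta>s {..d}"
  shows "eigenvalues scale As = \<theta>s ` {..d}"
proof
  show "\<theta>s ` {..d} \<subseteq> eigenvalues scale As"
    using As_v basis_nonzero[OF v] by (auto simp: eigenvalues_def eigenspace_def)
  show "eigenvalues scale As \<subseteq> \<theta>s ` {..d}"
  proof
    fix t assume "t \<in> eigenvalues scale As"
    then obtain y where y: "y \<noteq> 0" "As y = t *s y" by (auto simp: eigenvalues_def eigenspace_def)
    then obtain j where j: "j \<le> d" "c y j \<noteq> 0" using coord_eqI[OF v, of y 0] by auto
    have "\<theta>s j * c y j = t * c y j" using y c_As[of y j] by (auto simp: c_simps)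
    then show "t \<in> \<theta>s ` {..d}" using j by auto
  qed
qed

text \<open>Each \<open>v j\<close> lies in the chosen eigenspace or in the span of the others, so
  the defining conditions fix the operator on a basis.\<close>

lemma primitive_idempotent_As:
  assumes inj: "inj_on \<theta>s {..d}" and i: "i \<le> d"
  shows "primitive_idempotent scale As (\<theta>s i) = (\<lambda>y. c y i *s v i)"
  unfolding primitive_idempotent_def
proof (rule the_equality)
  let ?U = "\<Union>s\<in>eigenvalues scale As - {\<theta>s i}. eigenspace scale As s"
  show "lin (\<lambda>y. c y i *s v i) \<and> (\<forall>y\<in>eigenspace scale As (\<theta>s i). c y i *s v i = y) \<and>
      (\<forall>y\<in>span ?U. c y i *s v i = 0)"
  proof (intro conjI ballI)
    show "lin (\<lambda>y. c y i *s v i)" by (intro linI) (simp_all add: c_simps scale_left_distrib)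
    show "c y i *s v i = y" if "y \<in> eigenspace scale As (\<theta>s i)" for y
      using eigenspace_As[OF inj that i] by simp
    fix y assume "y \<in> span ?U"
    then have "c y i = 0"
    proof (induction rule: span_induct_alt)
      case (step r z y)
      then obtain j where j: "j \<le> d" "\<theta>s j \<noteq> \<theta>s i" "z \<in> eigenspace scale As (\<theta>s j)"
        by (auto simp: eigenvalues_As[OF inj])
      then have "c (c z j *s v j) i = 0" by (auto simp: c_simps)
      then have "c z i = 0" using eigenspace_As[OF inj j(3,1)] by simp
      then show ?case using step by (simp add: c_simps)
    qed simp
    then show "c y i *s v i = 0" by simp
  qed
  fix E assume E: "lin E \<and> (\<forall>y\<in>eigenspace scale As (\<theta>s i). E y = y) \<and> (\<forall>y\<in>span ?U. E y = 0)"
  show "E = (\<lambda>y. c y i *s v i)"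
  proof
    fix y
    show "E y = c y i *s v i"
    proof (rule lin_eqI[OF v, of E "\<lambda>y. c y i *s v i"])
      show "lin E" using E by blast
      show "lin (\<lambda>y. c y i *s v i)" by (intro linI) (simp_all add: c_simps scale_left_distrib)
      fix j assume j: "j \<le> d"
      have ev: "v j \<in> eigenspace scale As (\<theta>s j)" using As_v[OF j] by (simp add: eigenspace_def)
      show "E (v j) = c (v j) i *s v i"
      proof (cases "j = i")
        case True
        then show ?thesis using E ev i by (simp add: c_simps)
      next
        case False
        then have "\<theta>s j \<in> eigenvalues scale As - {\<theta>s i}"
          using inj_onD[OF inj, of j i] i j by (auto simp: eigenvalues_As[OF inj])
        then have "v j \<in> span ?U" using ev by (intro span_base) blast
        then show ?thesis using E False j by (simp add: c_simps)
      qed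
    qed
  qed
qed

lemma flat_part_eq:
  assumes inj: "inj_on \<theta>s {..d}"
  shows "flat_part scale A As = (\<lambda>y. \<Sum>i\<le>d. (a i * c y i) *s v i)"
proof
  fix y
  have "flat_part scale A As y = (\<Sum>i\<le>d. c (A (c y i *s v i)) i *s v i)"
    unfolding flat_part_def eigenvalues_As[OF inj]
    by (subst sum.reindex[OF inj]) (simp add: primitive_idempotent_As[OF inj])
  also have "\<dots> = (\<Sum>i\<le>d. (a i * c y i) *s v i)"
    by (intro sum.cong refl) (auto simp: c_A c_simps linear_scale[OF A] mult.commute)
  finally show "flat_part scale A As y = (\<Sum>i\<le>d. (a i * c y i) *s v i)" .
qed

lemma flat_part_removed:
  assumes inj: "inj_on \<theta>s {..d}"
  shows "tri_system scale d (\<lambda>y. A y - flat_part scale A As y) As v \<theta>s (\<lambda>_. 0) x"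
proof unfold_locales
  have L: "lin (\<lambda>y. A y - flat_part scale A As y)"
    unfolding flat_part_eq[OF inj] using linear_combination[of a]
    by (intro linI) (simp_all add: linear_add[OF A] linear_add[OF linear_combination] linear_scale[OF A]
        linear_scale[OF linear_combination] scale_right_diff_distrib)
  fix y z r
  show "A (y + z) - flat_part scale A As (y + z) = A y - flat_part scale A As y + (A z - flat_part scale A As z)"
    using linear_add[OF L] .
  show "A (r *s y) - flat_part scale A As (r *s y) = r *s (A y - flat_part scale A As y)"
    using linear_scale[OF L] .
next
  fix i assume "i \<le> d"
  then show "A (v i) - flat_part scale A As (v i) = (if i < d then v (i + 1) else 0) + 0 *s v i + (if 0 < i then x i *s v (i - 1) else 0)"
    by (simp add: flat_part_eq[OF inj] combination_v A_v)
qed (use v As_v x_nz in \<open>auto simp: linear_add[OF As] linear_scale[OF As]\<close>)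

lemma irreducible_A: "irreducible_tridiagonal (matrix_wrt scale d v A)"
proof -
  have e: "c (A (v j)) i = (if j + 1 = i then 1 else 0) + (if j = i then a i else 0) + (if j = i + 1 then x (i + 1) else 0)"
    if "i \<le> d" "j \<le> d" for i j
    using that by (simp add: A_v c_simps) auto
  show ?thesis
    unfolding irreducible_tridiagonal_def matrix_wrt_crd using x_nz by (auto simp: e)
qed

lemma diag_As: "matrix_wrt scale d v As = diag_seq_mat d \<theta>s"
  unfolding matrix_wrt_crd diag_seq_mat_def by (rule cong_mat) (auto simp: As_v c_simps)

lemma eigenbasis_exists:
  assumes u: "split_basis \<theta> \<phi> u" and inj: "inj_on \<theta> {..d}"
  shows "\<exists>w. basis d w \<and> (\<forall>i\<le>d. A (w i) = \<theta> i *s w i)"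
proof -
  have ub: "basis d u"
    and Au: "\<And>k. k \<le> d \<Longrightarrow> A (u k) = \<theta> k *s u k + (if k < d then u (k + 1) else 0)"
    using u by (auto simp: split_basis_def)
  \<comment> \<open>Solving the eigenvector equation of the lower bidiagonal matrix from entry 1 at
    position \<open>i\<close> onwards gives these reciprocal products; the empty product at
    \<open>k = i\<close> is the entry 1.\<close>
  define e where "e i k = (if k < i then 0 else inverse (\<Prod>h\<in>{i<..k}. \<theta> i - \<theta> h))" for i k
  define w where "w i = (\<Sum>k\<le>d. e i k *s u k)" for i
  have cw: "coord d u (w i) k = e i k" if "k \<le> d" for i k
    unfolding w_def by (rule coord_combination[OF ub that])
  have e_nz: "e i i \<noteq> 0" for i by (simp add: e_def)
  have e_step: "(if m = 0 then 0 else e i (m - 1)) = (\<theta> i - \<theta> m) * e i m" if im: "i \<le> d" "m \<le> d" for i m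
  proof -
    consider "m < i" | "m = i" | "i < m" by linarith
    then show ?thesis
    proof cases
      case 3
      then have "{i<..m} = insert m {i<..m - 1}" by auto
      then have "(\<Prod>h\<in>{i<..m}. \<theta> i - \<theta> h) = (\<theta> i - \<theta> m) * (\<Prod>h\<in>{i<..m - 1}. \<theta> i - \<theta> h)" using 3 by simp
      moreover have "\<theta> i - \<theta> m \<noteq> 0" using inj_onD[OF inj, of i m] im 3 by auto
      ultimately show ?thesis using 3 by (auto simp: e_def)
    qed (auto simp: e_def)
  qed
  have "A (w i) = \<theta> i *s w i" if i: "i \<le> d" for i
  proof (rule coord_eqI[OF ub])
    fix m assume m: "m \<le> d"
    have cAu: "coord d u (A (u k)) m = (if k = m then \<theta> m else 0) + (if k + 1 = m then 1 else 0)" if "k \<le> d" for k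
      using that m by (simp add: Au coord_add[OF ub] coord_scale[OF ub] coord_basis[OF ub])
    have "coord d u (A (w i)) m = (\<Sum>k\<le>d. coord d u (w i) k * coord d u (A (u k)) m)"
      by (rule coord_image[OF ub A])
    also have "\<dots> = (\<Sum>k\<le>d. (if k = m then e i m * \<theta> m else 0) + (if k + 1 = m then e i (m - 1) else 0))"
      by (intro sum.cong refl) (auto simp: cAu cw)
    also have "\<dots> = e i m * \<theta> m + (\<Sum>k\<le>d. if k + 1 = m then e i (m - 1) else 0)"
      using m by (simp add: sum.distrib)
    also have "(\<Sum>k\<le>d. if k + 1 = m then e i (m - 1) else 0) = (if m = 0 then 0 else e i (m - 1))"
    proof (cases m)
      case (Suc n)
      then have "(\<Sum>k\<le>d. if k + 1 = m then e i (m - 1) else 0) = (\<Sum>k\<le>d. if k = n then e i n else 0)"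
        by (intro sum.cong) auto
      then show ?thesis using Suc m by simp
    qed simp
    also have "e i m * \<theta> m + \<dots> = \<theta> i * e i m" using e_step[OF i m] by (simp add: algebra_simps)
    finally show "coord d u (A (w i)) m = coord d u (\<theta> i *s w i) m"
      using m by (simp add: coord_scale[OF ub] cw)
  qed
  \<comment> \<open>\<open>w i\<close> starts at index \<open>i\<close> of \<open>u\<close>, so
    triangularity appears after both bases are reversed.\<close>
  moreover have "basis d (\<lambda>i. w (d - i))"
  proof (rule triangular_basis[OF basis_reverse[OF ub]])
    show "coord d (\<lambda>i. u (d - i)) (w (d - k)) k \<noteq> 0" if "k \<le> d" for k
      using that e_nz by (simp add: coord_reverse cw)
    show "coord d (\<lambda>i. u (d - i)) (w (d - k)) i = 0" if "k \<le> d" "k < i" for k i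
    proof (cases "i \<le> d")
      case True
      then have "d - i < d - k" using that by simp
      then show ?thesis using True by (simp add: coord_reverse cw e_def)
    qed simp
  qed
  then have "basis d (\<lambda>i. w (d - (d - i)))" by (rule basis_reverse)
  ultimately show ?thesis by (intro exI[of _ "\<lambda>i. w (d - (d - i))"]) auto
qed

text \<open>\<open>u\<close> and \<open>w\<close> are triangular with respect to each other, each
  vector starting at its own index, and \<open>As\<close> lowers that index by at most one, with
  coefficient \<open>\<phi>\<close>. This controls only the entries on one side of the
  diagonal.\<close>

lemma split_lower_band:
  assumes u: "split_basis \<theta> \<phi> u" and inj: "inj_on \<theta> {..d}"
    and \<phi>: "\<And>k. 1 \<le> k \<Longrightarrow> k \<le> d \<Longrightarrow> \<phi> k \<noteq> 0"
    and w: "basis d w" and Aw: "\<And>i. i \<le> d \<Longrightarrow> A (w i) = \<theta> i *s w i"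
    and ij: "i \<le> d" "j \<le> d"
  shows "i + 1 < j \<Longrightarrow> coord d w (As (w j)) i = 0" "i + 1 = j \<Longrightarrow> coord d w (As (w j)) i \<noteq> 0"
proof -
  have ub: "basis d u"
    and Au: "\<And>k. k \<le> d \<Longrightarrow> A (u k) = \<theta> k *s u k + (if k < d then u (k + 1) else 0)"
    and Asu: "\<And>k. k \<le> d \<Longrightarrow> As (u k) = \<theta>s k *s u k + (if 0 < k then \<phi> k *s u (k - 1) else 0)"
    using u by (auto simp: split_basis_def)
  let ?u = "coord d u" and ?w = "coord d w"
  have \<theta>: "\<theta> i - \<theta> j \<noteq> 0" if "i \<le> d" "j \<le> d" "i \<noteq> j" for i j
    using inj_onD[OF inj, of i j] that by auto
  have wu: "?w (u k) m = 0" if "k \<le> d" "m < k" for k m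
    using that
  proof (induction "d - k" arbitrary: k)
    case 0
    then have "\<not> k < d" by simp
    then have "A (u k) = \<theta> k *s u k" using Au[of k] 0 by simp
    then have "\<theta> m * ?w (u k) m = \<theta> k * ?w (u k) m"
      using coord_eigen[OF w A Aw, of "u k" m] coord_scale[OF w, of "\<theta> k" "u k" m] by auto
    then show ?case using \<theta>[of m k] 0(2,3) by auto
  next
    case (Suc n)
    then have "?w (u (k + 1)) m = 0" by (intro Suc) auto
    moreover have "A (u k) = \<theta> k *s u k + u (k + 1)" using Au[of k] Suc by auto
    ultimately have "\<theta> m * ?w (u k) m = \<theta> k * ?w (u k) m"
      using coord_eigen[OF w A Aw, of "u k" m] by (simp only: coord_add[OF w] coord_scale[OF w] add_0_right)
    then show ?case using \<theta>[of m k] Suc(3,4) by auto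
  qed
  have uA: "?u (A y) m = \<theta> m * ?u y m + (if m = 0 then 0 else ?u y (m - 1))" if m: "m \<le> d" for y m
  proof -
    have cAu: "?u (A (u k)) m = (if k = m then \<theta> m else 0) + (if k + 1 = m then 1 else 0)" if "k \<le> d" for k
      using that m by (simp add: Au coord_add[OF ub] coord_scale[OF ub] coord_basis[OF ub])
    have "?u (A y) m = (\<Sum>k\<le>d. ?u y k * ?u (A (u k)) m)"
      by (rule coord_image[OF ub A])
    also have "\<dots> = (\<Sum>k\<le>d. (if k = m then \<theta> m * ?u y m else 0) + (if k + 1 = m then ?u y (m - 1) else 0))"
      by (intro sum.cong refl) (auto simp: cAu)
    also have "\<dots> = \<theta> m * ?u y m + (\<Sum>k\<le>d. if k + 1 = m then ?u y (m - 1) else 0)"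
      using m by (simp add: sum.distrib)
    also have "(\<Sum>k\<le>d. if k + 1 = m then ?u y (m - 1) else 0) = (if m = 0 then 0 else ?u y (m - 1))"
    proof (cases m)
      case (Suc n)
      then have "(\<Sum>k\<le>d. if k + 1 = m then ?u y (m - 1) else 0) = (\<Sum>k\<le>d. if k = n then ?u y n else 0)"
        by (intro sum.cong) auto
      then show ?thesis using Suc m by simp
    qed simp
    finally show ?thesis .
  qed
  have uw: "?u (w k) m = 0" if "k \<le> d" "m < k" for k m
    using that(2)
  proof (induction m)
    case 0
    then show ?case using uA[of 0 "w k"] Aw[OF that(1)] \<theta>[of k 0] that by (auto simp: coord_scale[OF ub])
  next
    case (Suc m)
    then show ?case using uA[of "Suc m" "w k"] Aw[OF that(1)] \<theta>[of k "Suc m"] that by (auto simp: coord_scale[OF ub])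
  qed
  have w_via_u: "?w y m = (\<Sum>k\<le>d. ?u y k * ?w (u k) m)" for y m
  proof -
    have "?w (\<Sum>k\<le>d. ?u y k *s u k) m = (\<Sum>k\<le>d. ?u y k * ?w (u k) m)"
      by (simp add: coord_sum[OF w] coord_scale[OF w])
    then show ?thesis using coord_expand[OF ub, of y] by simp
  qed
  have lead: "?w y m = ?u y m * ?w (u m) m" if "\<And>k. k < m \<Longrightarrow> ?u y k = 0" "m \<le> d" for y m
  proof -
    have "?w y m = (\<Sum>k\<in>{m}. ?u y k * ?w (u k) m)"
      unfolding w_via_u[of y m]
    proof (intro sum.mono_neutral_right ballI)
      fix k assume "k \<in> {..d} - {m}"
      then show "?u y k * ?w (u k) m = 0" using that wu[of k m] by (cases "k < m") auto
    qed (use that in auto)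
    then show ?thesis by simp
  qed
  have nz: "?u (w k) k \<noteq> 0" "?w (u k) k \<noteq> 0" if "k \<le> d" for k
    using lead[of k "w k"] uw that coord_basis[OF w that, of k] by auto
  have uAs: "?u (As (w j)) m = \<theta>s m * ?u (w j) m + \<phi> (m + 1) * ?u (w j) (m + 1)" if m: "m \<le> d" for m
  proof -
    have cAsu: "?u (As (u k)) m = (if k = m then \<theta>s m else 0) + (if k = m + 1 then \<phi> (m + 1) else 0)" if "k \<le> d" for k
      using that m by (simp add: Asu coord_add[OF ub] coord_scale[OF ub] coord_basis[OF ub]) auto
    have "?u (As (w j)) m = (\<Sum>k\<le>d. ?u (w j) k * ?u (As (u k)) m)"
      by (rule coord_image[OF ub As])
    also have "\<dots> = (\<Sum>k\<le>d. (if k = m then \<theta>s m * ?u (w j) m else 0) + (if k = m + 1 then \<phi> (m + 1) * ?u (w j) (m + 1) else 0))"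
      by (intro sum.cong refl) (auto simp: cAsu)
    also have "\<dots> = \<theta>s m * ?u (w j) m + \<phi> (m + 1) * ?u (w j) (m + 1)"
      using m by (simp add: sum.distrib)
    finally show ?thesis .
  qed
  have As0: "?u (As (w j)) k = 0" if "k + 1 < j" for k
    using uAs[of k] uw[OF ij(2)] that ij by simp
  show "?w (As (w j)) i = 0" if "i + 1 < j"
    using lead[of i "As (w j)"] As0 that ij by simp
  show "?w (As (w j)) i \<noteq> 0" if "i + 1 = j"
  proof -
    have "?u (As (w j)) i = \<phi> j * ?u (w j) j" using uAs[OF ij(1)] uw[OF ij(2), of i] that by simp
    then have "?u (As (w j)) i \<noteq> 0" using nz(1)[OF ij(2)] \<phi>[of j] that ij by simp
    then show ?thesis using lead[of i "As (w j)"] As0 that ij nz(2)[OF ij(1)] by simp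
  qed
qed

text \<open>Reversing an eigenbasis exchanges the two sides of the diagonal, so the second split
  basis supplies the half of the band that the first leaves open.\<close>

lemma leonard_data_from_splits:
  assumes u: "split_basis \<theta> \<phi> u" and t: "split_basis (\<lambda>i. \<theta> (d - i)) \<psi> t"
    and inj: "inj_on \<theta> {..d}"
    and \<phi>: "\<And>k. 1 \<le> k \<Longrightarrow> k \<le> d \<Longrightarrow> \<phi> k \<noteq> 0" and \<psi>: "\<And>k. 1 \<le> k \<Longrightarrow> k \<le> d \<Longrightarrow> \<psi> k \<noteq> 0"
  shows "\<exists>w. leonard_data scale d A As v \<theta>s a x w \<theta>"
proof -
  obtain w where w: "basis d w" "\<And>i. i \<le> d \<Longrightarrow> A (w i) = \<theta> i *s w i"
    using eigenbasis_exists[OF u inj] by blast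
  have inj': "inj_on (\<lambda>i. \<theta> (d - i)) {..d}"
    by (rule inj_onI) (metis atMost_iff diff_diff_cancel diff_le_self inj inj_onD)
  have w': "basis d (\<lambda>i. w (d - i))" "\<And>i. i \<le> d \<Longrightarrow> A (w (d - i)) = \<theta> (d - i) *s w (d - i)"
    using basis_reverse[OF w(1)] w(2) by auto
  note lo = split_lower_band[OF u inj \<phi> w]
  note up = split_lower_band[OF t inj' \<psi> w']
  have low: "coord d w (As (w j)) i = 0" if "i \<le> d" "j \<le> d" "i + 1 < j" for i j
    by (rule lo(1)) (use that in auto)
  have low1: "coord d w (As (w j)) i \<noteq> 0" if "i \<le> d" "j \<le> d" "i + 1 = j" for i j
    by (rule lo(2)) (use that in auto)
  have upp: "coord d w (As (w j)) i = 0" if "i \<le> d" "j \<le> d" "j + 1 < i" for i j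
  proof -
    have "coord d (\<lambda>i. w (d - i)) (As (w (d - (d - j)))) (d - i) = 0"
      by (rule up(1)) (use that in auto)
    then show ?thesis using that by (simp add: coord_reverse)
  qed
  have upp1: "coord d w (As (w j)) i \<noteq> 0" if "i \<le> d" "j \<le> d" "j + 1 = i" for i j
  proof -
    have "coord d (\<lambda>i. w (d - i)) (As (w (d - (d - j)))) (d - i) \<noteq> 0"
      by (rule up(2)) (use that in auto)
    then show ?thesis using that by (simp add: coord_reverse)
  qed
  have "leonard_data scale d A As v \<theta>s a x w \<theta>"
  proof unfold_locales
    show "irreducible_tridiagonal (matrix_wrt scale d w As)"
      unfolding irreducible_tridiagonal_def matrix_wrt_crd
      using low low1 upp upp1 by auto
  qed (use w in auto)
  then show ?thesis by blast
qed

end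

context leonard_data
begin

text \<open>
  If \<open>A\<close> has zero diagonal, conjugation by the sign operator turns \<open>A\<close> into \<open>-A\<close> and fixes \<open>A\<^sup>*\<close>;
  it therefore acts on the \<open>A\<close>-eigenspaces as an automorphism of the path.
\<close>

lemma bipartite_eigenvalues:
  assumes a: "\<And>i. i \<le> d \<Longrightarrow> a i = 0" and two: "(2::'a) \<noteq> 0" and d: "d \<ge> 1" and k: "k \<le> d"
  shows "\<theta> (d - k) = - \<theta> k"
proof -
  define S where "S y = (\<Sum>i\<le>d. ((- 1) ^ i * c y i) *s v i)" for y
  have S: "lin S" unfolding S_def by (rule linear_combination)
  have S_v: "S (v i) = (- 1) ^ i *s v i" if "i \<le> d" for i
    unfolding S_def by (rule combination_v[OF that])
  have cS: "c (S y) i = (- 1) ^ i * c y i" for y i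
    by (rule coord_eigen[OF v S S_v])
  have SA: "S (A y) = - A (S y)" for y
  proof (rule coord_eqI[OF v])
    fix i assume i: "i \<le> d"
    show "c (S (A y)) i = c (- A (S y)) i"
      using i a[OF i] by (cases i) (auto simp: cS c_A coord_uminus[OF v] algebra_simps)
  qed
  have SAs: "S (As y) = As (S y)" for y
    by (rule coord_eqI[OF v]) (simp add: cS c_As)
  have SS: "S (S y) = y" for y
    by (rule coord_eqI[OF v]) (simp add: cS mult.assoc[symmetric] power_mult_distrib[symmetric])
  have "\<exists>j. j \<le> d \<and> - \<theta> i = \<theta> j \<and> S (w i) = cw (S (w i)) j *s w j" if i: "i \<le> d" for i
  proof -
    have nz: "S (w i) \<noteq> 0"
    proof
      assume "S (w i) = 0"
      then have "w i = 0" using SS[of "w i"] linear_zero[OF S] by simp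
      then show False using basis_nonzero[OF w i] by simp
    qed
    have e: "A (S (w i)) = (- \<theta> i) *s S (w i)"
      using SA[of "w i"] A_w[OF i] linear_scale[OF S] by (metis minus_minus scale_minus_left)
    obtain j where j: "j \<le> d" "cw (S (w i)) j \<noteq> 0" using nz coord_eqI[OF w, of "S (w i)" 0] by auto
    have m: "\<theta> m * cw (S (w i)) m = - \<theta> i * cw (S (w i)) m" for m
      using cw_A[of "S (w i)" m] unfolding e by (simp add: coord_scale[OF w] coord_uminus[OF w])
    have t: "- \<theta> i = \<theta> j" using m[of j] j by (metis mult_right_cancel)
    have "S (w i) = cw (S (w i)) j *s w j"
    proof (rule coord_eqI[OF w])
      fix m' assume m': "m' \<le> d"
      have "cw (S (w i)) m' = 0 \<or> m' = j" using m[of m'] unfolding t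
        using inj_onD[OF \<theta>_inj, of m' j] m' j by auto
      then show "cw (S (w i)) m' = cw (cw (S (w i)) j *s w j) m'"
        using j by (auto simp: coord_scale[OF w] coord_basis[OF w])
    qed
    then show ?thesis using j t by blast
  qed
  then obtain \<sigma> where \<sigma>: "\<And>i. i \<le> d \<Longrightarrow> \<sigma> i \<le> d" "\<And>i. i \<le> d \<Longrightarrow> - \<theta> i = \<theta> (\<sigma> i)"
    "\<And>i. i \<le> d \<Longrightarrow> S (w i) = cw (S (w i)) (\<sigma> i) *s w (\<sigma> i)"
    by metis
  define r where "r i = cw (S (w i)) (\<sigma> i)" for i
  have Sw: "S (w i) = r i *s w (\<sigma> i)" if "i \<le> d" for i using \<sigma>(3)[OF that] by (simp add: r_def)
  have r: "r i \<noteq> 0" if i: "i \<le> d" for i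
  proof
    assume "r i = 0"
    then have "S (w i) = 0" using Sw[OF i] by simp
    then have "w i = 0" using SS[of "w i"] linear_zero[OF S] by simp
    then show False using basis_nonzero[OF w i] by simp
  qed
  have \<sigma>_inj: "inj_on \<sigma> {..d}"
  proof (rule inj_onI)
    fix i j assume ij: "i \<in> {..d}" "j \<in> {..d}" "\<sigma> i = \<sigma> j"
    then have "- \<theta> i = - \<theta> j" using \<sigma>(2)[of i] \<sigma>(2)[of j] by simp
    then show "i = j" using inj_onD[OF \<theta>_inj, of i j] ij by simp
  qed
  \<comment> \<open>\<open>S\<close> commutes with \<open>As\<close>, so it carries the nonzero
    entry of \<open>As\<close> between neighbours to a nonzero entry, and tridiagonality then makes
    the images neighbours.\<close>
  have adj: "\<sigma> (i + 1) = \<sigma> i + 1 \<or> \<sigma> i = \<sigma> (i + 1) + 1" if i: "i < d" for i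
  proof -
    have "S (As (w i)) = (\<Sum>j\<le>d. (cw (As (w i)) j * r j) *s w (\<sigma> j))"
      by (subst coord_expand[OF w, of "As (w i)"]) (simp add: linear_sum[OF S] linear_scale[OF S] Sw)
    then have "cw (S (As (w i))) (\<sigma> (i + 1)) = (\<Sum>j\<le>d. cw (As (w i)) j * r j * cw (w (\<sigma> j)) (\<sigma> (i + 1)))"
      by (simp add: coord_sum[OF w] coord_scale[OF w])
    also have "\<dots> = (\<Sum>j\<le>d. if j = i + 1 then cw (As (w i)) j * r j else 0)"
    proof (intro sum.cong refl)
      fix j assume "j \<in> {..d}"
      then show "cw (As (w i)) j * r j * cw (w (\<sigma> j)) (\<sigma> (i + 1)) = (if j = i + 1 then cw (As (w i)) j * r j else 0)"
        using coord_basis[OF w \<sigma>(1), of j "\<sigma> (i + 1)"] inj_onD[OF \<sigma>_inj, of "i + 1" j] i by auto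
    qed
    also have "\<dots> = cw (As (w i)) (i + 1) * r (i + 1)" using i by simp
    finally have "cw (S (As (w i))) (\<sigma> (i + 1)) \<noteq> 0" using M_1[of "i + 1" i] r[of "i + 1"] i by simp
    moreover have "S (As (w i)) = r i *s As (w (\<sigma> i))"
      unfolding SAs using Sw[of i] i linear_scale[OF As] by simp
    ultimately have "cw (As (w (\<sigma> i))) (\<sigma> (i + 1)) \<noteq> 0" by (auto simp: coord_scale[OF w])
    then have "\<not> (\<sigma> (i + 1) + 1 < \<sigma> i \<or> \<sigma> i + 1 < \<sigma> (i + 1))"
      using M_0[of "\<sigma> (i + 1)" "\<sigma> i"] \<sigma>(1)[of i] \<sigma>(1)[of "i + 1"] i by auto
    moreover have "\<sigma> i \<noteq> \<sigma> (i + 1)" using inj_onD[OF \<sigma>_inj, of i "i + 1"] i by auto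
    ultimately show ?thesis by linarith
  qed
  \<comment> \<open>The identity would mean \<open>\<theta> i = - \<theta> i\<close> for all
    \<open>i\<close>, hence a repeated eigenvalue 0.\<close>
  have "\<not> (\<forall>i\<le>d. \<sigma> i = i)"
  proof
    assume id: "\<forall>i\<le>d. \<sigma> i = i"
    have "\<theta> i = 0" if "i \<le> d" for i
    proof -
      have "2 * \<theta> i = 0" using \<sigma>(2)[OF that] id that by (metis add.right_inverse mult_2)
      then show ?thesis using two by simp
    qed
    then show False using inj_onD[OF \<theta>_inj, of 0 1] d by auto
  qed
  then have "\<sigma> k = d - k" using path_automorphism[OF \<sigma>_inj \<sigma>(1) adj] k by blast
  then show ?thesis using \<sigma>(2)[OF k] by simp
qed

end

section \<open>Parameter arrays\<close>

lemma (in split_numbers) fundamental_ratios: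
  assumes i: "2 \<le> i" "i < d"
  shows "(\<theta> (i - 2) - \<theta> (i + 1)) / (\<theta> (i - 1) - \<theta> i) = \<beta> + 1"
    and "(\<theta>s (i - 2) - \<theta>s (i + 1)) / (\<theta>s (i - 1) - \<theta>s i) = \<beta> + 1"
proof -
  obtain k where k: "i = k + 2" using i(1) by (metis add.commute le_Suc_ex)
  have e: "i - 2 = k" "i - 1 = k + 1" using k by simp_all
  have le: "k + 1 < d" "k + 2 < d" "k + 3 \<le> d" using i k by simp_all
  have "\<theta> k + \<theta> (k + 2) = \<beta> * \<theta> (k + 1) + \<gamma>" "\<theta> (k + 1) + \<theta> (k + 3) = \<beta> * \<theta> (k + 2) + \<gamma>"
    using \<theta>_rec[of "k + 1"] \<theta>_rec[of "k + 2"] le by (simp_all add: numeral_3_eq_3)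
  then have "\<theta> k - \<theta> (k + 3) = (\<beta> + 1) * (\<theta> (k + 1) - \<theta> (k + 2))" by Groebner_Basis.algebra
  then show "(\<theta> (i - 2) - \<theta> (i + 1)) / (\<theta> (i - 1) - \<theta> i) = \<beta> + 1"
    using \<theta>_neq[of "k + 1" "k + 2"] le unfolding e k by (simp add: numeral_3_eq_3)
  have "(\<theta>s (k + 1) - \<theta>s k) + (\<theta>s (k + 3) - \<theta>s (k + 2)) = \<beta> * (\<theta>s (k + 2) - \<theta>s (k + 1))"
    using \<theta>s_rec[of "k + 1"] le by (simp add: numeral_3_eq_3)
  then have "\<theta>s k - \<theta>s (k + 3) = (\<beta> + 1) * (\<theta>s (k + 1) - \<theta>s (k + 2))" by Groebner_Basis.algebra
  then show "(\<theta>s (i - 2) - \<theta>s (i + 1)) / (\<theta>s (i - 1) - \<theta>s i) = \<beta> + 1"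
    using \<theta>s_neq[of "k + 1" "k + 2"] le unfolding e k by (simp add: numeral_3_eq_3)
qed

context vspace
begin

lemma diag_seq_matD:
  assumes w: "basis d w" and m: "matrix_wrt scale d w A = diag_seq_mat d \<theta>" and j: "j \<le> d"
  shows "A (w j) = \<theta> j *s w j"
proof (rule coord_eqI[OF w])
  fix i assume i: "i \<le> d"
  have "coord d w (A (w j)) i = matrix_wrt scale d w A $$ (i, j)" using i j by (simp add: matrix_wrt_crd)
  also have "\<dots> = (if i = j then \<theta> i else 0)" unfolding m using i j by (simp add: diag_seq_mat_def)
  finally show "coord d w (A (w j)) i = coord d w (\<theta> j *s w j) i"
    using j by (auto simp: coord_scale[OF w] coord_basis[OF w])
qed

lemma leonard_pair_iff_orderings:
  "leonard_pair scale d A As \<longleftrightarrow> lin A \<and> lin As \<and>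
     (\<exists>\<theta>. standard_ordering scale d A As \<theta>) \<and> (\<exists>\<theta>s. standard_ordering scale d As A \<theta>s)"
proof -
  have "diagonal_mat (matrix_wrt scale d v B) \<longleftrightarrow> (\<exists>\<theta>. matrix_wrt scale d v B = diag_seq_mat d \<theta>)" for v B
  proof
    assume "diagonal_mat (matrix_wrt scale d v B)"
    then have "matrix_wrt scale d v B = diag_seq_mat d (\<lambda>i. matrix_wrt scale d v B $$ (i, i))"
      by (intro eq_matI) (auto simp: diagonal_mat_def diag_seq_mat_def matrix_wrt_crd)
    then show "\<exists>\<theta>. matrix_wrt scale d v B = diag_seq_mat d \<theta>" by blast
  next
    assume "\<exists>\<theta>. matrix_wrt scale d v B = diag_seq_mat d \<theta>"
    then show "diagonal_mat (matrix_wrt scale d v B)" by (auto simp: diagonal_mat_def diag_seq_mat_def)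
  qed
  then show ?thesis unfolding leonard_pair_def standard_ordering_def by blast
qed

lemma leonard_data_of_orderings:
  assumes "lin A" "lin As" and 1: "standard_ordering scale d A As \<theta>" and 2: "standard_ordering scale d As A \<theta>s"
  obtains v a x w where "leonard_data scale d A As v \<theta>s a x w \<theta>"
proof -
  obtain w where w: "basis d w" "matrix_wrt scale d w A = diag_seq_mat d \<theta>"
    "irreducible_tridiagonal (matrix_wrt scale d w As)"
    using 1 by (auto simp: standard_ordering_def)
  obtain v where v: "basis d v" "matrix_wrt scale d v As = diag_seq_mat d \<theta>s"
    "irreducible_tridiagonal (matrix_wrt scale d v A)"
    using 2 by (auto simp: standard_ordering_def)
  obtain v' a x where T: "tri_system scale d A As v' \<theta>s a x"
    using monic_exists[OF v(1) assms(1,2) v(3) diag_seq_matD[OF v(1,2)]] by blast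
  have "leonard_data scale d A As v' \<theta>s a x w \<theta>"
    using T w diag_seq_matD[OF w(1,2)] by (simp add: leonard_data_def leonard_data_axioms_def)
  then show thesis by (rule that)
qed

end

context tri_system
begin

lemma split_basis_iff:
  "split_basis \<theta> \<phi> u \<longleftrightarrow> basis d u \<and> matrix_wrt scale d u A = lower_bidiagonal_mat d \<theta> \<and>
     matrix_wrt scale d u As = upper_bidiagonal_mat d \<theta>s \<phi>"
proof (cases "basis d u")
  case True
  have 1: "coord d u (\<theta> k *s u k + (if k < d then u (k + 1) else 0)) i =
      lower_bidiagonal_mat d \<theta> $$ (i, k)" if "i \<le> d" "k \<le> d" for i k
    using that by (auto simp: lower_bidiagonal_mat_def coord_add[OF True] coord_scale[OF True] coord_basis[OF True])
  have 2: "coord d u (\<theta>s k *s u k + (if 0 < k then \<phi> k *s u (k - 1) else 0)) i =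
      upper_bidiagonal_mat d \<theta>s \<phi> $$ (i, k)" if "i \<le> d" "k \<le> d" for i k
    using that by (auto simp: upper_bidiagonal_mat_def coord_add[OF True] coord_scale[OF True] coord_basis[OF True])
  have eq: "B (u k) = z \<longleftrightarrow> (\<forall>i\<le>d. coord d u (B (u k)) i = coord d u z i)" for B :: "'b \<Rightarrow> 'b" and k z
    using coord_eqI[OF True] by blast
  have "matrix_wrt scale d u A = lower_bidiagonal_mat d \<theta> \<longleftrightarrow>
      (\<forall>k\<le>d. \<forall>i\<le>d. coord d u (A (u k)) i = lower_bidiagonal_mat d \<theta> $$ (i, k))"
    unfolding mat_eq_iff by (auto simp: matrix_wrt_crd lower_bidiagonal_mat_def less_Suc_eq_le)
  moreover have "matrix_wrt scale d u As = upper_bidiagonal_mat d \<theta>s \<phi> \<longleftrightarrow>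
      (\<forall>k\<le>d. \<forall>i\<le>d. coord d u (As (u k)) i = upper_bidiagonal_mat d \<theta>s \<phi> $$ (i, k))"
    unfolding mat_eq_iff by (auto simp: matrix_wrt_crd upper_bidiagonal_mat_def less_Suc_eq_le)
  ultimately show ?thesis using True unfolding split_basis_def eq by (simp add: 1 2)
qed (simp add: split_basis_def)

lemma split_basis_cong:
  assumes "split_basis \<theta> \<phi> u" "\<And>k. k \<le> d \<Longrightarrow> \<theta>' k = \<theta> k"
  shows "split_basis \<theta>' \<phi> u"
  using assms by (simp add: split_basis_def)

text \<open>Only \<open>l * l\<close> is tied to \<open>x\<close>, so the result holds for
  \<open>l\<close> and for \<open>- l\<close>. Since \<open>qeig\<close> is antisymmetric, the two
  choices list the eigenvalues in opposite orders.\<close>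

lemma geometric_split:
  assumes a: "\<And>i. i \<le> d \<Longrightarrow> a i = 0"
    and \<theta>s: "\<And>i. i \<le> d \<Longrightarrow> \<theta>s i = \<theta>s 0 + D * qnum h i"
    and nz: "\<And>k. 1 \<le> k \<Longrightarrow> k \<le> d \<Longrightarrow> qnum h k \<noteq> 0"
    and x: "\<And>k. 1 \<le> k \<Longrightarrow> k \<le> d \<Longrightarrow> x k = l * l * qnum h k * qnum h (d + 1 - k) * h ^ (d - k)"
  shows "split_basis (\<lambda>j. - l * qeig h d j) (\<lambda>k. - D * l * h ^ (k - 1) * qnum h k * qnum h (d + 1 - k))
    (\<lambda>j. \<Sum>i\<le>d. split_coeff l h d j i *s v i)"
proof -
  define u where "u j = (\<Sum>i\<le>d. split_coeff l h d j i *s v i)" for j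
  have cu: "c (u j) i = split_coeff l h d j i" if "i \<le> d" for i j
    unfolding u_def by (rule coord_combination[OF v that])
  have ub: "basis d u"
  proof (rule triangular_basis[OF v])
    show "c (u k) k \<noteq> 0" if "k \<le> d" for k using cu[OF that, of k] by simp
    show "c (u k) i = 0" if "k \<le> d" "k < i" for k i
      using cu[of i k] that split_coeff_beyond[of k i l h d] by (cases "i \<le> d") auto
  qed
  have ud: "u (Suc d) = 0"
    by (rule coord_eqI[OF v]) (simp add: cu del: split_coeff.simps, rule split_coeff_end)
  have Au: "A (u j) = (- l * qeig h d j) *s u j + u (Suc j)" if j: "j \<le> d" for j
  proof (rule coord_eqI[OF v])
    fix i assume i: "i \<le> d"
    have "c (u j) (i + 1) = split_coeff l h d j (i + 1)"
      using cu[of "i + 1" j] split_coeff_beyond[of j "i + 1" l h d] i j by (cases "i + 1 \<le> d") auto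
    then have "c (A (u j)) i = (if i = 0 then 0 else split_coeff l h d j (i - 1)) + x (i + 1) * split_coeff l h d j (i + 1)"
      using i a[OF i] cu[of "i - 1" j] by (simp add: c_A)
    also have "\<dots> = - l * qeig h d j * split_coeff l h d j i + split_coeff l h d (Suc j) i"
      by (rule split_coeff_A[OF nz x i j])
    finally show "c (A (u j)) i = c ((- l * qeig h d j) *s u j + u (Suc j)) i"
      using i by (simp add: c_simps cu del: split_coeff.simps)
  qed
  have Asu: "As (u j) = \<theta>s j *s u j + (if 0 < j then (- D * l * h ^ (j - 1) * qnum h j * qnum h (d + 1 - j)) *s u (j - 1) else 0)"
    if j: "j \<le> d" for j
  proof (rule coord_eqI[OF v])
    fix i assume i: "i \<le> d"
    show "c (As (u j)) i = c (\<theta>s j *s u j + (if 0 < j then (- D * l * h ^ (j - 1) * qnum h j * qnum h (d + 1 - j)) *s u (j - 1) else 0)) i"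
    proof (cases j)
      case 0
      then show ?thesis using i by (auto simp: c_As c_simps cu)
    next
      case (Suc m)
      show ?thesis
      proof (cases "i \<le> m")
        case True
        then obtain n where n: "m = i + n" using le_Suc_ex by blast
        have q: "qnum h (n + 1) \<noteq> 0" using nz[of "n + 1"] n Suc j by simp
        have "split_coeff l h d j i = l * h ^ n * qnum h j * qnum h (d - m) / qnum h (n + 1) * split_coeff l h d m i"
          using Suc True n by simp
        then have 1: "qnum h (n + 1) * split_coeff l h d j i = l * h ^ n * qnum h j * qnum h (d - m) * split_coeff l h d m i"
          using q by simp
        have "j = i + (n + 1)" using Suc n by simp
        \<comment> \<open>Multiplied by \<open>D\<close>, this gives
          \<open>\<theta>s j - \<theta>s i = D * h ^ i * qnum h (n + 1)\<close>; the last factor is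
          the denominator in \<open>split_coeff\<close>.\<close>
        then have qj: "qnum h j = qnum h i + h ^ i * qnum h (n + 1)"
          by (simp only: qnum_add power_qnum[of h i]) (simp add: algebra_simps)
        have "c (As (u j)) i - \<theta>s j * c (u j) i = - D * h ^ i * (qnum h (n + 1) * split_coeff l h d j i)"
          unfolding c_As cu[OF i] \<theta>s[OF i] \<theta>s[OF j] qj by (simp add: algebra_simps)
        also have "\<dots> = (- D * l * h ^ (j - 1) * qnum h j * qnum h (d + 1 - j)) * split_coeff l h d m i"
          unfolding 1 using Suc n by (simp add: power_add mult_ac del: split_coeff.simps)
        finally show ?thesis using Suc i by (simp add: c_simps cu del: split_coeff.simps) (simp add: algebra_simps del: split_coeff.simps)
      next
        case False
        then show ?thesis using Suc i split_coeff_beyond[of m i l h d]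
          by (auto simp: c_As c_simps cu split_coeff_beyond)
      qed
    qed
  qed
  show ?thesis
    unfolding split_basis_def u_def[symmetric]
  proof (intro conjI allI impI)
    show "basis d u" by (rule ub)
    show "A (u k) = (- l * qeig h d k) *s u k + (if k < d then u (k + 1) else 0)" if "k \<le> d" for k
      using Au[OF that] ud that by (cases "k = d") auto
  qed (use Asu in blast)
qed

end

context leonard_data
begin

lemma diag_A: "matrix_wrt scale d w A = diag_seq_mat d \<theta>"
  unfolding matrix_wrt_crd diag_seq_mat_def
  by (rule cong_mat) (auto simp: A_w coord_scale[OF w] coord_basis[OF w])

lemma standard_orderings: "standard_ordering scale d A As \<theta>" "standard_ordering scale d As A \<theta>s"
  unfolding standard_ordering_def using v w diag_A As_w diag_As irreducible_A by blast+

lemma leonard_pair: "leonard_pair scale d A As"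
  unfolding leonard_pair_iff_orderings using A As standard_orderings by blast

lemma parameter_array_iff:
  "parameter_array scale d A As \<theta> \<theta>s \<phi> \<psi> \<longleftrightarrow>
     (\<exists>u. split_basis \<theta> \<phi> u) \<and> (\<exists>t. split_basis (\<lambda>i. \<theta> (d - i)) \<psi> t)"
  unfolding parameter_array_def split_basis_iff using standard_orderings by blast

lemma parameter_array_exists: "\<exists>\<phi> \<psi>. parameter_array scale d A As \<theta> \<theta>s \<phi> \<psi>"
  unfolding parameter_array_iff using split_exists leonard_data.split_exists[OF reversed] by blast

lemma numbers:
  assumes "d \<ge> 3" "(2::'a) \<noteq> 0" "parameter_array scale d A As \<theta> \<theta>s \<phi> \<psi>"
  obtains \<beta> \<gamma> where "split_numbers d \<theta> \<theta>s a x (split_f \<phi>) (split_f \<psi>) \<beta> \<gamma>"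
proof -
  obtain u t where u: "split_basis \<theta> \<phi> u" and t: "split_basis (\<lambda>i. \<theta> (d - i)) \<psi> t"
    using assms(3) unfolding parameter_array_iff by blast
  obtain \<beta> \<gamma> where rec: "\<And>k. 1 \<le> k \<Longrightarrow> k < d \<Longrightarrow> \<theta> (k - 1) + \<theta> (k + 1) = \<beta> * \<theta> k + \<gamma>"
    "\<And>k. 1 \<le> k \<Longrightarrow> k + 2 \<le> d \<Longrightarrow>
      (\<theta>s k - \<theta>s (k - 1)) + (\<theta>s (k + 2) - \<theta>s (k + 1)) = \<beta> * (\<theta>s (k + 1) - \<theta>s k)"
    using three_term_recurrence[OF assms(1)] by blast
  have "split_numbers d \<theta> \<theta>s a x (split_f \<phi>) (split_f \<psi>) \<beta> \<gamma>"
  proof (rule split_numbers.intro)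
    show "x k = split_f \<psi> k * (split_f \<psi> (k - 1) * kap \<theta>s k - split_f \<psi> (k + 1) * kap \<theta>s (k + 1) + \<theta> (d + 1 - k) - a k)"
      if k: "1 \<le> k" "k \<le> d" for k
    proof -
      have e: "d + 1 - k = d - (k - 1)" using k by simp
      show ?thesis unfolding e by (rule split_relations(2)[OF \<theta>s_inj t k])
    qed
    show "x k = split_f \<phi> k * (split_f \<phi> (k - 1) * kap \<theta>s k - split_f \<phi> (k + 1) * kap \<theta>s (k + 1) + \<theta> (k - 1) - a k)"
      if k: "1 \<le> k" "k \<le> d" for k
      by (rule split_relations(2)[OF \<theta>s_inj u k])
    show "a k = \<theta> k + split_f \<phi> k - split_f \<phi> (k + 1)" if "k \<le> d" for k
      by (rule split_relations(1)[OF \<theta>s_inj u that])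
    show "a k = \<theta> (d - k) + split_f \<psi> k - split_f \<psi> (k + 1)" if "k \<le> d" for k
      by (rule split_relations(1)[OF \<theta>s_inj t that])
    show "split_f \<phi> 0 = 0" "split_f \<psi> 0 = 0" "split_f \<phi> (d + 1) = 0" "split_f \<psi> (d + 1) = 0"
      by (simp_all add: split_f_def)
  qed (fact assms(1,2) \<theta>_inj \<theta>s_inj rec x_nz)+
  then show thesis by (rule that)
qed

text \<open>The array chosen in the definition may order the eigenvalues differently. Its
  \<open>\<theta>'\<close> is also standard together with the present \<open>\<theta>s\<close>, and
  the recurrence for \<open>\<theta>s\<close> determines the constant.\<close>

lemma fundamental_constant_iff:
  assumes d: "d \<ge> 3" and two: "(2::'a) \<noteq> 0"
    and N: "split_numbers d \<theta> \<theta>s a x f g \<beta> \<gamma>"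
  shows "fundamental_constant scale d A As b \<longleftrightarrow> b = \<beta>"
proof
  interpret N: split_numbers d \<theta> \<theta>s a x f g \<beta> \<gamma> by (rule N)
  assume "b = \<beta>"
  moreover obtain \<phi> \<psi> where "parameter_array scale d A As \<theta> \<theta>s \<phi> \<psi>"
    using parameter_array_exists by blast
  moreover have "\<forall>i\<in>{2..d - 1}. (\<theta> (i - 2) - \<theta> (i + 1)) / (\<theta> (i - 1) - \<theta> i) = \<beta> + 1 \<and>
      (\<theta>s (i - 2) - \<theta>s (i + 1)) / (\<theta>s (i - 1) - \<theta>s i) = \<beta> + 1"
  proof
    fix i assume "i \<in> {2..d - 1}"
    then have "2 \<le> i" "i < d" using d by auto
    then show "(\<theta> (i - 2) - \<theta> (i + 1)) / (\<theta> (i - 1) - \<theta> i) = \<beta> + 1 \<and>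
        (\<theta>s (i - 2) - \<theta>s (i + 1)) / (\<theta>s (i - 1) - \<theta>s i) = \<beta> + 1"
      by (intro conjI N.fundamental_ratios)
  qed
  ultimately show "fundamental_constant scale d A As b"
    using d unfolding fundamental_constant_def by blast
next
  interpret N: split_numbers d \<theta> \<theta>s a x f g \<beta> \<gamma> by (rule N)
  assume "fundamental_constant scale d A As b"
  then obtain \<theta>' \<theta>s' \<phi> \<psi> where P: "parameter_array scale d A As \<theta>' \<theta>s' \<phi> \<psi>"
    and r: "\<And>i. i \<in> {2..d - 1} \<Longrightarrow> (\<theta>' (i - 2) - \<theta>' (i + 1)) / (\<theta>' (i - 1) - \<theta>' i) = b + 1"
    unfolding fundamental_constant_def by blast
  obtain v' a' x' w' where D: "leonard_data scale d A As v' \<theta>s a' x' w' \<theta>'"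
    using leonard_data_of_orderings[OF A As _ standard_orderings(2), of \<theta>'] P
    unfolding parameter_array_def by blast
  interpret D: leonard_data scale d A As v' \<theta>s a' x' w' \<theta>' by (rule D)
  obtain \<phi>' \<psi>' where P': "parameter_array scale d A As \<theta>' \<theta>s \<phi>' \<psi>'"
    using D.parameter_array_exists by blast
  obtain \<beta>' \<gamma>' where N': "split_numbers d \<theta>' \<theta>s a' x' (D.split_f \<phi>') (D.split_f \<psi>') \<beta>' \<gamma>'"
    using D.numbers[OF d two P'] by blast
  interpret N': split_numbers d \<theta>' \<theta>s a' x' "D.split_f \<phi>'" "D.split_f \<psi>'" \<beta>' \<gamma>' by (rule N')
  have "\<beta>' * (\<theta>s 2 - \<theta>s 1) = \<beta> * (\<theta>s 2 - \<theta>s 1)"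
    using N.\<theta>s_rec[of 1] N'.\<theta>s_rec[of 1] d by (auto simp: numeral_2_eq_2)
  then have "\<beta>' = \<beta>" using N.\<theta>s_neq[of 2 1] d by simp
  moreover have "\<beta>' + 1 = b + 1" using N'.fundamental_ratios(1)[of 2] r[of 2] d by simp
  ultimately show "b = \<beta>" by simp
qed

text \<open>Cases (ii) and (iii) of the converse both end here, with \<open>h = 1\<close> for the
  latter. The constant \<open>p\<close> is neither 0 nor 1 because \<open>f 1\<close> and
  \<open>g 1\<close> are nonzero, so the square root \<open>l\<close> is nonzero as well.\<close>

lemma near_bipartite_geometric:
  assumes alg: "\<And>y :: 'a. \<exists>r. r * r = y"
    and N: "split_numbers d \<theta> \<theta>s a x f g \<beta> \<gamma>"
    and h: "\<And>k. 1 \<le> k \<Longrightarrow> k < d \<Longrightarrow> \<theta>s (k + 1) - \<theta>s (k + 1 - 1) = h * (\<theta>s k - \<theta>s (k - 1))"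
    and p: "\<And>k. 1 \<le> k \<Longrightarrow> k \<le> d \<Longrightarrow> f k = p * (f k - g k)"
    and pow: "\<And>i. 1 \<le> i \<Longrightarrow> i < d \<Longrightarrow> h ^ i \<noteq> - 1"
  shows "near_bipartite scale d A As"
proof -
  interpret N: split_numbers d \<theta> \<theta>s a x f g \<beta> \<gamma> by (rule N)
  have p': "f k = p * N.T k" if "1 \<le> k" "k \<le> d" for k using p[OF that] by (simp add: N.T_def)
  have qnz: "qnum h k \<noteq> 0" if "1 \<le> k" "k \<le> d" for k by (rule N.qnum_nz[OF h that])
  have h0: "h \<noteq> 0" using N.geometric_\<beta>(1)[OF h] by blast
  have "f 1 \<noteq> 0" "g 1 \<noteq> 0" using N.f_nz[of 1] N.g_nz[of 1] N.d3 by simp_all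
  moreover have "f 1 = p * (f 1 - g 1)" using p[of 1] N.d3 by simp
  ultimately have p01: "p \<noteq> 0" "1 - p \<noteq> 0" by auto
  obtain l where l: "l * l = p * (1 - p) * (N.u 0 / qnum h d)\<^sup>2" using alg by blast
  have l0: "l \<noteq> 0" using l p01 N.u_0 qnz[of d] N.d3 by auto
  have x: "x k = l * l * qnum h k * qnum h (d + 1 - k) * h ^ (d - k)" if "1 \<le> k" "k \<le> d" for k
    by (rule N.x_geometric[OF h p' l that])
  have \<theta>s: "\<theta>s i = \<theta>s 0 + (\<theta>s 1 - \<theta>s 0) * qnum h i" if "i \<le> d" for i
    using N.\<theta>s_geometric[OF h that] by simp
  have D: "\<theta>s 1 - \<theta>s 0 \<noteq> 0" using N.\<theta>s_neq[of 1 0] N.d3 by simp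
  interpret B: tri_system scale d "\<lambda>y. A y - flat_part scale A As y" As v \<theta>s "\<lambda>_. 0" x
    by (rule flat_part_removed[OF \<theta>s_inj])
  let ?t = "\<lambda>j. - l * qeig h d j"
  let ?\<phi> = "\<lambda>l k. - (\<theta>s 1 - \<theta>s 0) * l * h ^ (k - 1) * qnum h k * qnum h (d + 1 - k)"
  have 1: "B.split_basis ?t (?\<phi> l) (\<lambda>j. \<Sum>i\<le>d. split_coeff l h d j i *s v i)"
    by (rule B.geometric_split[OF refl \<theta>s qnz x])
  have x': "x k = (- l) * (- l) * qnum h k * qnum h (d + 1 - k) * h ^ (d - k)" if "1 \<le> k" "k \<le> d" for k
    using x[OF that] by simp
  have 2: "B.split_basis (\<lambda>j. - (- l) * qeig h d j) (?\<phi> (- l)) (\<lambda>j. \<Sum>i\<le>d. split_coeff (- l) h d j i *s v i)"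
    by (rule B.geometric_split[OF refl \<theta>s qnz x'])
  have 3: "B.split_basis (\<lambda>j. ?t (d - j)) (?\<phi> (- l)) (\<lambda>j. \<Sum>i\<le>d. split_coeff (- l) h d j i *s v i)"
    by (rule B.split_basis_cong[OF 2]) (simp add: qeig_anti)
  have inj: "inj_on ?t {..d}"
    using qeig_inj[OF N.two h0 qnz pow] l0 by (auto simp: inj_on_def)
  have nz: "?\<phi> r k \<noteq> 0" if "r \<noteq> 0" "1 \<le> k" "k \<le> d" for r k
    using that D h0 qnz[of k] qnz[of "d + 1 - k"] by auto
  obtain w' where "leonard_data scale d (\<lambda>y. A y - flat_part scale A As y) As v \<theta>s (\<lambda>_. 0) x w' ?t"
    using B.leonard_data_from_splits[OF 1 3 inj nz nz] l0 by auto
  then show ?thesis unfolding near_bipartite_def by (rule leonard_data.leonard_pair)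
qed

end

section \<open>Near-bipartite Leonard pairs\<close>

context leonard_data
begin

lemma essentially_bipartite_iff:
  "essentially_bipartite scale A As \<longleftrightarrow> (\<forall>i\<le>d. a i = a 0)"
proof
  assume "essentially_bipartite scale A As"
  then obtain r where r: "flat_part scale A As = (\<lambda>y. r *s y)" by (auto simp: essentially_bipartite_def)
  have "a i = r" if "i \<le> d" for i
  proof -
    have "a i *s v i = r *s v i"
      using fun_cong[OF r, of "v i"] combination_v[OF that] by (simp add: flat_part_eq[OF \<theta>s_inj])
    then show ?thesis using basis_nonzero[OF v that] by simp
  qed
  then show "\<forall>i\<le>d. a i = a 0" by simp
next
  assume a: "\<forall>i\<le>d. a i = a 0"
  have "flat_part scale A As y = a 0 *s y" for y
  proof (rule coord_eqI[OF v])
    show "c (flat_part scale A As y) i = c (a 0 *s y) i" if "i \<le> d" for i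
      unfolding flat_part_eq[OF \<theta>s_inj] coord_combination[OF v that] c_simps by (simp only: a[rule_format, OF that])
  qed
  then show "essentially_bipartite scale A As" by (auto simp: essentially_bipartite_def)
qed

lemma essentially_bipartite_imp_near_bipartite:
  assumes "essentially_bipartite scale A As"
  shows "near_bipartite scale d A As"
proof -
  obtain r where r: "flat_part scale A As = (\<lambda>y. r *s y)" using assms by (auto simp: essentially_bipartite_def)
  interpret B: tri_system scale d "\<lambda>y. A y - flat_part scale A As y" As v \<theta>s "\<lambda>_. 0" x
    by (rule flat_part_removed[OF \<theta>s_inj])
  have "leonard_data scale d (\<lambda>y. A y - flat_part scale A As y) As v \<theta>s (\<lambda>_. 0) x w (\<lambda>i. \<theta> i - r)"
    by unfold_locales (use w As_w A_w in \<open>auto simp: r scale_left_diff_distrib\<close>)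
  then show ?thesis unfolding near_bipartite_def by (rule leonard_data.leonard_pair)
qed

lemma near_bipartite_imp:
  assumes d: "d \<ge> 3" and two: "(2::'a) \<noteq> 0" and alg: "\<And>y :: 'a. \<exists>r. r * r = y"
    and nb: "near_bipartite scale d A As" and neb: "\<not> essentially_bipartite scale A As"
  shows "reinforced_dual_q_Krawtchouk_type scale d A As \<or> Krawtchouk_type scale d A As"
proof -
  obtain \<phi> \<psi> where P: "parameter_array scale d A As \<theta> \<theta>s \<phi> \<psi>"
    using parameter_array_exists by blast
  obtain \<beta> \<gamma> where N: "split_numbers d \<theta> \<theta>s a x (split_f \<phi>) (split_f \<psi>) \<beta> \<gamma>"
    using numbers[OF d two P] by blast
  interpret N: split_numbers d \<theta> \<theta>s a x "split_f \<phi>" "split_f \<psi>" \<beta> \<gamma> by (rule N)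
  let ?A = "\<lambda>y. A y - flat_part scale A As y"
  have T: "tri_system scale d ?A As v \<theta>s (\<lambda>_. 0) x" by (rule flat_part_removed[OF \<theta>s_inj])
  obtain \<theta>' where "standard_ordering scale d ?A As \<theta>'"
    using nb unfolding near_bipartite_def leonard_pair_iff_orderings by blast
  then obtain w' where w': "basis d w'" "matrix_wrt scale d w' ?A = diag_seq_mat d \<theta>'"
    "irreducible_tridiagonal (matrix_wrt scale d w' As)"
    by (auto simp: standard_ordering_def)
  have D: "leonard_data scale d ?A As v \<theta>s (\<lambda>_. 0) x w' \<theta>'"
    using T w' diag_seq_matD[OF w'(1,2)] by (simp add: leonard_data_def leonard_data_axioms_def)
  interpret D: leonard_data scale d ?A As v \<theta>s "\<lambda>_. 0" x w' \<theta>' by (rule D)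
  obtain \<phi>' \<psi>' where P': "parameter_array scale d ?A As \<theta>' \<theta>s \<phi>' \<psi>'"
    using D.parameter_array_exists by blast
  obtain \<beta>' \<gamma>' where N': "split_numbers d \<theta>' \<theta>s (\<lambda>_. 0) x (D.split_f \<phi>') (D.split_f \<psi>') \<beta>' \<gamma>'"
    using D.numbers[OF d two P'] by blast
  interpret N': split_numbers d \<theta>' \<theta>s "\<lambda>_. 0" x "D.split_f \<phi>'" "D.split_f \<psi>'" \<beta>' \<gamma>' by (rule N')
  \<comment> \<open>Both pairs have the same \<open>\<theta>s\<close>, whose recurrence determines
    the constant.\<close>
  have "\<beta>' * (\<theta>s 2 - \<theta>s 1) = \<beta> * (\<theta>s 2 - \<theta>s 1)"
    using N.\<theta>s_rec[of 1] N'.\<theta>s_rec[of 1] d by (auto simp: numeral_2_eq_2)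
  then have "\<beta>' = \<beta>" using N.\<theta>s_neq[of 2 1] d by simp
  then have N'': "split_numbers d \<theta>' \<theta>s (\<lambda>_. 0) x (D.split_f \<phi>') (D.split_f \<psi>') \<beta> \<gamma>'" using N' by simp
  have anti: "\<theta>' (d - k) = - \<theta>' k" if "k \<le> d" for k
    by (rule D.bipartite_eigenvalues) (use two d that in auto)
  have nc: "\<not> (\<forall>k\<le>d. a k = a 0)" using neb by (simp add: essentially_bipartite_iff)
  obtain h r where h: "\<And>k. 1 \<le> k \<Longrightarrow> k < d \<Longrightarrow> \<theta>s (k + 1) - \<theta>s (k + 1 - 1) = h * (\<theta>s k - \<theta>s (k - 1))"
    and r: "\<And>k. 1 \<le> k \<Longrightarrow> k \<le> d \<Longrightarrow> split_f \<phi> k = r * split_f \<psi> k"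
    and K: "\<And>k. \<beta> = 2 \<Longrightarrow> 1 \<le> k \<Longrightarrow> k \<le> d \<Longrightarrow> \<theta> k - \<theta> (k - 1) = \<theta> 1 - \<theta> 0"
    and pow: "\<And>i. \<beta> \<noteq> 2 \<Longrightarrow> 1 \<le> i \<Longrightarrow> i < d \<Longrightarrow> h ^ i \<noteq> - 1"
    using N.near_bipartite_numbers[OF N'' refl anti nc] by blast
  have h0: "h \<noteq> 0" and h\<beta>: "\<beta> = h + inverse h" "\<beta> \<noteq> - 2" and h1: "\<beta> = 2 \<Longrightarrow> h = 1"
    using N.geometric_\<beta>[OF h] by blast+
  have fc: "fundamental_constant scale d A As \<beta>"
    using fundamental_constant_iff[OF d two N] by blast
  show ?thesis
  proof (cases "\<beta> = 2")
    case True
    have "1 \<le> k \<Longrightarrow> k \<le> d \<Longrightarrow> \<theta>s k - \<theta>s (k - 1) = \<theta>s 1 - \<theta>s 0" for k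
    proof (induction k rule: nat_induct_at_least)
      case (Suc k)
      then show ?case using h[of k] h1[OF True] by simp
    qed simp
    then have "Krawtchouk_type scale d A As"
      unfolding Krawtchouk_type_def type_II_def using fc True P K[OF True]
      by (metis atLeastAtMost_iff)
    then show ?thesis by blast
  next
    case False
    have I: "type_I scale d A As" unfolding type_I_def using fc False h\<beta>(2) by blast
    have "(\<theta>s (i - 1) - \<theta>s i) / (\<theta>s i - \<theta>s (i + 1)) = inverse h" if "i \<in> {1..d - 1}" for i
    proof -
      have i: "1 \<le> i" "i < d" using that d by auto
      have nz: "\<theta>s i - \<theta>s (i + 1) \<noteq> 0" using N.\<theta>s_neq[of i "i + 1"] i by simp
      have "\<theta>s i - \<theta>s (i + 1) = h * (\<theta>s (i - 1) - \<theta>s i)" using h[OF i] by (simp add: algebra_simps)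
      then have "inverse h * (\<theta>s i - \<theta>s (i + 1)) = \<theta>s (i - 1) - \<theta>s i" using h0 by simp
      then show ?thesis using nz by (simp add: divide_eq_eq)
    qed
    moreover have "\<phi> i / \<psi> i = r" if "i \<in> {1..d}" for i
    proof -
      have i: "1 \<le> i" "i \<le> d" using that by auto
      have nz: "\<theta>s i - \<theta>s (i - 1) \<noteq> 0" using N.\<theta>s_neq[of i "i - 1"] i by simp
      have "\<psi> i \<noteq> 0" using N.g_nz[OF i] i by (auto simp: split_f_def)
      moreover have "\<phi> i = r * \<psi> i" using r[OF i] i nz by (simp add: split_f_def)
      ultimately show ?thesis by simp
    qed
    ultimately have dq: "dual_q_Krawtchouk_type scale d A As"
      unfolding dual_q_Krawtchouk_type_def using I P by blast
    \<comment> \<open>Since \<open>\<beta> = h + inverse h\<close>, a square root of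
      \<open>h\<close> is an admissible \<open>q\<close>, and the condition on
      \<open>q ^ (2 * i)\<close> becomes the one on \<open>h ^ i\<close>.\<close>
    obtain q where q: "q * q = h" using alg by blast
    then have q2: "q ^ 2 = h" by (simp add: power2_eq_square)
    have "q \<noteq> 0" using q h0 by auto
    moreover have "q ^ (2 * i) \<noteq> - 1" if "i \<in> {1..d - 1}" for i
    proof -
      have "1 \<le> i" "i < d" using that d by auto
      then show ?thesis using pow[OF False] unfolding power_mult q2 by blast
    qed
    ultimately have "reinforced_dual_q_Krawtchouk_type scale d A As"
      unfolding reinforced_dual_q_Krawtchouk_type_def using dq fc h\<beta>(1) q2 by blast
    then show ?thesis by blast
  qed
qed

lemma Krawtchouk_imp_near_bipartite:
  assumes d: "d \<ge> 3" and two: "(2::'a) \<noteq> 0" and alg: "\<And>y :: 'a. \<exists>r. r * r = y"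
    and P: "parameter_array scale d A As \<theta> \<theta>s \<phi> \<psi>"
    and \<theta>: "\<And>i. 1 \<le> i \<Longrightarrow> i \<le> d \<Longrightarrow> \<theta> i - \<theta> (i - 1) = e"
    and \<theta>s: "\<And>i. 1 \<le> i \<Longrightarrow> i \<le> d \<Longrightarrow> \<theta>s i - \<theta>s (i - 1) = e'"
  shows "near_bipartite scale d A As"
proof -
  obtain \<beta> \<gamma> where N: "split_numbers d \<theta> \<theta>s a x (split_f \<phi>) (split_f \<psi>) \<beta> \<gamma>"
    using numbers[OF d two P] by blast
  interpret N: split_numbers d \<theta> \<theta>s a x "split_f \<phi>" "split_f \<psi>" \<beta> \<gamma> by (rule N)
  have "\<theta>s (k + 1) - \<theta>s (k + 1 - 1) = \<theta>s k - \<theta>s (k - 1)" if "1 \<le> k" "k < d" for k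
    using \<theta>s[of k] \<theta>s[of "k + 1"] that by simp
  then obtain p where p: "\<And>k. 1 \<le> k \<Longrightarrow> k \<le> d \<Longrightarrow> split_f \<phi> k = p * N.T k"
    using N.f_proportional[of e] \<theta> by blast
  show ?thesis
  proof (rule near_bipartite_geometric[OF alg N, of 1 p])
    show "\<theta>s (k + 1) - \<theta>s (k + 1 - 1) = 1 * (\<theta>s k - \<theta>s (k - 1))" if "1 \<le> k" "k < d" for k
      using \<theta>s[of k] \<theta>s[of "k + 1"] that by simp
    show "split_f \<phi> k = p * (split_f \<phi> k - split_f \<psi> k)" if "1 \<le> k" "k \<le> d" for k
      using p[OF that] by (simp add: N.T_def)
    show "1 ^ i \<noteq> (- 1 :: 'a)" for i :: nat
      using two by (metis eq_neg_iff_add_eq_0 one_add_one power_one)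
  qed
qed

lemma dual_q_Krawtchouk_imp_near_bipartite:
  assumes d: "d \<ge> 3" and two: "(2::'a) \<noteq> 0" and alg: "\<And>y :: 'a. \<exists>r. r * r = y"
    and P: "parameter_array scale d A As \<theta> \<theta>s \<phi> \<psi>"
    and \<theta>s: "\<And>i. i \<in> {1..d - 1} \<Longrightarrow> (\<theta>s (i - 1) - \<theta>s i) / (\<theta>s i - \<theta>s (i + 1)) = e"
    and \<phi>: "\<And>i. i \<in> {1..d} \<Longrightarrow> \<phi> i / \<psi> i = r"
    and fc: "fundamental_constant scale d A As b" and q: "q \<noteq> 0" "b = q ^ 2 + inverse (q ^ 2)"
    and pow: "\<And>i. i \<in> {1..d - 1} \<Longrightarrow> q ^ (2 * i) \<noteq> - 1"
  shows "near_bipartite scale d A As"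
proof -
  obtain \<beta> \<gamma> where N: "split_numbers d \<theta> \<theta>s a x (split_f \<phi>) (split_f \<psi>) \<beta> \<gamma>"
    using numbers[OF d two P] by blast
  interpret N: split_numbers d \<theta> \<theta>s a x "split_f \<phi>" "split_f \<psi>" \<beta> \<gamma> by (rule N)
  define h where "h = inverse e"
  have h: "\<theta>s (k + 1) - \<theta>s (k + 1 - 1) = h * (\<theta>s k - \<theta>s (k - 1))" if k: "1 \<le> k" "k < d" for k
  proof -
    have n: "\<theta>s k - \<theta>s (k + 1) \<noteq> 0" "\<theta>s (k - 1) - \<theta>s k \<noteq> 0"
      using N.\<theta>s_neq[of k "k + 1"] N.\<theta>s_neq[of "k - 1" k] k by auto
    have "\<theta>s (k - 1) - \<theta>s k = e * (\<theta>s k - \<theta>s (k + 1))"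
      using \<theta>s[of k] n k by (auto simp: divide_eq_eq)
    moreover from this have "e \<noteq> 0" using n by auto
    ultimately have "\<theta>s k - \<theta>s (k + 1) = h * (\<theta>s (k - 1) - \<theta>s k)" by (simp add: h_def)
    then show ?thesis by (simp add: algebra_simps)
  qed
  have T: "N.T k \<noteq> 0" if "1 \<le> k" "k \<le> d" for k by (rule N.T_geometric_nz[OF h that])
  have fr: "split_f \<phi> k = r * split_f \<psi> k" if k: "1 \<le> k" "k \<le> d" for k
  proof -
    have "\<psi> k \<noteq> 0" using N.g_nz[OF k] k by (auto simp: split_f_def)
    then have "\<phi> k = r * \<psi> k" using \<phi>[of k] k by (auto simp: divide_eq_eq)
    then show ?thesis by (simp add: split_f_def)
  qed
  have "1 \<le> d" using d by simp
  \<comment> \<open>For \<open>r = 1\<close> the two split sequences would agree at 1, so that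
    \<open>T 1 = 0\<close>.\<close>
  then have "r \<noteq> 1" using fr[of 1] T[of 1] by (auto simp: N.T_def)
  then have r1: "r - 1 \<noteq> 0" by simp
  have b: "b = \<beta>" using fc fundamental_constant_iff[OF d two N] by blast
  have hb: "h \<noteq> 0" "1 + h * h = \<beta> * h" using N.geometric_\<beta>[OF h] by blast+
  define y where "y = q ^ 2"
  have y: "y * inverse y = 1" using q(1) by (simp add: y_def)
  \<comment> \<open>\<open>h\<close> and \<open>y\<close> are roots of the same polynomial
    \<open>t * t - \<beta> * t + 1\<close>, so \<open>h\<close> is \<open>y\<close> or its inverse;
    inversion does not affect which powers equal -1.\<close>
  have "(h - y) * (h - inverse y) = 0"
    using hb(2) y b q(2) unfolding y_def[symmetric] by Groebner_Basis.algebra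
  then have hy: "h = y \<or> h = inverse y" by simp
  show ?thesis
  proof (rule near_bipartite_geometric[OF alg N h, of "r / (r - 1)"])
    show "split_f \<phi> k = r / (r - 1) * (split_f \<phi> k - split_f \<psi> k)" if k: "1 \<le> k" "k \<le> d" for k
      unfolding fr[OF k] using r1 by (simp add: field_simps)
    show "h ^ i \<noteq> - 1" if i: "1 \<le> i" "i < d" for i
    proof
      assume "h ^ i = - 1"
      then have "y ^ i = - 1" using hy
        by (metis inverse_inverse_eq inverse_minus_eq inverse_1 power_inverse)
      moreover have "i \<in> {1..d - 1}" using i by auto
      ultimately show False using pow[of i] by (simp add: y_def power_mult)
    qed
  qed
qed

end

theorem theorem25p1:
  fixes scale :: "'a::alg_closed_field \<Rightarrow> 'v::ab_group_add \<Rightarrow> 'v"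
    and A As :: "'v \<Rightarrow> 'v" and d :: nat
  assumes "vector_space scale"
    and "CHAR('a) \<noteq> 2"
    and "d \<ge> 3"
    and "leonard_pair scale d A As"
  shows "near_bipartite scale d A As \<longleftrightarrow>
      essentially_bipartite scale A As \<or>
      reinforced_dual_q_Krawtchouk_type scale d A As \<or>
      Krawtchouk_type scale d A As"
proof -
  interpret vspace scale using assms(1) by (simp add: vspace_def)
  have two: "(2::'a) \<noteq> 0"
  proof
    assume "(2::'a) = 0"
    then have "of_nat 2 = (0::'a)" by simp
    then have "CHAR('a) dvd 2" by (simp only: of_nat_eq_0_iff_char_dvd)
    then have "CHAR('a) = 1 \<or> CHAR('a) = 2" using prime_nat_iff two_is_prime_nat by blast
    then show False using assms(2) CHAR_not_1 by auto
  qed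
  have alg: "\<exists>r. r * r = y" for y :: 'a
    using nth_root_exists[of 2 y] by (auto simp: power2_eq_square)
  have lp: "lin A" "lin As" using assms(4) by (auto simp: leonard_pair_def)
  obtain \<theta> \<theta>s where "standard_ordering scale d A As \<theta>" "standard_ordering scale d As A \<theta>s"
    using assms(4) unfolding leonard_pair_iff_orderings by blast
  then obtain v a x w where D: "leonard_data scale d A As v \<theta>s a x w \<theta>"
    using leonard_data_of_orderings[OF lp] by blast
  show ?thesis
  proof (intro iffI)
    assume "near_bipartite scale d A As"
    then show "essentially_bipartite scale A As \<or> reinforced_dual_q_Krawtchouk_type scale d A As \<or>
        Krawtchouk_type scale d A As"
      using leonard_data.near_bipartite_imp[OF D assms(3) two alg] by blast
  next
    assume "essentially_bipartite scale A As \<or> reinforced_dual_q_Krawtchouk_type scale d A As \<or>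
        Krawtchouk_type scale d A As"
    then consider (bip) "essentially_bipartite scale A As"
      | (dualq) "reinforced_dual_q_Krawtchouk_type scale d A As"
      | (Kraw) "Krawtchouk_type scale d A As" by blast
    then show "near_bipartite scale d A As"
    proof cases
      case bip
      then show ?thesis by (rule leonard_data.essentially_bipartite_imp_near_bipartite[OF D])
    next
      case dualq
      then obtain \<beta> q where q: "fundamental_constant scale d A As \<beta>" "q \<noteq> 0" "\<beta> = q ^ 2 + inverse (q ^ 2)"
        "\<And>i. i \<in> {1..d - 1} \<Longrightarrow> q ^ (2 * i) \<noteq> - 1" and dq: "dual_q_Krawtchouk_type scale d A As"
        unfolding reinforced_dual_q_Krawtchouk_type_def by blast
      obtain \<theta> \<theta>s \<phi> \<psi> e r where P: "parameter_array scale d A As \<theta> \<theta>s \<phi> \<psi>"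
        and e: "\<And>i. i \<in> {1..d - 1} \<Longrightarrow> (\<theta>s (i - 1) - \<theta>s i) / (\<theta>s i - \<theta>s (i + 1)) = e"
        and r: "\<And>i. i \<in> {1..d} \<Longrightarrow> \<phi> i / \<psi> i = r"
        using dq unfolding dual_q_Krawtchouk_type_def by blast
      \<comment> \<open>The type may be witnessed by orderings other than those fixed above, so the
        bases are chosen anew for this array.\<close>
      obtain v a x w where D: "leonard_data scale d A As v \<theta>s a x w \<theta>"
        using leonard_data_of_orderings[OF lp] P unfolding parameter_array_def by blast
      show ?thesis
        by (rule leonard_data.dual_q_Krawtchouk_imp_near_bipartite[OF D assms(3) two alg P e r q])
    next
      case Kraw
      then obtain \<theta> \<theta>s \<phi> \<psi> e e' where P: "parameter_array scale d A As \<theta> \<theta>s \<phi> \<psi>"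
        and e: "\<And>i. i \<in> {1..d} \<Longrightarrow> \<theta> i - \<theta> (i - 1) = e"
        and e': "\<And>i. i \<in> {1..d} \<Longrightarrow> \<theta>s i - \<theta>s (i - 1) = e'"
        unfolding Krawtchouk_type_def by blast
      obtain v a x w where D: "leonard_data scale d A As v \<theta>s a x w \<theta>"
        using leonard_data_of_orderings[OF lp] P unfolding parameter_array_def by blast
      show ?thesis
        by (rule leonard_data.Krawtchouk_imp_near_bipartite[OF D assms(3) two alg P])
          (use e e' in auto)
    qed
  qed
qed

end
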